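(* Let $f$ satisfy the Standing Assumption in the context, let $m_0\in\mathbb{R}^D$, let $C_0\in\mathbb{R}^{D\times D}$ be positive semi-definite, and let $m:[0,T]\to\mathbb{R}^D$ be the solution of $\frac{dm}{dt}=f(m)$, $m(0)=m_0$. For $\epsilon>0$ let $\mu^\epsilon$ be the law in $C([0,T],\mathbb{R}^D)$ of the solution $v^\epsilon$ of $$dv^\epsilon(t)=f\bigl(v^\epsilon(t)\bigr)\,dt+\sqrt{\epsilon\Sigma}\,dW(t),\quad t\in[0,T],\qquad v^\epsilon(0)\sim\mu_0^\epsilon,$$ and let $\nu^\epsilon$ be the law in $C([0,T],\mathbb{R}^D)$ of the solution $l^\epsilon$ of the linear SDE $$dl^\epsilon(t)=\Bigl(f\bigl(m(t)\bigr)+Df\bigl(m(t)\bigr)\bigl(l^\epsilon(t)-m(t)\bigr)\Bigr)dt+\sqrt{\epsilon\Sigma}\,dW(t),\qquad l^\epsilon(0)\sim N(m_0,\epsilon C_0).$$ Then there is $c>0$ (independent of $\epsilon$) such that, for all $\epsilon>0$ sufficiently small, $$D_{\mathrm{KL}}(\nu^\epsilon\|\mu^\epsilon)\le D_{\mathrm{KL}}(\nu_0^\epsilon\|\mu_0^\epsilon)+c\,\epsilon .$$ Moreover, for all $t\in[0,T]$, $$D_{\mathrm{KL}}(\nu_t^\epsilon\|\mu_t^\epsilon)\le D_{\mathrm{KL}}(\nu_0^\epsilon\|\mu_0^\epsilon)+c\,\epsilon,$$ where $\nu_t^\epsilon$ and $\mu_t^\epsilon$ denote the time-marginals of $\nu^\epsilon$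 and $\mu^\epsilon$ at time $t$.
   Context: $T>0$ is finite and fixed; $D\in\mathbb{N}$; $\Sigma\in\mathbb{R}^{D\times D}$ is a fixed (symmetric) positive-definite matrix; $W$ is a standard $D$-dimensional Wiener process, independent of the initial condition; $\mu_0^\epsilon$ is a probability measure on $\mathbb{R}^D$ for each $\epsilon>0$. It is assumed that the SDE for $v^\epsilon$ has solution paths that are continuous on $[0,T]$. Standing Assumption: $f\in C^2(\mathbb{R}^D,\mathbb{R}^D)$ and there exist a constant $c>0$ and $s\in\mathbb{N}$ such that, for $1\le d\le D$ and every multi-index $\alpha$ with $|\alpha|=2$, $|\partial^\alpha f_d(u)|\le c(1+|u|^s)$ for all $u\in\mathbb{R}^D$. Moreover, for any $m_0\in\mathbb{R}^D$, the ODE $\frac{dm}{dt}=f(m)$, $t\in[0,T]$, $m(0)=m_0$, has a unique solution on $[0,T]$. $Df$ denotes the Jacobian of $f$. For a measure $\mu$ on $C([0,T],\mathbb{R}^D)$ and $t\in[0,T]$, $\mu_t$ is the push-forward of $\mu$ under the evaluation map $h\mapsto h(t)$. The Kullback-Leibler divergence is $D_{\mathrm{KL}}(\nu\|\mu)=\mathbb{E}^\nu\log\frac{d\nu}{d\mu}$ if $\nu\ll\mu$, and $+\infty$ otherwise. $N(m_0,\epsilon C_0)$ is the (possibly degenerate) Gaussian measure with that mean and covariance; it is the Dirac measure at $m_0$ if $C_0=0$. Here $\nu_0^\epsilon=N(m_0,\epsilon C_0)$. *)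

theory Defs
  imports "HOL-Probability.Probability"
begin

definition partial :: "'n \<Rightarrow> (real ^ 'n::finite \<Rightarrow> real) \<Rightarrow> real ^ 'n \<Rightarrow> real" where
  "partial i g x = frechet_derivative g (at x) (axis i 1)"

primrec C_class :: "nat \<Rightarrow> (real ^ 'n::finite \<Rightarrow> real) \<Rightarrow> bool" where
  "C_class 0 g \<longleftrightarrow> continuous_on UNIV g"
| "C_class (Suc k) g \<longleftrightarrow> (\<forall>x. g differentiable (at x)) \<and> (\<forall>i. C_class k (partial i g))"

definition ode_solution ::
    "real \<Rightarrow> (real ^ 'n::finite \<Rightarrow> real ^ 'n) \<Rightarrow> real ^ 'n \<Rightarrow> (real \<Rightarrow> real ^ 'n) \<Rightarrow> bool" where
  "ode_solution T f m0 m \<longleftrightarrow>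
     m 0 = m0 \<and> (\<forall>t\<in>{0..T}. (m has_vector_derivative f (m t)) (at t within {0..T}))"

text \<open>A multi-index of order two is a sum of two unit multi-indices, so the derivatives of
  order two are exactly the iterated partial derivatives below. Solutions of the ODE are
  functions on the whole real line of which only the restriction to \<open>[0,T]\<close> matters; hence
  uniqueness is agreement on that interval.\<close>

definition standing_assumption :: "real \<Rightarrow> (real ^ 'n::finite \<Rightarrow> real ^ 'n) \<Rightarrow> bool" where
  "standing_assumption T f \<longleftrightarrow>
     (\<forall>d. C_class 2 (\<lambda>x. f x $ d)) \<and>
     (\<exists>c>0. \<exists>s::nat. \<forall>d i j u.
        \<bar>partial i (partial j (\<lambda>x. f x $ d)) u\<bar> \<le> c * (1 + norm u ^ s)) \<and>
     (\<forall>m0. \<exists>m. ode_solution T f m0 m \<and>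
        (\<forall>m'. ode_solution T f m0 m' \<longrightarrow> (\<forall>t\<in>{0..T}. m' t = m t)))"

definition pos_semidef :: "real ^ 'n ^ 'n::finite \<Rightarrow> bool" where
  "pos_semidef A \<longleftrightarrow> transpose A = A \<and> (\<forall>x. 0 \<le> x \<bullet> (A *v x))"

definition pos_def :: "real ^ 'n ^ 'n::finite \<Rightarrow> bool" where
  "pos_def A \<longleftrightarrow> transpose A = A \<and> (\<forall>x. x \<noteq> 0 \<longrightarrow> 0 < x \<bullet> (A *v x))"

text \<open>A positive semi-definite matrix has exactly one positive semi-definite square root.\<close>

definition matrix_sqrt :: "real ^ 'n ^ 'n::finite \<Rightarrow> real ^ 'n ^ 'n" where
  "matrix_sqrt A = (THE S. pos_semidef S \<and> S ** S = A)"

definition normal_measure :: "real \<Rightarrow> real \<Rightarrow> real measure" where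
  "normal_measure a v =
     (if v = 0 then return borel a
      else density lborel (\<lambda>x. ennreal (normal_density a (sqrt v) x)))"

text \<open>\<open>\<mu>\<close> is the possibly degenerate Gaussian measure with mean \<open>a\<close> and covariance \<open>C\<close>: every
  linear functional of it is normally distributed with the corresponding mean and variance.\<close>

definition is_gaussian :: "real ^ 'n::finite \<Rightarrow> real ^ 'n ^ 'n \<Rightarrow> (real ^ 'n) measure \<Rightarrow> bool" where
  "is_gaussian a C \<mu> \<longleftrightarrow>
     prob_space \<mu> \<and> sets \<mu> = sets borel \<and>
     (\<forall>u. distr \<mu> borel (\<lambda>x. u \<bullet> x) = normal_measure (u \<bullet> a) (u \<bullet> (C *v u)))"

text \<open>Standard Wiener process on \<open>[0,T]\<close>; \<open>mat (t - s)\<close> is \<open>t - s\<close> times the identity matrix.\<close>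

definition wiener_process :: "real \<Rightarrow> 'a measure \<Rightarrow> (real \<Rightarrow> 'a \<Rightarrow> real ^ 'n::finite) \<Rightarrow> bool" where
  "wiener_process T M W \<longleftrightarrow>
     prob_space M \<and>
     (\<forall>t\<in>{0..T}. W t \<in> borel_measurable M) \<and>
     (AE \<omega> in M. W 0 \<omega> = 0) \<and>
     (AE \<omega> in M. continuous_on {0..T} (\<lambda>t. W t \<omega>)) \<and>
     (\<forall>s t. 0 \<le> s \<and> s < t \<and> t \<le> T \<longrightarrow>
        is_gaussian 0 (mat (t - s)) (distr M borel (\<lambda>\<omega>. W t \<omega> - W s \<omega>))) \<and>
     (\<forall>k (\<tau> :: nat \<Rightarrow> real).
        0 \<le> \<tau> 0 \<and> (\<forall>i<k. \<tau> i < \<tau> (Suc i)) \<and> \<tau> k \<le> T \<longrightarrow>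
        prob_space.indep_vars M (\<lambda>_. borel) (\<lambda>i \<omega>. W (\<tau> (Suc i)) \<omega> - W (\<tau> i) \<omega>) {..<k})"

text \<open>\<open>C([0,T],\<real>\<^sup>D)\<close> with the Borel \<open>\<sigma>\<close>-algebra of the supremum metric. Its elements are extended
  by \<open>undefined\<close> outside \<open>[0,T]\<close>.\<close>

definition path_metric :: "real \<Rightarrow> (real \<Rightarrow> real ^ 'n::finite) metric" where
  "path_metric T = cfunspace (top_of_set {0..T}) euclidean_metric"

definition path_space :: "real \<Rightarrow> (real \<Rightarrow> real ^ 'n::finite) measure" where
  "path_space T = sigma (mspace (path_metric T)) {U. openin (mtopology_of (path_metric T)) U}"

text \<open>\<open>X\<close> solves \<open>dX = b(t,X) dt + S dW\<close> on \<open>[0,T]\<close>, with initial law \<open>\<rho>\<close> and initial value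
  independent of \<open>W\<close>. Since \<open>S\<close> is constant, the stochastic integral is \<open>S *v W t\<close>. The
  independence is that of the \<open>\<sigma>\<close>-algebras generated by \<open>X 0\<close> and by \<open>W\<close>
  (\<open>indep_var\<close> would require the two random variables to have the same type).\<close>

definition sde_solution ::
    "real \<Rightarrow> (real \<Rightarrow> real ^ 'n::finite \<Rightarrow> real ^ 'n) \<Rightarrow> real ^ 'n ^ 'n \<Rightarrow> (real ^ 'n) measure \<Rightarrow>
     'a measure \<Rightarrow> (real \<Rightarrow> 'a \<Rightarrow> real ^ 'n) \<Rightarrow> ('a \<Rightarrow> real \<Rightarrow> real ^ 'n) \<Rightarrow> bool" where
  "sde_solution T b S \<rho> M W X \<longleftrightarrow>
     prob_space M \<and>
     wiener_process T M W \<and>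
     X \<in> M \<rightarrow>\<^sub>M path_space T \<and>
     distr M borel (\<lambda>\<omega>. X \<omega> 0) = \<rho> \<and>
     prob_space.indep_set M
       (sets (vimage_algebra (space M) (\<lambda>\<omega>. X \<omega> 0) borel))
       (sets (vimage_algebra (space M) (\<lambda>\<omega>. \<lambda>t\<in>{0..T}. W t \<omega>) (PiM {0..T} (\<lambda>_. borel)))) \<and>
     (AE \<omega> in M.
        (\<lambda>s. b s (X \<omega> s)) absolutely_integrable_on {0..T} \<and>
        (\<forall>t\<in>{0..T}. X \<omega> t = X \<omega> 0 + integral {0..t} (\<lambda>s. b s (X \<omega> s)) + S *v W t \<omega>))"

definition time_marginal :: "real \<Rightarrow> (real \<Rightarrow> real ^ 'n::finite) measure \<Rightarrow> (real ^ 'n) measure" where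
  "time_marginal t \<mu> = distr \<mu> borel (\<lambda>h. h t)"

text \<open>The argument order is that of \<open>D(\<nu> \<parallel> \<mu>)\<close>, reversed with respect to the library's real-valued
  \<^const>\<open>KL_divergence\<close>. For probability measures \<open>\<nu> \<lless> \<mu>\<close> the negative part of
  \<open>log (d\<nu>/d\<mu>)\<close> is always \<open>\<nu>\<close>-integrable, so the expectation is \<open>+\<infinity>\<close> exactly when the
  logarithm is not \<open>\<nu>\<close>-integrable.\<close>

definition KL :: "'a measure \<Rightarrow> 'a measure \<Rightarrow> ereal" where
  "KL \<nu> \<mu> =
     (if absolutely_continuous \<mu> \<nu> \<and> integrable \<nu> (entropy_density (exp 1) \<mu> \<nu>)
      then ereal (KL_divergence (exp 1) \<mu> \<nu>) else \<infinity>)"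

end

theory Submission
  imports Defs
begin

text \<open>Both equations are discretised by the Euler scheme with step \<open>\<Delta>\<close>; let \<open>b\<close> be the linearised
  drift and \<open>S\<close> the square root of \<open>\<epsilon> \<Sigma>\<close>. On the grid, the scheme for the linear equation
  is the scheme for the nonlinear one with the noise increments shifted by the predictable amount
  \<open>\<Delta> S\<inverse>(b - f)\<close>, so the Cameron-Martin formula, applied increment by increment, gives
  the Donsker-Varadhan inequality
  \<open>E[\<phi>(l)] \<le> cost + D(\<nu>\<^sub>0 \<parallel> \<mu>\<^sub>0) + ln E[exp (\<phi>(v))]\<close>
  in which the cost is the expectation of \<open>\<Sum>\<^sub>j \<Delta> |S\<inverse>(b - f)(l\<^sub>j)|\<^sup>2 / 2\<close>. Both schemes converge
  pathwise because the noise is additive, hence the inequality passes to the solutions, first for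
  continuous and then for bounded measurable functionals \<open>\<phi>\<close>; it is equivalent to a bound on the
  divergence and is inherited by the time marginals. By Taylor's theorem \<open>b - f\<close> is quadratic in
  \<open>l - m\<close>, whose moments of order \<open>2k\<close> are \<open>O(\<epsilon>\<^sup>k)\<close>; as \<open>S S = \<epsilon> \<Sigma>\<close>, the cost is
  \<open>O(\<epsilon>)\<close>.\<close>

section \<open>The variational form of relative entropy\<close>

text \<open>The two equations may live on different probability spaces, so \<open>v\<close> and
  \<open>l\<close> are not coupled and only laws are compared. What the two schemes share is the law
  of the noise input, a product of n Gaussians. The Donsker-Varadhan inequality, recorded as
  \<open>entropy_bound\<close>, is the quantity carried along because it involves only integrals of
  bounded functionals: it survives pathwise limits and images under measurable maps without a
  density on path space, and no martingale property of a Girsanov exponential has to be verified.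
  Continuity of functionals refers to the samples at rational times, a map into the Polish space
  \<open>nat \<Rightarrow> real ^ 'n\<close> that generates the Borel sets of the path space. The
  drift f is locally Lipschitz with a polynomially growing Taylor remainder; moments are therefore
  taken only of the linear scheme, while for \<open>v\<close> the boundedness of each individual
  path suffices. The rate is a balance: inverting the noise costs a factor 1/\<epsilon>, and the
  squared Taylor remainder contributes moments of order at least four, of size \<epsilon>^2.\<close>

definition entropy_bound :: "real \<Rightarrow> 'a measure \<Rightarrow> 'a measure \<Rightarrow> bool" where
  "entropy_bound K \<nu> \<mu> \<longleftrightarrow>
     (\<forall>F\<in>borel_measurable \<mu>. (\<exists>b. \<forall>x. \<bar>F x\<bar> \<le> b) \<longrightarrow>
        (\<integral>x. F x \<partial>\<nu>) \<le> K + ln (\<integral>x. exp (F x) \<partial>\<mu>))"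

lemma (in prob_space) integrable_bounded:
  fixes F :: "'a \<Rightarrow> real"
  assumes "F \<in> borel_measurable M" "\<And>x. \<bar>F x\<bar> \<le> b"
  shows "integrable M F"
  using assms by (intro integrable_const_bound[where B=b]) auto

lemma (in prob_space) integrable_exp_bounded:
  fixes F :: "'a \<Rightarrow> real"
  assumes [measurable]: "F \<in> borel_measurable M" and b: "\<And>x. \<bar>F x\<bar> \<le> b"
  shows "integrable M (\<lambda>x. exp (F x))"
  using b by (intro integrable_const_bound[where B="exp b"]) (auto intro: order_trans[OF abs_ge_self])

lemma (in prob_space) integral_exp_bounded_ge:
  fixes F :: "'a \<Rightarrow> real"
  assumes [measurable]: "F \<in> borel_measurable M" and b: "\<And>x. \<bar>F x\<bar> \<le> b"
  shows "exp (- b) \<le> (\<integral>x. exp (F x) \<partial>M)"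
proof -
  have "exp (- b) = (\<integral>x. exp (- b) \<partial>M)" by (simp add: prob_space)
  also have "\<dots> \<le> (\<integral>x. exp (F x) \<partial>M)"
    using b by (intro integral_mono integrable_exp_bounded[OF assms]) (auto simp: abs_le_iff minus_le_iff)
  finally show ?thesis .
qed

lemma (in prob_space) integral_exp_bounded_le:
  fixes F :: "'a \<Rightarrow> real"
  assumes [measurable]: "F \<in> borel_measurable M" and b: "\<And>x. \<bar>F x\<bar> \<le> b"
  shows "(\<integral>x. exp (F x) \<partial>M) \<le> exp b"
proof -
  have "(\<integral>x. exp (F x) \<partial>M) \<le> (\<integral>x. exp b \<partial>M)"
    using b by (intro integral_mono integrable_exp_bounded[OF assms]) (auto simp: abs_le_iff)
  then show ?thesis by (simp add: prob_space)
qed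

lemma (in prob_space) integral_exp_bounded_pos:
  fixes F :: "'a \<Rightarrow> real"
  assumes "F \<in> borel_measurable M" "\<And>x. \<bar>F x\<bar> \<le> b"
  shows "0 < (\<integral>x. exp (F x) \<partial>M)"
  using integral_exp_bounded_ge[OF assms] by (meson exp_gt_zero less_le_trans)

lemma (in prob_space) abs_ln_integral_exp_le:
  fixes F :: "'a \<Rightarrow> real"
  assumes F: "F \<in> borel_measurable M" and b: "\<And>x. \<bar>F x\<bar> \<le> b"
  shows "\<bar>ln (\<integral>x. exp (F x) \<partial>M)\<bar> \<le> b"
proof -
  have p: "0 < (\<integral>x. exp (F x) \<partial>M)" by (rule integral_exp_bounded_pos[OF F b])
  have "ln (\<integral>x. exp (F x) \<partial>M) \<le> ln (exp b)"
    using p integral_exp_bounded_le[OF F b] by (subst ln_le_cancel_iff) auto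
  moreover have "ln (exp (- b)) \<le> ln (\<integral>x. exp (F x) \<partial>M)"
    using p integral_exp_bounded_ge[OF F b] by (subst ln_le_cancel_iff) auto
  ultimately show ?thesis by auto
qed

text \<open>Passes to a finite version of the Radon-Nikodym derivative, so that the entropy density
  becomes an ordinary real logarithm, up to a null set.\<close>

lemma log_density_exists:
  assumes "prob_space \<nu>" "prob_space \<mu>" and sets: "sets \<nu> = sets \<mu>"
    and ac: "absolutely_continuous \<mu> \<nu>"
  obtains D where "D \<in> borel_measurable \<mu>" "\<And>x. 0 \<le> D x" "\<nu> = density \<mu> (\<lambda>x. ennreal (D x))"
    "AE x in \<nu>. 0 < D x" "AE x in \<nu>. entropy_density (exp 1) \<mu> \<nu> x = ln (D x)"
proof -
  interpret nu: prob_space \<nu> by fact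
  interpret mu: prob_space \<mu> by fact
  obtain D where D: "D \<in> borel_measurable \<mu>" "AE x in \<mu>. RN_deriv \<mu> \<nu> x = ennreal (D x)"
    "AE x in \<nu>. 0 < D x" "\<And>x. 0 \<le> D x"
    using mu.real_RN_deriv[OF nu.finite_measure_axioms ac sets] by metis
  have "\<nu> = density \<mu> (RN_deriv \<mu> \<nu>)"
    using mu.density_RN_deriv[OF ac sets] ..
  also have "\<dots> = density \<mu> (\<lambda>x. ennreal (D x))"
    using D by (intro density_cong) auto
  finally have eq: "\<nu> = density \<mu> (\<lambda>x. ennreal (D x))" .
  have "AE x in \<nu>. RN_deriv \<mu> \<nu> x = ennreal (D x)"
    using absolutely_continuous_AE[OF sets ac D(2)] .
  then have "AE x in \<nu>. entropy_density (exp 1) \<mu> \<nu> x = ln (D x)"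
    using D(4) by (auto simp: entropy_density_def log_def)
  with D eq that show thesis by blast
qed

text \<open>Integrates ln y \<le> y - 1 at y = exp(F - c) / D, where D is the density and c the
  logarithm on the right. Under \<open>\<nu>\<close> the density cancels against D, so y has
  integral at most 1 and the right-hand side integrates to something nonpositive.\<close>

lemma KL_imp_entropy_bound:
  assumes "prob_space \<nu>" "prob_space \<mu>" and sets: "sets \<nu> = sets \<mu>" and fin: "KL \<nu> \<mu> \<noteq> \<infinity>"
  shows "entropy_bound (KL_divergence (exp 1) \<mu> \<nu>) \<nu> \<mu>"
  unfolding entropy_bound_def
proof safe
  fix F :: "_ \<Rightarrow> real" and b assume F[measurable]: "F \<in> borel_measurable \<mu>" and b: "\<forall>x. \<bar>F x\<bar> \<le> b"
  interpret nu: prob_space \<nu> by fact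
  interpret mu: prob_space \<mu> by fact
  have ac: "absolutely_continuous \<mu> \<nu>" and int: "integrable \<nu> (entropy_density (exp 1) \<mu> \<nu>)"
    using fin unfolding KL_def by (auto split: if_splits)
  obtain D where D[measurable]: "D \<in> borel_measurable \<mu>" and D0: "\<And>x. 0 \<le> D x"
    and nu: "\<nu> = density \<mu> (\<lambda>x. ennreal (D x))" and pos: "AE x in \<nu>. 0 < D x"
    and ed: "AE x in \<nu>. entropy_density (exp 1) \<mu> \<nu> x = ln (D x)"
    using log_density_exists[OF assms(1-3) ac] by metis
  define c where "c = ln (\<integral>x. exp (F x) \<partial>\<mu>)"
  have intF: "integrable \<mu> (\<lambda>x. exp (F x))"
    using b by (intro mu.integrable_exp_bounded) auto
  have ec: "exp c = (\<integral>x. exp (F x) \<partial>\<mu>)"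
    unfolding c_def by (intro exp_ln mu.integral_exp_bounded_pos) (use b in auto)
  \<comment> \<open>Where D vanishes the quotient is 0, division by zero being 0. The mass of exp(F
    - c) on that set is lost, which is why \<open>le1\<close> is an inequality.\<close>
  have Dmul: "D x * (exp (F x - c) / D x) = indicator {x. D x \<noteq> 0} x * exp (F x - c)" for x
    by (auto simp: indicator_def)
  have int0: "integrable \<mu> (\<lambda>x. exp (F x - c))"
    using intF by (simp add: exp_diff)
  have int1: "integrable \<mu> (\<lambda>x. D x * (exp (F x - c) / D x))"
    using int0 by (rule Bochner_Integration.integrable_bound) (auto simp: Dmul indicator_def)
  then have int2: "integrable \<nu> (\<lambda>x. exp (F x - c) / D x)"
    unfolding nu by (subst integrable_density) (auto simp: D0)
  have "(\<integral>x. exp (F x - c) / D x \<partial>\<nu>) = (\<integral>x. D x * (exp (F x - c) / D x) \<partial>\<mu>)"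
    unfolding nu by (subst integral_density) (auto simp: D0)
  also have "\<dots> \<le> (\<integral>x. exp (F x - c) \<partial>\<mu>)"
    using int0 int1 by (intro integral_mono) (auto simp: Dmul indicator_def)
  also have "\<dots> = 1"
    using ec[symmetric] by (simp add: exp_diff)
  finally have le1: "(\<integral>x. exp (F x - c) / D x \<partial>\<nu>) \<le> 1" .
  have iF: "integrable \<nu> F"
    using b by (intro nu.integrable_bounded[where b=b]) (auto simp: measurable_cong_sets[OF sets refl])
  have "(\<integral>x. F x - entropy_density (exp 1) \<mu> \<nu> x - c \<partial>\<nu>) \<le> (\<integral>x. exp (F x - c) / D x - 1 \<partial>\<nu>)"
  proof (rule integral_mono_AE)
    show "AE x in \<nu>. F x - entropy_density (exp 1) \<mu> \<nu> x - c \<le> exp (F x - c) / D x - 1"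
      using pos ed
    proof eventually_elim
      case (elim x)
      have "ln (exp (F x - c) / D x) \<le> exp (F x - c) / D x - 1"
        using elim by (intro ln_le_minus_one) auto
      then show ?case using elim by (simp add: ln_div)
    qed
  qed (use iF int int2 in auto)
  also have "\<dots> \<le> 0" using le1 int2 by (simp add: nu.prob_space)
  finally have "(\<integral>x. F x \<partial>\<nu>) - KL_divergence (exp 1) \<mu> \<nu> - c \<le> 0"
    using iF int by (simp add: nu.prob_space KL_divergence_def)
  then show "(\<integral>x. F x \<partial>\<nu>) \<le> KL_divergence (exp 1) \<mu> \<nu> + ln (\<integral>x. exp (F x) \<partial>\<mu>)"
    by (simp add: c_def)
qed

text \<open>Truncated logarithms of the density are nearly optimal test functions: their exponential
  moment is at most 1 + exp(-n), so their expectation is at most K + exp(-n). Absolute continuity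
  and integrability of the full logarithm have to be established on the way, as \<open>KL\<close> is
  infinite otherwise.\<close>

lemma entropy_bound_imp_KL_le:
  fixes \<nu> \<mu> :: "'a measure"
  assumes "prob_space \<nu>" "prob_space \<mu>" and sets: "sets \<nu> = sets \<mu>" and K: "entropy_bound K \<nu> \<mu>"
  shows "KL \<nu> \<mu> \<le> ereal K"
proof -
  interpret nu: prob_space \<nu> by fact
  interpret mu: prob_space \<mu> by fact
  note ms = measurable_cong_sets[OF sets refl]
  have EB: "(\<integral>x. F x \<partial>\<nu>) \<le> K + ln (\<integral>x. exp (F x) \<partial>\<mu>)"
    if "F \<in> borel_measurable \<mu>" "\<And>x. \<bar>F x\<bar> \<le> b" for F :: "'a \<Rightarrow> real" and b
    using K that unfolding entropy_bound_def by blast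
  have ac: "absolutely_continuous \<mu> \<nu>"
    unfolding absolutely_continuous_def
  proof
    fix A assume A: "A \<in> null_sets \<mu>"
    then have [measurable]: "A \<in> sets \<mu>" by auto
    then have [measurable]: "A \<in> sets \<nu>" by (simp add: sets)
    \<comment> \<open>Testing with c times the indicator of a \<open>\<mu>\<close>-null set leaves
      the logarithm at 0. Since c is arbitrary, \<open>\<nu>\<close> must vanish on the set.\<close>
    have le: "c * nu.prob A \<le> K" if "c \<ge> 0" for c
    proof -
      have "(\<integral>x. c * indicator A x \<partial>\<nu>) \<le> K + ln (\<integral>x. exp (c * indicator A x) \<partial>\<mu>)"
        using that by (intro EB[of "\<lambda>x. c * indicator A x" c]) (auto simp: indicator_def)
      moreover have "(\<integral>x. exp (c * indicator A x) \<partial>\<mu>) = (\<integral>x. 1 \<partial>\<mu>)"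
      proof (rule integral_cong_AE)
        show "AE x in \<mu>. exp (c * indicator A x) = 1"
          using AE_not_in[OF A] by eventually_elim auto
      qed auto
      ultimately show ?thesis by (simp add: mu.prob_space)
    qed
    have "nu.prob A = 0"
    proof (rule ccontr)
      assume "nu.prob A \<noteq> 0"
      then have p: "nu.prob A > 0" by (simp add: zero_less_measure_iff)
      have "((\<bar>K\<bar> + 1) / nu.prob A) * nu.prob A \<le> K" using p by (intro le) auto
      then show False using p by auto
    qed
    then show "A \<in> null_sets \<nu>" by (simp add: null_sets_def nu.emeasure_eq_measure)
  qed
  obtain D where D[measurable]: "D \<in> borel_measurable \<mu>" and D0: "\<And>x. 0 \<le> D x"
    and nu: "\<nu> = density \<mu> (\<lambda>x. ennreal (D x))" and pos: "AE x in \<nu>. 0 < D x"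
    and ed: "AE x in \<nu>. entropy_density (exp 1) \<mu> \<nu> x = ln (D x)"
    using log_density_exists[OF assms(1-3) ac] by metis
  have [measurable]: "D \<in> borel_measurable \<nu>" by (simp add: ms)
  \<comment> \<open>The value -n where D = 0 keeps exp(G n) \<le> D + exp(-n) true everywhere, also
    below the truncation level.\<close>
  define G where "G n x = (if D x > 0 then max (- real n) (min (real n) (ln (D x))) else - real n)" for n x
  have G[measurable]: "G n \<in> borel_measurable \<mu>" for n unfolding G_def by measurable
  have Gn[measurable]: "G n \<in> borel_measurable \<nu>" for n by (simp add: ms)
  have Gb: "\<bar>G n x\<bar> \<le> real n" for n x unfolding G_def by auto
  have intD: "integrable \<mu> D" "(\<integral>x. D x \<partial>\<mu>) = 1"
  proof -
    have "(\<integral>\<^sup>+x. ennreal (D x) \<partial>\<mu>) = 1"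
      using nu.emeasure_space_1 sets_eq_imp_space_eq[OF sets]
      by (subst (asm) nu) (simp add: emeasure_density cong: nn_integral_cong)
    then show "integrable \<mu> D" "(\<integral>x. D x \<partial>\<mu>) = 1"
      using D0 by (auto intro!: integrableI_nonneg simp: integral_eq_nn_integral)
  qed
  have Gexp: "exp (G n x) \<le> D x + exp (- real n)" for n x
  proof (cases "D x > 0")
    case True
    then have "exp (ln (D x)) = D x" by simp
    show ?thesis
    proof (cases "ln (D x) \<ge> - real n")
      case t: True
      then have "G n x \<le> ln (D x)" using True by (simp add: G_def)
      then have "exp (G n x) \<le> exp (ln (D x))" by simp
      then show ?thesis using True by (simp add: add_increasing2)
    next
      case False
      then show ?thesis using True by (simp add: G_def)
    qed
  next
    case False
    then show ?thesis using D0[of x] by (simp add: G_def)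
  qed
  have Gle: "(\<integral>x. G n x \<partial>\<nu>) \<le> K + exp (- real n)" for n
  proof -
    have "(\<integral>x. exp (G n x) \<partial>\<mu>) \<le> (\<integral>x. D x + exp (- real n) \<partial>\<mu>)"
      using Gexp Gb intD by (intro integral_mono mu.integrable_exp_bounded) auto
    also have "\<dots> = 1 + exp (- real n)" using intD by (simp add: mu.prob_space)
    finally have "ln (\<integral>x. exp (G n x) \<partial>\<mu>) \<le> ln (1 + exp (- real n))"
      using mu.integral_exp_bounded_pos[OF G Gb, of n] by (subst ln_le_cancel_iff) auto
    also have "\<dots> \<le> exp (- real n)" by (rule ln_add_one_self_le_self) auto
    finally show ?thesis using EB[OF G Gb, of n] by linarith
  qed
  define Lm where "Lm x = max 0 (- ln (D x))" for x
  define Lp where "Lp x = max 0 (ln (D x))" for x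
  have [measurable]: "Lm \<in> borel_measurable \<nu>" "Lp \<in> borel_measurable \<nu>" "Lm \<in> borel_measurable \<mu>"
    unfolding Lm_def Lp_def by measurable
  \<comment> \<open>The negative part of the logarithm is always \<open>\<nu>\<close>-integrable:
    under \<open>\<mu>\<close> it is weighted by D, and -D ln D \<le> 1 - D \<le> 1.\<close>
  have "integrable \<mu> (\<lambda>x. D x * Lm x)"
  proof (rule mu.integrable_bounded[where b=1])
    fix x show "\<bar>D x * Lm x\<bar> \<le> 1"
    proof (cases "D x > 0")
      case True
      have "ln (1 / D x) \<le> 1 / D x - 1" using True by (intro ln_le_minus_one) auto
      then have "D x * (- ln (D x)) \<le> D x * (1 / D x - 1)"
        using True by (intro mult_left_mono) (auto simp: ln_div)
      also have "\<dots> \<le> 1" using True by (simp add: algebra_simps)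
      finally show ?thesis using True by (auto simp: Lm_def max_def)
    next
      case False
      then show ?thesis using D0[of x] by simp
    qed
  qed auto
  then have iLm: "integrable \<nu> Lm"
    unfolding nu by (subst integrable_density) (auto simp: D0)
  have iG: "integrable \<nu> (G n)" for n using Gb by (intro nu.integrable_bounded[where b="real n"]) auto
  have iP: "integrable \<nu> (\<lambda>x. min (real n) (Lp x))" for n
    by (rule nu.integrable_bounded[where b="real n"]) (auto simp: Lp_def)
  \<comment> \<open>The bound does not depend on n because exp(-n) \<le> 1. Monotone convergence
    then makes the positive part of the logarithm integrable.\<close>
  have Pb: "(\<integral>x. min (real n) (Lp x) \<partial>\<nu>) \<le> K + 1 + (\<integral>x. Lm x \<partial>\<nu>)" for n
  proof -
    have "(\<integral>x. min (real n) (Lp x) \<partial>\<nu>) \<le> (\<integral>x. G n x + Lm x \<partial>\<nu>)"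
    proof (rule integral_mono_AE)
      show "AE x in \<nu>. min (real n) (Lp x) \<le> G n x + Lm x"
        using pos by eventually_elim (auto simp: Lp_def Lm_def G_def)
    qed (use iG iLm iP in auto)
    also have "\<dots> = (\<integral>x. G n x \<partial>\<nu>) + (\<integral>x. Lm x \<partial>\<nu>)" using iG iLm by simp
    finally show ?thesis using Gle[of n] by (smt (verit) exp_le_one_iff of_nat_0_le_iff)
  qed
  have "incseq (\<lambda>n. \<integral>x. min (real n) (Lp x) \<partial>\<nu>)"
    using iP by (intro monoI integral_mono) auto
  then obtain l where l: "(\<lambda>n. \<integral>x. min (real n) (Lp x) \<partial>\<nu>) \<longlonglongrightarrow> l"
    using Pb by (meson incseq_convergent)
  have iLp: "integrable \<nu> Lp"
  proof (rule integrable_monotone_convergence[OF iP _ _ l])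
    show "AE x in \<nu>. mono (\<lambda>n. min (real n) (Lp x))" by (auto simp: mono_def)
    show "AE x in \<nu>. (\<lambda>n. min (real n) (Lp x)) \<longlonglongrightarrow> Lp x"
    proof (rule AE_I2)
      fix x
      obtain k :: nat where k: "Lp x \<le> real k" using real_arch_simple by blast
      have "\<forall>\<^sub>F n in sequentially. min (real n) (Lp x) = Lp x"
        using eventually_ge_at_top[of k] by eventually_elim (use k in \<open>auto simp: min_def\<close>)
      then show "(\<lambda>n. min (real n) (Lp x)) \<longlonglongrightarrow> Lp x" by (simp add: tendsto_eventually)
    qed
  qed auto
  have Lpm: "ln (D x) = Lp x - Lm x" for x by (auto simp: Lp_def Lm_def)
  have iL: "integrable \<nu> (\<lambda>x. ln (D x))" unfolding Lpm using iLp iLm by auto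
  have edm[measurable]: "entropy_density (exp 1) \<mu> \<nu> \<in> borel_measurable \<nu>"
    by (simp add: ms)
  have iE: "integrable \<nu> (entropy_density (exp 1) \<mu> \<nu>)"
    using iL ed by (subst integrable_cong_AE[of _ _ "\<lambda>x. ln (D x)"]) auto
  have KLeq: "KL_divergence (exp 1) \<mu> \<nu> = (\<integral>x. ln (D x) \<partial>\<nu>)"
    unfolding KL_divergence_def using ed by (intro integral_cong_AE) auto
  have "(\<lambda>n. \<integral>x. G n x \<partial>\<nu>) \<longlonglongrightarrow> (\<integral>x. ln (D x) \<partial>\<nu>)"
  proof (rule integral_dominated_convergence[where w="\<lambda>x. \<bar>ln (D x)\<bar>"])
    show "AE x in \<nu>. (\<lambda>n. G n x) \<longlonglongrightarrow> ln (D x)"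
      using pos
    proof eventually_elim
      case (elim x)
      obtain k :: nat where k: "\<bar>ln (D x)\<bar> \<le> real k" using real_arch_simple by blast
      have "\<forall>\<^sub>F n in sequentially. G n x = ln (D x)"
        using eventually_ge_at_top[of k] by eventually_elim (use k elim in \<open>auto simp: G_def\<close>)
      then show ?case by (simp add: tendsto_eventually)
    qed
    show "AE x in \<nu>. norm (G n x) \<le> \<bar>ln (D x)\<bar>" for n
      using pos by eventually_elim (auto simp: G_def)
  qed (use iL in auto)
  moreover have "(\<lambda>n. K + exp (- real n)) \<longlonglongrightarrow> K + 0"
    by (intro tendsto_intros filterlim_compose[OF exp_at_bot]
        filterlim_compose[OF filterlim_uminus_at_bot_at_top] filterlim_real_sequentially)
  ultimately have "(\<integral>x. ln (D x) \<partial>\<nu>) \<le> K + 0"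
    using Gle by (intro LIMSEQ_le[rotated]) auto
  then show ?thesis unfolding KL_def using ac iE KLeq by simp
qed

section \<open>From continuous to bounded measurable test functionals\<close>

text \<open>Outer regularity is applied to A and to its complement, with e/2 each; the closed set is
  the complement of the open set around the complement of A.\<close>

lemma closed_open_approx:
  fixes P :: "'x::polish_space measure"
  assumes "finite_measure P" and sP: "sets P = sets borel" and A: "A \<in> sets borel" and e: "e > 0"
  obtains C U where "closed C" "open U" "C \<subseteq> A" "A \<subseteq> U" "measure P (U - C) < e"
proof -
  interpret finite_measure P by fact
  have spc: "space P = UNIV" using sets_eq_imp_space_eq[OF sP] by simp
  have outer: "\<exists>U. open U \<and> B \<subseteq> U \<and> measure P (U - B) < e / 2" if B: "B \<in> sets borel" for B
  proof -
    have "emeasure P B = (INF U \<in> {U. B \<subseteq> U \<and> open U}. emeasure P U)"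
      by (rule outer_regular[OF sP _ B]) simp
    moreover have "emeasure P B < ennreal (measure P B + e / 2)"
      unfolding emeasure_eq_measure using e by (intro ennreal_lessI) (auto simp: add_nonneg_pos)
    ultimately obtain U where U: "B \<subseteq> U" "open U" "emeasure P U < ennreal (measure P B + e / 2)"
      by (auto simp: INF_less_iff)
    then have "measure P U < measure P B + e / 2"
      unfolding emeasure_eq_measure using e by (subst (asm) ennreal_less_iff) auto
    moreover have "measure P (U - B) = measure P U - measure P B"
      using U B by (intro finite_measure_Diff) (auto simp: sP)
    ultimately show ?thesis using U by auto
  qed
  obtain U where U: "open U" "A \<subseteq> U" "measure P (U - A) < e / 2" using outer[OF A] by blast
  obtain V where V: "open V" "- A \<subseteq> V" "measure P (V - - A) < e / 2" using outer[of "- A"] A by auto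
  have "measure P (U - - V) \<le> measure P ((U - A) \<union> (V - - A))"
    using U V A by (intro finite_measure_mono) (auto simp: sP)
  also have "\<dots> \<le> measure P (U - A) + measure P (V - - A)"
    using U V A by (intro measure_subadditive) (auto simp: sP emeasure_eq_measure)
  also have "\<dots> < e" using U V by simp
  finally show thesis using U V by (intro that[of "- V" U]) auto
qed

text \<open>One function has to serve both measures, because the dual inequality involves the two at
  once. The union of the closed sets and the intersection of the open sets form a common sandwich,
  and a Urysohn function differs from the indicator only between its two sides.\<close>

lemma continuous_approx_indicator:
  fixes P Q :: "'x::polish_space measure"
  assumes P: "finite_measure P" "sets P = sets borel" and Q: "finite_measure Q" "sets Q = sets borel"
    and A: "A \<in> sets borel" and e: "e > 0"
  obtains \<phi> :: "'x \<Rightarrow> real" where "continuous_on UNIV \<phi>" "\<And>x. 0 \<le> \<phi> x" "\<And>x. \<phi> x \<le> 1"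
    "(\<integral>x. \<bar>indicator A x - \<phi> x\<bar> \<partial>P) \<le> e" "(\<integral>x. \<bar>indicator A x - \<phi> x\<bar> \<partial>Q) \<le> e"
proof -
  obtain C1 U1 where 1: "closed C1" "open U1" "C1 \<subseteq> A" "A \<subseteq> U1" "measure P (U1 - C1) < e"
    using closed_open_approx[OF P A e] .
  obtain C2 U2 where 2: "closed C2" "open U2" "C2 \<subseteq> A" "A \<subseteq> U2" "measure Q (U2 - C2) < e"
    using closed_open_approx[OF Q A e] .
  define C U where "C = C1 \<union> C2" and "U = U1 \<inter> U2"
  have CU: "closed C" "open U" "closed (- U)" "disjnt (- U) C" "C \<subseteq> A" "A \<subseteq> U"
    using 1 2 by (auto simp: C_def U_def disjnt_def)
  have n: "normal_space (euclidean :: 'x topology)"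
    by (simp add: metrizable_imp_normal_space metrizable_space_euclidean)
  obtain \<phi> :: "'x \<Rightarrow> real" where \<phi>: "continuous_map euclidean (top_of_set {0..1}) \<phi>"
    "\<phi> ` (- U) \<subseteq> {0}" "\<phi> ` C \<subseteq> {1}"
    using Urysohn_lemma[OF n, of "- U" C 0 1] CU by (metis closed_closedin zero_le_one)
  have cont: "continuous_on UNIV \<phi>" and rng: "0 \<le> \<phi> x" "\<phi> x \<le> 1" for x
    using \<phi>(1) by (auto simp: continuous_map_in_subtopology)
  have rng2: "- 1 \<le> \<phi> x" "\<phi> x \<le> 2" for x using rng[of x] by linarith+
  have [measurable]: "\<phi> \<in> borel_measurable borel" by (rule borel_measurable_continuous_onI[OF cont])
  have ptw: "\<bar>indicator A x - \<phi> x\<bar> \<le> indicator (U - C) x" for x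
  proof (cases "x \<in> C \<or> x \<notin> U")
    case True then show ?thesis using \<phi>(2,3) CU(5,6) by (auto simp: indicator_def)
  next
    case False then show ?thesis using rng[of x] by (auto simp: indicator_def)
  qed
  have bd: "(\<integral>x. \<bar>indicator A x - \<phi> x\<bar> \<partial>R) \<le> measure R (U - C)"
    if R: "finite_measure R" "sets R = sets borel" for R :: "'x measure"
  proof -
    interpret finite_measure R by fact
    have ms: "measurable R = measurable (borel :: 'x measure)"
      using R(2) by (intro ext measurable_cong_sets) auto
    have [measurable]: "U - C \<in> sets R" using CU(1,2) unfolding R(2) by auto
    have "(\<integral>x. \<bar>indicator A x - \<phi> x\<bar> \<partial>R) \<le> (\<integral>x. indicator (U - C) x \<partial>R)"
    proof (rule integral_mono)
      show "integrable R (\<lambda>x. \<bar>indicator A x - \<phi> x\<bar>)"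
        using rng rng2 A by (intro integrable_const_bound[where B=1])
         (auto simp: ms indicator_def abs_le_iff intro!: AE_I2)
      show "integrable R (indicator (U - C) :: _ \<Rightarrow> real)"
        by (intro integrable_const_bound[where B=1]) (auto simp: indicator_def)
    qed (rule ptw)
    also have "\<dots> = measure R (U - C)" 
      using sets_eq_imp_space_eq[OF R(2)] by simp
    finally show ?thesis .
  qed
  have "measure P (U - C) \<le> measure P (U1 - C1)"
    using 1 2 P by (intro finite_measure.finite_measure_mono) (auto simp: U_def C_def)
  moreover have "measure Q (U - C) \<le> measure Q (U2 - C2)"
    using 1 2 Q by (intro finite_measure.finite_measure_mono) (auto simp: U_def C_def)
  ultimately show thesis using bd[OF P] bd[OF Q] 1 2 cont rng by (intro that[of \<phi>]) auto
qed

text \<open>Convexity: the tangent of exp at x lies below exp at y, and its slope exp x is at most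
  exp b.\<close>

lemma exp_le_exp_plus:
  fixes x y b :: real
  assumes "\<bar>x\<bar> \<le> b"
  shows "exp x \<le> exp y + exp b * \<bar>x - y\<bar>"
proof (cases "x \<le> y")
  case False
  have "exp x * (1 + (y - x)) \<le> exp x * exp (y - x)" by (intro mult_left_mono) auto
  also have "\<dots> = exp y" by (simp flip: exp_add)
  finally have "exp x \<le> exp y + exp x * (x - y)" by (simp add: algebra_simps)
  also have "exp x * (x - y) \<le> exp b * \<bar>x - y\<bar>" using assms False by (intro mult_mono) auto
  finally show ?thesis by simp
qed (simp add: add_increasing2)

lemma le_of_le_add_mult:
  fixes x y C :: real
  assumes "C \<ge> 0" "\<And>e. e > 0 \<Longrightarrow> x \<le> y + C * e"
  shows "x \<le> y"
proof (rule field_le_epsilon)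
  fix e :: real assume "e > 0"
  then have "x \<le> y + C * (e / (C + 1))" using assms by (intro assms(2)) auto
  also have "C * (e / (C + 1)) \<le> e" using assms(1) \<open>e > 0\<close> by (simp add: field_simps)
  finally show "x \<le> y + e" by simp
qed

text \<open>\<open>J\<close> generates the sigma-algebra, so approximating indicators on its Polish
  target in L1, simultaneously for both image measures, reaches all simple functions; bounded
  functions are uniform limits of these. Both sides are stable under the approximation: the left one
  by linearity, the logarithm because the exponential moment stays away from 0.\<close>

lemma entropy_bound_from_continuous:
  fixes J :: "'p \<Rightarrow> 'x::polish_space" and \<nu> \<mu> :: "'p measure"
  assumes "prob_space \<nu>" "prob_space \<mu>" and sets: "sets \<nu> = sets \<mu>"
    and J[measurable]: "J \<in> borel_measurable \<mu>"
    and gen: "\<And>A. A \<in> sets \<mu> \<Longrightarrow> \<exists>A'\<in>sets borel. A = J -` A' \<inter> space \<mu>"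
    and cont: "\<And>\<phi> b. continuous_on UNIV \<phi> \<Longrightarrow> (\<And>x. \<bar>\<phi> x\<bar> \<le> b) \<Longrightarrow>
      (\<integral>x. \<phi> (J x) \<partial>\<nu>) \<le> K + ln (\<integral>x. exp (\<phi> (J x)) \<partial>\<mu>)"
  shows "entropy_bound K \<nu> \<mu>"
proof -
  interpret nu: prob_space \<nu> by fact
  interpret mu: prob_space \<mu> by fact
  note ms = measurable_cong_sets[OF sets refl]
  have spc: "space \<nu> = space \<mu>" by (rule sets_eq_imp_space_eq[OF sets])
  have Jn[measurable]: "J \<in> borel_measurable \<nu>" by (simp add: ms)
  have simple: "(\<integral>x. (\<Sum>i\<in>I. c i * indicator (A i) x) \<partial>\<nu>)
      \<le> K + ln (\<integral>x. exp (\<Sum>i\<in>I. c i * indicator (A i) x) \<partial>\<mu>)"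
    if I: "finite I" and A: "\<And>i. i \<in> I \<Longrightarrow> A i \<in> sets \<mu>" for I :: "int set" and c :: "int \<Rightarrow> real" and A
  proof -
    define F where "F x = (\<Sum>i\<in>I. c i * indicator (A i) x)" for x
    define b where "b = (\<Sum>i\<in>I. \<bar>c i\<bar>)"
    have b0: "b \<ge> 0" unfolding b_def by (simp add: sum_nonneg)
    have Fm[measurable]: "F \<in> borel_measurable \<mu>" unfolding F_def using A by measurable
    have Fn[measurable]: "F \<in> borel_measurable \<nu>" by (simp add: ms)
    have sumb: "\<bar>\<Sum>i\<in>I. c i * g i\<bar> \<le> b" if "\<And>i. 0 \<le> g i" "\<And>i. g i \<le> 1" for g
      unfolding b_def using that
      by (intro order_trans[OF sum_abs] sum_mono) (auto simp: abs_mult mult_left_le)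
    have Fb: "\<bar>F x\<bar> \<le> b" for x
      unfolding F_def by (rule sumb) (auto simp: indicator_def)
    have "(\<integral>x. F x \<partial>\<nu>) \<le> K + ln (\<integral>x. exp (F x) \<partial>\<mu>)"
    proof (rule le_of_le_add_mult)
      \<comment> \<open>The summand b is the L1 error of the left integral. In exp(2b) b, one factor
        exp b is a Lipschitz constant of exp on [-b, b] and the other bounds the reciprocal of the
        exponential moment, which is at least exp(-b).\<close>
      show "0 \<le> b + exp (2 * b) * b" using b0 by simp
      fix e :: real assume e: "e > 0"
      have "\<forall>i\<in>I. \<exists>\<phi> :: 'x \<Rightarrow> real. continuous_on UNIV \<phi> \<and> (\<forall>x. 0 \<le> \<phi> x \<and> \<phi> x \<le> 1) \<and>
         (\<integral>x. \<bar>indicator (A i) x - \<phi> (J x)\<bar> \<partial>\<nu>) \<le> e \<and> (\<integral>x. \<bar>indicator (A i) x - \<phi> (J x)\<bar> \<partial>\<mu>) \<le> e"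
      proof
        fix i assume "i \<in> I"
        then obtain A' where A': "A' \<in> sets borel" "A i = J -` A' \<inter> space \<mu>" using gen A by metis
        have fm: "finite_measure (distr \<nu> borel J)" "finite_measure (distr \<mu> borel J)"
          by (auto intro!: prob_space.finite_measure nu.prob_space_distr mu.prob_space_distr)
        obtain \<phi> :: "'x \<Rightarrow> real" where \<phi>: "continuous_on UNIV \<phi>" "\<And>x. 0 \<le> \<phi> x" "\<And>x. \<phi> x \<le> 1"
          "(\<integral>x. \<bar>indicator A' x - \<phi> x\<bar> \<partial>distr \<nu> borel J) \<le> e"
          "(\<integral>x. \<bar>indicator A' x - \<phi> x\<bar> \<partial>distr \<mu> borel J) \<le> e"
          using continuous_approx_indicator[OF fm(1) _ fm(2) _ A'(1) e] by auto
        have [measurable]: "\<phi> \<in> borel_measurable borel"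
          by (rule borel_measurable_continuous_onI[OF \<phi>(1)])
        have eq: "(\<integral>x. \<bar>indicator A' x - \<phi> x\<bar> \<partial>distr R borel J) = (\<integral>x. \<bar>indicator (A i) x - \<phi> (J x)\<bar> \<partial>R)"
          if "space R = space \<mu>" "J \<in> borel_measurable R" for R
          using A' that by (subst integral_distr) (auto intro!: Bochner_Integration.integral_cong simp: indicator_def)
        show "\<exists>\<phi> :: 'x \<Rightarrow> real. continuous_on UNIV \<phi> \<and> (\<forall>x. 0 \<le> \<phi> x \<and> \<phi> x \<le> 1) \<and>
         (\<integral>x. \<bar>indicator (A i) x - \<phi> (J x)\<bar> \<partial>\<nu>) \<le> e \<and> (\<integral>x. \<bar>indicator (A i) x - \<phi> (J x)\<bar> \<partial>\<mu>) \<le> e"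
          using \<phi> eq[of \<nu>] eq[of \<mu>] spc by (intro exI[of _ \<phi>]) auto
      qed
      from bchoice[OF this] obtain \<phi> :: "int \<Rightarrow> 'x \<Rightarrow> real" where
        \<phi>0: "\<forall>i\<in>I. continuous_on UNIV (\<phi> i) \<and> (\<forall>x. 0 \<le> \<phi> i x \<and> \<phi> i x \<le> 1) \<and>
         (\<integral>x. \<bar>indicator (A i) x - \<phi> i (J x)\<bar> \<partial>\<nu>) \<le> e \<and> (\<integral>x. \<bar>indicator (A i) x - \<phi> i (J x)\<bar> \<partial>\<mu>) \<le> e"
        by blast
      then have
        \<phi>: "\<And>i. i \<in> I \<Longrightarrow> continuous_on UNIV (\<phi> i)" "\<And>i x. i \<in> I \<Longrightarrow> 0 \<le> \<phi> i x \<and> \<phi> i x \<le> 1"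
        "\<And>i. i \<in> I \<Longrightarrow> (\<integral>x. \<bar>indicator (A i) x - \<phi> i (J x)\<bar> \<partial>\<nu>) \<le> e"
        "\<And>i. i \<in> I \<Longrightarrow> (\<integral>x. \<bar>indicator (A i) x - \<phi> i (J x)\<bar> \<partial>\<mu>) \<le> e"
        by auto
      define \<psi> where "\<psi> x = (\<Sum>i\<in>I. c i * \<phi> i x)" for x
      have \<psi>c: "continuous_on UNIV \<psi>" unfolding \<psi>_def using \<phi>(1) by (intro continuous_intros) auto
      have [measurable]: "\<psi> \<in> borel_measurable borel" by (rule borel_measurable_continuous_onI[OF \<psi>c])
      have [measurable]: "i \<in> I \<Longrightarrow> \<phi> i \<in> borel_measurable borel" for i
        by (rule borel_measurable_continuous_onI[OF \<phi>(1)])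
      have \<psi>b: "\<bar>\<psi> x\<bar> \<le> b" for x
      proof -
        have "\<psi> x = (\<Sum>i\<in>I. c i * (if i \<in> I then \<phi> i x else 0))" unfolding \<psi>_def by (intro sum.cong) auto
        also have "\<bar>\<dots>\<bar> \<le> b" using \<phi>(2) by (intro sumb) auto
        finally show ?thesis .
      qed
      have diff: "(\<integral>x. \<bar>F x - \<psi> (J x)\<bar> \<partial>R) \<le> b * e"
        if R: "prob_space R" "sets R = sets \<mu>" 
          and le: "\<And>i. i \<in> I \<Longrightarrow> (\<integral>x. \<bar>indicator (A i) x - \<phi> i (J x)\<bar> \<partial>R) \<le> e" for R
      proof -
        interpret R: prob_space R by fact
        have msR: "measurable R = measurable \<mu>" using R by (intro ext measurable_cong_sets) auto
        have ii: "integrable R (\<lambda>x. \<bar>indicator (A i) x - \<phi> i (J x)\<bar>)" if "i \<in> I" for i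
        proof (rule R.integrable_bounded)
          show "(\<lambda>x. \<bar>indicator (A i) x - \<phi> i (J x)\<bar>) \<in> borel_measurable R"
            unfolding msR using that A[OF that] by measurable
          show "\<bar>\<bar>indicator (A i) x - \<phi> i (J x)\<bar>\<bar> \<le> 1" for x
            using \<phi>(2)[OF that, of "J x"] by (auto simp: indicator_def)
        qed
        have "(\<integral>x. \<bar>F x - \<psi> (J x)\<bar> \<partial>R) \<le> (\<integral>x. (\<Sum>i\<in>I. \<bar>c i\<bar> * \<bar>indicator (A i) x - \<phi> i (J x)\<bar>) \<partial>R)"
        proof (rule integral_mono)
          show "integrable R (\<lambda>x. \<bar>F x - \<psi> (J x)\<bar>)"
          proof (rule R.integrable_bounded[where b="2 * b"])
            show "\<bar>\<bar>F x - \<psi> (J x)\<bar>\<bar> \<le> 2 * b" for x using Fb[of x] \<psi>b[of "J x"] by linarith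
          qed (simp add: msR)
          show "\<bar>F x - \<psi> (J x)\<bar> \<le> (\<Sum>i\<in>I. \<bar>c i\<bar> * \<bar>indicator (A i) x - \<phi> i (J x)\<bar>)" for x
            unfolding F_def \<psi>_def sum_subtractf[symmetric] right_diff_distrib[symmetric]
            by (intro order_trans[OF sum_abs] sum_mono) (auto simp: abs_mult)
        qed (use ii in auto)
        also have "\<dots> = (\<Sum>i\<in>I. \<bar>c i\<bar> * (\<integral>x. \<bar>indicator (A i) x - \<phi> i (J x)\<bar> \<partial>R))"
          using ii by (subst Bochner_Integration.integral_sum) auto
        also have "\<dots> \<le> (\<Sum>i\<in>I. \<bar>c i\<bar> * e)" using le by (intro sum_mono mult_left_mono) auto
        also have "\<dots> = b * e" by (simp add: b_def sum_distrib_right)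
        finally show ?thesis .
      qed
      have d1: "(\<integral>x. \<bar>F x - \<psi> (J x)\<bar> \<partial>\<nu>) \<le> b * e" by (rule diff) (use \<phi> sets nu.prob_space_axioms in auto)
      have d2: "(\<integral>x. \<bar>F x - \<psi> (J x)\<bar> \<partial>\<mu>) \<le> b * e" by (rule diff) (use \<phi> sets mu.prob_space_axioms in auto)
      have tb: "\<bar>\<bar>F x - \<psi> (J x)\<bar>\<bar> \<le> 2 * b" for x using Fb[of x] \<psi>b[of "J x"] by linarith
      have id: "integrable \<nu> (\<lambda>x. \<bar>F x - \<psi> (J x)\<bar>)" "integrable \<mu> (\<lambda>x. \<bar>F x - \<psi> (J x)\<bar>)"
        by (rule nu.integrable_bounded[OF _ tb] mu.integrable_bounded[OF _ tb], measurable)+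
      have iF: "integrable \<nu> F" "integrable \<nu> (\<lambda>x. \<psi> (J x))" 
        by (rule nu.integrable_bounded[OF _ Fb] nu.integrable_bounded[OF _ \<psi>b], measurable)+
      have "(\<integral>x. F x \<partial>\<nu>) - (\<integral>x. \<psi> (J x) \<partial>\<nu>) = (\<integral>x. F x - \<psi> (J x) \<partial>\<nu>)" using iF by simp
      also have "\<dots> \<le> (\<integral>x. \<bar>F x - \<psi> (J x)\<bar> \<partial>\<nu>)" using iF id by (intro integral_mono) auto
      finally have s1: "(\<integral>x. F x \<partial>\<nu>) \<le> (\<integral>x. \<psi> (J x) \<partial>\<nu>) + b * e" using d1 by linarith
      have iE: "integrable \<mu> (\<lambda>x. exp (F x))" "integrable \<mu> (\<lambda>x. exp (\<psi> (J x)))"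
        by (rule mu.integrable_exp_bounded[OF _ Fb] mu.integrable_exp_bounded[OF _ \<psi>b], measurable)+
      have "(\<integral>x. exp (\<psi> (J x)) \<partial>\<mu>) \<le> (\<integral>x. exp (F x) + exp b * \<bar>F x - \<psi> (J x)\<bar> \<partial>\<mu>)"
        using exp_le_exp_plus[OF \<psi>b] iE id by (intro integral_mono) (auto simp: abs_minus_commute)
      also have "\<dots> \<le> (\<integral>x. exp (F x) \<partial>\<mu>) + exp b * (b * e)" using iE id d2 by simp
      finally have s2: "(\<integral>x. exp (\<psi> (J x)) \<partial>\<mu>) \<le> (\<integral>x. exp (F x) \<partial>\<mu>) + exp b * (b * e)" .
      define X where "X = (\<integral>x. exp (F x) \<partial>\<mu>)"
      have X: "exp (- b) \<le> X" "0 < X"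
        unfolding X_def using mu.integral_exp_bounded_ge[OF Fm Fb] mu.integral_exp_bounded_pos[OF Fm Fb] .
      have "ln (\<integral>x. exp (\<psi> (J x)) \<partial>\<mu>) \<le> ln (X + exp b * (b * e))"
        using s2 mu.integral_exp_bounded_pos[of "\<lambda>x. \<psi> (J x)" b] \<psi>b unfolding X_def
        by (subst ln_le_cancel_iff) auto
      also have "\<dots> = ln (X * (1 + exp b * (b * e) / X))" using X by (simp add: distrib_left)
      also have "\<dots> = ln X + ln (1 + exp b * (b * e) / X)" using X b0 e 
        by (intro ln_mult_pos) (auto intro!: add_pos_nonneg)
      also have "\<dots> \<le> ln X + exp b * (b * e) / X" using X b0 e
        by (intro add_left_mono ln_add_one_self_le_self) auto
      also have "exp b * (b * e) / X \<le> exp b * (b * e) / exp (- b)"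
        using X b0 e by (intro divide_left_mono) auto
      also have "\<dots> = exp (2 * b) * b * e" by (simp add: exp_minus field_simps flip: exp_add)
      finally show "(\<integral>x. F x \<partial>\<nu>) \<le> K + ln (\<integral>x. exp (F x) \<partial>\<mu>) + (b + exp (2 * b) * b) * e"
        using s1 cont[OF \<psi>c \<psi>b] unfolding X_def by (simp add: algebra_simps)
    qed
    then show ?thesis unfolding F_def .
  qed
  show ?thesis unfolding entropy_bound_def
  proof safe
    fix F :: "'p \<Rightarrow> real" and b assume F[measurable]: "F \<in> borel_measurable \<mu>" and b: "\<forall>x. \<bar>F x\<bar> \<le> b"
    have Fn[measurable]: "F \<in> borel_measurable \<nu>" by (simp add: ms)
    show "(\<integral>x. F x \<partial>\<nu>) \<le> K + ln (\<integral>x. exp (F x) \<partial>\<mu>)"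
    proof (rule field_le_epsilon)
      fix e :: real assume e: "e > 0"
      \<comment> \<open>F is rounded down to multiples of e: since |F| \<le> b only finitely many
        levels occur, and G \<le> F \<le> G + e on the space. Monotonicity later replaces G by F
        inside the logarithm at no cost.\<close>
      define I where "I = {\<lfloor>- b / e\<rfloor>..\<lfloor>b / e\<rfloor>}"
      define A where "A i = {x \<in> space \<mu>. \<lfloor>F x / e\<rfloor> = i}" for i
      define G where "G x = (\<Sum>i\<in>I. (e * of_int i) * indicator (A i) x)" for x
      have A[measurable]: "A i \<in> sets \<mu>" for i unfolding A_def by measurable
      have Geq: "G x = e * of_int \<lfloor>F x / e\<rfloor>" if x: "x \<in> space \<mu>" for x
      proof -
        have "- b \<le> F x" "F x \<le> b" using b[rule_format, of x] by auto
        then have "- b / e \<le> F x / e" "F x / e \<le> b / e" using e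
          by (meson divide_right_mono less_imp_le)+
        then have "\<lfloor>F x / e\<rfloor> \<in> I" unfolding I_def by (simp add: floor_mono del: minus_divide_left)
        then have "G x = (\<Sum>i\<in>{\<lfloor>F x / e\<rfloor>}. (e * of_int i) * indicator (A i) x)"
          unfolding G_def by (intro sum.mono_neutral_right) (auto simp: I_def A_def)
        then show ?thesis using x by (simp add: A_def)
      qed
      have G1: "G x \<le> F x" "F x \<le> G x + e" if x: "x \<in> space \<mu>" for x
      proof -
        have "e * of_int \<lfloor>F x / e\<rfloor> \<le> e * (F x / e)" "e * (F x / e) \<le> e * (of_int \<lfloor>F x / e\<rfloor> + 1)"
          using e by (intro mult_left_mono; linarith)+
        moreover have "e * (F x / e) = F x" using e by simp
        ultimately show "G x \<le> F x" "F x \<le> G x + e" unfolding Geq[OF x] by (auto simp: distrib_left)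
      qed
      have Gm[measurable]: "G \<in> borel_measurable \<mu>" unfolding G_def by measurable
      have Gn[measurable]: "G \<in> borel_measurable \<nu>" by (simp add: ms)
      have GB: "x \<in> space \<mu> \<Longrightarrow> \<bar>G x\<bar> \<le> b + e" for x
        using G1[of x] b[rule_format, of x] e by (auto simp: abs_le_iff)
      have iG: "integrable \<nu> G" using GB by (intro nu.integrable_const_bound[where B="b+e"]) (auto simp: spc)
      have iF: "integrable \<nu> F" using b by (intro nu.integrable_bounded[where b=b]) auto
      have iE: "integrable \<mu> (\<lambda>x. exp (F x))" using b by (intro mu.integrable_exp_bounded[where b=b]) auto
      have iEG: "integrable \<mu> (\<lambda>x. exp (G x))" 
        using iE by (rule Bochner_Integration.integrable_bound) (auto simp: G1 intro!: AE_I2)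
      have pos: "0 < (\<integral>x. exp (G x) \<partial>\<mu>)"
      proof -
        have "exp (- (b + e)) = (\<integral>x. exp (- (b + e)) \<partial>\<mu>)" by (simp add: mu.prob_space)
        also have "\<dots> \<le> (\<integral>x. exp (G x) \<partial>\<mu>)" using iEG
        proof (intro integral_mono)
          fix x assume "x \<in> space \<mu>"
          from GB[OF this] show "exp (- (b + e)) \<le> exp (G x)" by auto
        qed auto
        finally show ?thesis by (meson exp_gt_zero less_le_trans)
      qed
      have "(\<integral>x. F x \<partial>\<nu>) \<le> (\<integral>x. G x + e \<partial>\<nu>)" using iF iG G1 spc by (intro integral_mono) auto
      also have "\<dots> = (\<integral>x. G x \<partial>\<nu>) + e" using iG by (simp add: nu.prob_space)
      also have "(\<integral>x. G x \<partial>\<nu>) \<le> K + ln (\<integral>x. exp (G x) \<partial>\<mu>)"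
        unfolding G_def by (rule simple) (auto simp: I_def)
      also have "ln (\<integral>x. exp (G x) \<partial>\<mu>) \<le> ln (\<integral>x. exp (F x) \<partial>\<mu>)"
        using pos iE iEG G1 by (intro ln_mono integral_mono) (auto intro: less_le_trans)
      finally show "(\<integral>x. F x \<partial>\<nu>) \<le> K + ln (\<integral>x. exp (F x) \<partial>\<mu>) + e" by simp
    qed
  qed
qed

section \<open>The path space\<close>

text \<open>The function space consists of bounded continuous maps; on a compact interval
  boundedness is automatic.\<close>

lemma mspace_path_metric:
  "mspace (path_metric T) = {h. h \<in> extensional {0..T} \<and> continuous_on {0..T} h}"
proof -
  have "compactin (top_of_set {0..T}) (topspace (top_of_set {0..T}))"
    by (simp add: compactin_subtopology)
  then show ?thesis unfolding path_metric_def
    by (subst compactin_mspace_cfunspace) auto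
qed

lemma space_path_space: "space (path_space T) = mspace (path_metric T)"
  by (simp add: path_space_def space_measure_of_conv)

lemma openin_path_metric:
  "openin (mtopology_of (path_metric T)) U \<longleftrightarrow> U \<subseteq> mspace (path_metric T) \<and>
     (\<forall>h\<in>U. \<exists>r>0. \<forall>g\<in>mspace (path_metric T). mdist (path_metric T) h g < r \<longrightarrow> g \<in> U)"
proof -
  interpret M: Metric_space "mspace (path_metric T)" "mdist (path_metric T)"
    by (rule Metric_space_mspace_mdist)
  have eq: "M.mball h r \<subseteq> U \<longleftrightarrow> (\<forall>g\<in>mspace (path_metric T). mdist (path_metric T) h g < r \<longrightarrow> g \<in> U)"
    if "h \<in> mspace (path_metric T)" for h r
    unfolding M.mball_def using that by blast
  have "(\<exists>r>0. M.mball h r \<subseteq> U) \<longleftrightarrow>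
      (\<exists>r>0. \<forall>g\<in>mspace (path_metric T). mdist (path_metric T) h g < r \<longrightarrow> g \<in> U)"
    if "U \<subseteq> mspace (path_metric T)" "h \<in> U" for h
    using that by (simp add: eq subset_iff Ball_def imp_conjL)
  then show ?thesis
    unfolding mtopology_of_def M.openin_mtopology Ball_def by (intro conj_cong all_cong1 imp_cong) simp_all
qed

lemma sets_path_space:
  "sets (path_space T) = sigma_sets (mspace (path_metric T)) {U. openin (mtopology_of (path_metric T)) U}"
  unfolding path_space_def by (rule sets_measure_of) (auto simp: openin_path_metric)

lemma mdist_path_metric_lt:
  assumes "h \<in> mspace (path_metric T)" "g \<in> mspace (path_metric T)"
    "mdist (path_metric T) h g < r" "t \<in> {0..T}"
  shows "dist (h t) (g t) < r"
proof -
  have c: "compactin (top_of_set {0..T}) (topspace (top_of_set {0..T}))"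
    by (simp add: compactin_subtopology)
  have "mdist euclidean_metric (h t) (g t) < r"
    by (rule cfunspace_mdist_lt[OF c, of h euclidean_metric g r t, folded path_metric_def]) (use assms in simp_all)
  then show ?thesis by simp
qed

lemma mdist_path_metric_le:
  assumes "0 \<le> r" "\<And>t. t \<in> {0..T} \<Longrightarrow> dist (h t) (g t) \<le> r"
  shows "mdist (path_metric T) h g \<le> r"
  unfolding path_metric_def using assms by (intro mdist_cfunspace_le) auto

lemma measurable_path_eval:
  assumes "t \<in> {0..T}"
  shows "(\<lambda>h. h t) \<in> borel_measurable (path_space T)"
proof (rule borel_measurableI)
  fix V :: "(real ^ 'n) set" assume V: "open V"
  have op: "openin (mtopology_of (path_metric T)) ((\<lambda>h. h t) -` V \<inter> space (path_space T))"
    unfolding openin_path_metric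
  proof (intro conjI ballI)
    fix h assume h: "h \<in> (\<lambda>h. h t) -` V \<inter> space (path_space T)"
    then obtain r where r: "r > 0" "ball (h t) r \<subseteq> V" using V openE by blast
    show "\<exists>r>0. \<forall>g\<in>mspace (path_metric T). mdist (path_metric T) h g < r \<longrightarrow> g \<in> (\<lambda>h. h t) -` V \<inter> space (path_space T)"
    proof (intro exI[of _ r] conjI ballI impI r(1))
      fix g assume g: "g \<in> mspace (path_metric T)" "mdist (path_metric T) h g < r"
      then have "dist (h t) (g t) < r"
        using h assms by (intro mdist_path_metric_lt) (auto simp: space_path_space)
      then have "g t \<in> V" using r(2) by (auto simp: ball_def)
      then show "g \<in> (\<lambda>h. h t) -` V \<inter> space (path_space T)" using g by (simp add: space_path_space)
    qed
  qed (auto simp: space_path_space)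
  then show "(\<lambda>h. h t) -` V \<inter> space (path_space T) \<in> sets (path_space T)"
    unfolding sets_path_space by (intro sigma_sets.Basic CollectI)
qed

section \<open>Borel sets of the path space from countably many times\<close>

definition rational_time :: "real \<Rightarrow> nat \<Rightarrow> real" where
  "rational_time T = from_nat_into (\<rat> \<inter> {0..T})"

lemma range_rational_time:
  assumes "T > 0" shows "range (rational_time T) = \<rat> \<inter> {0..T}"
proof -
  have "0 \<in> \<rat> \<inter> {0..T}" using assms by auto
  then show ?thesis unfolding rational_time_def
    by (intro range_from_nat_into) (auto intro: countable_subset[OF _ countable_rat])
qed

lemma rational_time_in: "T > 0 \<Longrightarrow> rational_time T i \<in> {0..T}"
  using range_rational_time[of T] by auto

text \<open>Encodes a path by its values on a countable dense set of times. The target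
  \<open>nat \<Rightarrow> real ^ 'n\<close> is Polish, so that the approximation by continuous
  functions can take place there.\<close>

definition sample_path :: "real \<Rightarrow> (real \<Rightarrow> real ^ 'n::finite) \<Rightarrow> nat \<Rightarrow> real ^ 'n" where
  "sample_path T h i = h (rational_time T i)"

lemma measurable_sample_path:
  assumes "T > 0" shows "sample_path T \<in> borel_measurable (path_space T)"
proof -
  have "sample_path T \<in> measurable (path_space T) (PiM UNIV (\<lambda>_. borel))"
    using rational_time_in[OF assms]
    by (intro measurable_PiM_single') (auto simp: sample_path_def space_PiM intro!: measurable_path_eval)
  then show ?thesis by (simp add: measurable_cong_sets[OF refl sets_PiM_equal_borel])
qed

text \<open>Separability in explicit form: every open set is a countable union of closed tubes
  around step functions with values in a countable dense set, and membership in a tube is a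
  condition at countably many rational times.\<close>

lemma path_space_sets_from_samples:
  fixes A :: "(real \<Rightarrow> real ^ 'n::finite) set"
  assumes T: "T > 0" and A: "A \<in> sets (path_space T)"
  shows "\<exists>A'\<in>sets borel. A = sample_path T -` A' \<inter> space (path_space T)"
proof -
  let ?M = "mspace (path_metric T) :: (real \<Rightarrow> real ^ 'n) set"
  define V where "V = vimage_algebra ?M (sample_path T) (borel :: (nat \<Rightarrow> real ^ 'n) measure)"
  have setsV: "sets V = {sample_path T -` A \<inter> ?M | A. A \<in> sets borel}"
    unfolding V_def by (rule sets_vimage_algebra2) auto
  have spV: "space V = ?M" by (simp add: V_def)
  obtain D :: "(real ^ 'n) set" where D: "countable D" "\<And>X. open X \<Longrightarrow> X \<noteq> {} \<Longrightarrow> \<exists>d\<in>D. d \<in> X"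
    using countable_dense_exists by metis
  \<comment> \<open>Only interior times are used: for t < T the index floor(t k / T) stays below k,
    the length of the list of values. The end points are recovered by continuity, since the closure
    of \<open>Q\<close> is [0,T].\<close>
  define Q where "Q = \<rat> \<inter> {0<..<T}"
  define C :: "nat \<Rightarrow> nat \<Rightarrow> (real ^ 'n) list \<Rightarrow> (real \<Rightarrow> real ^ 'n) set" where
    "C k m r = {g \<in> ?M. \<forall>t\<in>Q. dist (g t) (r ! nat \<lfloor>t * real k / T\<rfloor>) \<le> 1 / real (Suc m)}" for k m r
  have single: "{g \<in> ?M. dist (g t) x \<le> d} \<in> sets V" if "t \<in> Q" for t x d
  proof -
    have "t \<in> range (rational_time T)" using that range_rational_time[OF T] by (auto simp: Q_def)
    then obtain i where i: "rational_time T i = t" by auto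
    have "(\<lambda>z::nat \<Rightarrow> real ^ 'n. z i) \<in> borel_measurable borel"
      by (intro borel_measurable_continuous_onI continuous_on_product_coordinates)
    then have "{z::nat \<Rightarrow> real ^ 'n. dist (z i) x \<le> d} \<in> sets borel" by measurable
    moreover have "{g \<in> ?M. dist (g t) x \<le> d} = sample_path T -` {z. dist (z i) x \<le> d} \<inter> ?M"
      by (auto simp: sample_path_def i)
    ultimately show ?thesis unfolding setsV by blast
  qed
  have countQ: "countable Q" unfolding Q_def by (auto intro: countable_subset[OF _ countable_rat])
  \<comment> \<open>\<open>Q\<close> has to be nonempty: an intersection over the empty set would be
    everything instead of a set of paths.\<close>
  obtain t0 where t0: "t0 \<in> Q" using Rats_dense_in_real[OF T] by (auto simp: Q_def)
  have CV: "C k m r \<in> sets V" for k m r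
  proof -
    have "C k m r = (\<Inter>t\<in>Q. {g \<in> ?M. dist (g t) (r ! nat \<lfloor>t * real k / T\<rfloor>) \<le> 1 / real (Suc m)})"
      using t0 unfolding C_def by auto
    also have "\<dots> \<in> sets V" using t0 countQ single by (intro sets.countable_INT') auto
    finally show ?thesis .
  qed
  have clQ: "closure Q = {0..T}"
  proof -
    have "closure ({0<..<T} \<inter> \<rat>) = closure {0<..<T}"
      by (rule closure_open_Int_superset) (auto simp: Rats_closure_real)
    then show ?thesis using T by (simp add: Q_def Int_commute)
  qed
  have opV: "U \<in> sets V" if U: "openin (mtopology_of (path_metric T)) U" for U
  proof -
    define I where "I = {(k, m, r). r \<in> lists D \<and> C k m r \<subseteq> U}"
    have "countable ((UNIV :: nat set) \<times> (UNIV :: nat set) \<times> lists D)" using D(1) by auto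
    then have cI: "countable I" by (rule countable_subset[rotated]) (auto simp: I_def)
    have "U = (\<Union>(k, m, r)\<in>I. C k m r)"
    proof safe
      fix h assume h: "h \<in> U"
      then have hM: "h \<in> ?M" using U by (auto simp: openin_path_metric)
      obtain e where e: "e > 0" "\<And>g. g \<in> ?M \<Longrightarrow> mdist (path_metric T) h g < e \<Longrightarrow> g \<in> U"
        using U h unfolding openin_path_metric by blast
      obtain m where m: "1 / real (Suc m) < e / 2" using e(1) nat_approx_posE[of "e/2"] by auto
      \<comment> \<open>Half of the tube radius. One \<delta> pays for the oscillation of h within a
        cell, the other for moving the value of h at the left end of the cell into the dense
        set.\<close>
      define \<delta> where "\<delta> = 1 / (2 * real (Suc m))"
      have \<delta>: "\<delta> > 0" "\<delta> + \<delta> = 1 / real (Suc m)" by (auto simp: \<delta>_def field_simps)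
      have ch: "continuous_on {0..T} h" using hM by (simp add: mspace_path_metric)
      then have "uniformly_continuous_on {0..T} h" by (intro compact_uniformly_continuous) auto
      then obtain d where d: "d > 0" "\<And>s t. s \<in> {0..T} \<Longrightarrow> t \<in> {0..T} \<Longrightarrow> dist s t < d \<Longrightarrow> dist (h s) (h t) < \<delta>"
        unfolding uniformly_continuous_on_def using \<delta>(1) by metis
      obtain k0 where k0: "T / d < real k0" using reals_Archimedean2 by blast
      define k where "k = Suc k0"
      have "T / d < real k" using k0 by (simp add: k_def)
      then have k: "T / real k < d" using d(1) by (simp add: k_def field_simps)
      have k0: "real k > 0" by (simp add: k_def)
      have "\<exists>x\<in>D. dist (h (real i * T / real k)) x < \<delta>" for i
        using D(2)[of "ball (h (real i * T / real k)) \<delta>"] \<delta>(1) by (auto simp: Bex_def)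
      then have "\<exists>x. \<forall>i. x i \<in> D \<and> dist (h (real i * T / real k)) (x i) < \<delta>"
        by (intro choice) blast
      then obtain x where x: "\<And>i. x i \<in> D" "\<And>i. dist (h (real i * T / real k)) (x i) < \<delta>" by blast
      define r where "r = map x [0..<k]"
      have fl: "nat \<lfloor>t * real k / T\<rfloor> < k" "real (nat \<lfloor>t * real k / T\<rfloor>) * T / real k \<in> {0..T}"
        "dist t (real (nat \<lfloor>t * real k / T\<rfloor>) * T / real k) < d" if t: "t \<in> Q" for t
      proof -
        have tt: "0 < t" "t < T" using t by (auto simp: Q_def)
        define j where "j = nat \<lfloor>t * real k / T\<rfloor>"
        have pos: "0 \<le> t * real k / T" using tt T by auto
        have j1: "real j \<le> t * real k / T" "t * real k / T < real j + 1"
          unfolding j_def using pos by linarith+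
        have "t * real k / T < real k" using tt T k0 by (simp add: field_simps)
        then have jk: "j < k" using j1 by linarith
        have a: "real j * T / real k \<le> t" using j1(1) T k0 by (simp add: field_simps)
        have "t * real k < (real j + 1) * T" using j1(2) T by (simp add: field_simps)
        then have "t < real j * T / real k + T / real k" using k0 by (simp add: field_simps)
        then have "dist t (real j * T / real k) < d" using a k by (simp add: dist_real_def)
        then show "nat \<lfloor>t * real k / T\<rfloor> < k" "real (nat \<lfloor>t * real k / T\<rfloor>) * T / real k \<in> {0..T}"
        "dist t (real (nat \<lfloor>t * real k / T\<rfloor>) * T / real k) < d"
          using a tt jk T unfolding j_def[symmetric] by auto
      qed
      have "h \<in> C k m r"
        unfolding C_def
      proof (safe)
        fix t assume t: "t \<in> Q"
        then have tT: "t \<in> {0..T}" by (auto simp: Q_def)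
        have "r ! nat \<lfloor>t * real k / T\<rfloor> = x (nat \<lfloor>t * real k / T\<rfloor>)"
          using fl[OF t] by (simp add: r_def)
        moreover have "dist (h t) (h (real (nat \<lfloor>t * real k / T\<rfloor>) * T / real k)) < \<delta>"
          using d(2)[OF tT fl(2,3)[OF t]] .
        ultimately have "dist (h t) (r ! nat \<lfloor>t * real k / T\<rfloor>) < \<delta> + \<delta>"
          using x(2)[of "nat \<lfloor>t * real k / T\<rfloor>"] by (metis dist_triangle_less_add dist_commute)
        then show "dist (h t) (r ! nat \<lfloor>t * real k / T\<rfloor>) \<le> 1 / real (Suc m)" using \<delta> by simp
      qed (use hM in auto)
      moreover have "r \<in> lists D" using x(1) by (auto simp: r_def)
      moreover have "C k m r \<subseteq> U"
      proof
        fix g assume g: "g \<in> C k m r"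
        then have gM: "g \<in> ?M" by (simp add: C_def)
        \<comment> \<open>Two members of the same tube differ by at most twice its radius at times
          in \<open>Q\<close>, hence on all of [0,T] by continuity; \<open>m\<close> was taken so
          that this stays below e.\<close>
        have dl: "dist (h t) (g t) \<le> 2 / real (Suc m)" if t: "t \<in> {0..T}" for t
        proof (rule continuous_le_on_closure[where f="\<lambda>t. dist (h t) (g t)" and x=t])
          show "continuous_on (closure Q) (\<lambda>t. dist (h t) (g t))"
            unfolding clQ using ch gM by (intro continuous_intros) (auto simp: mspace_path_metric)
          show "t \<in> closure Q" using t clQ by simp
          fix t assume t: "t \<in> Q"
          have "dist (h t) (r ! nat \<lfloor>t * real k / T\<rfloor>) \<le> 1 / real (Suc m)"
            "dist (g t) (r ! nat \<lfloor>t * real k / T\<rfloor>) \<le> 1 / real (Suc m)"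
            using g \<open>h \<in> C k m r\<close> t by (auto simp: C_def)
          moreover have "2 / real (Suc m) = 1 / real (Suc m) + 1 / real (Suc m)" by simp
          ultimately show "dist (h t) (g t) \<le> 2 / real (Suc m)"
            using dist_triangle2[of "h t" "g t" "r ! nat \<lfloor>t * real k / T\<rfloor>"] by linarith
        qed
        have "mdist (path_metric T) h g \<le> 2 / real (Suc m)"
          by (rule mdist_path_metric_le[OF _ dl]) auto
        moreover have "2 / real (Suc m) < e" using m by (simp add: field_simps)
        ultimately show "g \<in> U" using e(2)[OF gM] by linarith
      qed
      ultimately show "h \<in> (\<Union>(k, m, r)\<in>I. C k m r)" unfolding I_def by blast
    qed (auto simp: I_def)
    also have "\<dots> \<in> sets V" using cI CV by (intro sets.countable_UN') auto
    finally show ?thesis .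
  qed
  have "sets (path_space T) \<subseteq> sets V"
    unfolding sets_path_space spV[symmetric] by (rule sets.sigma_sets_subset) (use opV in auto)
  then have "A \<in> sets V" using A by blast
  then show ?thesis unfolding setsV space_path_space by auto
qed

section \<open>Gaussian measures on Euclidean space\<close>

text \<open>Approximating the indicator in L1 of both measures by one continuous function explains a
  gap of at most 2e, whereas e is a third of the supposed gap.\<close>

lemma measure_eqI_continuous:
  fixes P Q :: "'x::polish_space measure"
  assumes P: "prob_space P" "sets P = sets borel" and Q: "prob_space Q" "sets Q = sets borel"
    and eq: "\<And>\<phi> :: 'x \<Rightarrow> real. continuous_on UNIV \<phi> \<Longrightarrow> (\<And>x. 0 \<le> \<phi> x) \<Longrightarrow> (\<And>x. \<phi> x \<le> 1) \<Longrightarrow>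
       (\<integral>x. \<phi> x \<partial>P) = (\<integral>x. \<phi> x \<partial>Q)"
  shows "P = Q"
proof (rule measure_eqI)
  interpret P: prob_space P by fact
  interpret Q: prob_space Q by fact
  show "sets P = sets Q" using P Q by simp
  fix A assume "A \<in> sets P"
  then have A: "A \<in> sets borel" using P by simp
  have diff: "\<bar>measure R A - (\<integral>x. \<phi> x \<partial>R)\<bar> \<le> e"
    if R: "prob_space R" "sets R = sets borel" and \<phi>: "continuous_on UNIV \<phi>" "\<And>x. 0 \<le> \<phi> x" "\<And>x. \<phi> x \<le> 1"
      "(\<integral>x. \<bar>indicator A x - \<phi> x\<bar> \<partial>R) \<le> e" for R e and \<phi> :: "'x \<Rightarrow> real"
  proof -
    interpret R: prob_space R by fact
    have [measurable]: "\<phi> \<in> borel_measurable R" "A \<in> sets R"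
      using borel_measurable_continuous_onI[OF \<phi>(1)] R A by (auto simp: measurable_cong_sets[OF R(2) refl])
    have b: "\<bar>\<phi> x\<bar> \<le> 1" "\<bar>indicator A x :: real\<bar> \<le> 1" for x using \<phi>(2,3)[of x] by (auto simp: indicator_def)
    have i: "integrable R \<phi>" "integrable R (indicator A :: _ \<Rightarrow> real)"
      by (rule R.integrable_bounded[OF _ b(1)] R.integrable_bounded[OF _ b(2)], measurable)+
    have "measure R A - (\<integral>x. \<phi> x \<partial>R) = (\<integral>x. indicator A x - \<phi> x \<partial>R)"
      using i sets.sets_into_space[of A R] by (simp add: Int_absorb2)
    also have "\<bar>\<dots>\<bar> \<le> (\<integral>x. \<bar>indicator A x - \<phi> x\<bar> \<partial>R)" by (rule integral_abs_bound)
    finally show ?thesis using \<phi>(4) by linarith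
  qed
  have "measure P A = measure Q A"
  proof (rule ccontr)
    assume ne: "measure P A \<noteq> measure Q A"
    define e where "e = \<bar>measure P A - measure Q A\<bar> / 3"
    have e: "e > 0" using ne by (simp add: e_def)
    obtain \<phi> :: "'x \<Rightarrow> real" where \<phi>: "continuous_on UNIV \<phi>" "\<And>x. 0 \<le> \<phi> x" "\<And>x. \<phi> x \<le> 1"
      "(\<integral>x. \<bar>indicator A x - \<phi> x\<bar> \<partial>P) \<le> e" "(\<integral>x. \<bar>indicator A x - \<phi> x\<bar> \<partial>Q) \<le> e"
      by (rule continuous_approx_indicator[OF P.finite_measure_axioms P(2) Q.finite_measure_axioms Q(2) A e]) blast
    have "\<bar>measure P A - measure Q A\<bar> \<le> e + e"
      using diff[OF P \<phi>(1-3,4)] diff[OF Q \<phi>(1-3,5)] eq[OF \<phi>(1-3)] by (simp only: abs_le_iff) linarith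
    then show False using e by (simp add: e_def)
  qed
  then show "emeasure P A = emeasure Q A" by (simp add: P.emeasure_eq_measure Q.emeasure_eq_measure)
qed

lemma integral_lborel_prod:
  fixes f :: "'a::euclidean_space \<Rightarrow> real \<Rightarrow> 'b::{real_normed_field,banach,second_countable_topology}"
  assumes "\<And>b. b \<in> Basis \<Longrightarrow> integrable lborel (f b)"
  shows "(\<integral>x. (\<Prod>b\<in>Basis. f b (x \<bullet> b)) \<partial>lborel) = (\<Prod>b\<in>Basis. (\<integral>x. f b x \<partial>lborel))"
proof -
  interpret product_sigma_finite "\<lambda>_::'a. lborel :: real measure" ..
  have [measurable]: "b \<in> Basis \<Longrightarrow> f b \<in> borel_measurable borel" for b
    using borel_measurable_integrable[OF assms] by simp
  have "(\<integral>x. (\<Prod>b\<in>Basis. f b (x \<bullet> b)) \<partial>lborel)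
      = (\<integral>y. (\<Prod>b\<in>Basis. f b ((\<Sum>b\<in>Basis. y b *\<^sub>R b) \<bullet> b)) \<partial>PiM Basis (\<lambda>_. lborel))"
    by (subst lborel_eq, subst integral_distr) (auto simp: comp_def)
  also have "\<dots> = (\<integral>y. (\<Prod>b\<in>Basis. f b (y b)) \<partial>PiM Basis (\<lambda>_. lborel))"
    by (intro Bochner_Integration.integral_cong prod.cong) (auto simp: inner_sum_left inner_Basis if_distrib cong: if_cong)
  also have "\<dots> = (\<Prod>b\<in>Basis. (\<integral>x. f b x \<partial>lborel))"
    using assms by (intro product_integral_prod) auto
  finally show ?thesis .
qed

text \<open>The parameter is a standard deviation: for \<sigma> > 0 this is the isotropic centred
  Gaussian density with covariance \<sigma>^2 times the identity.\<close>

definition gauss_density :: "real \<Rightarrow> 'a::euclidean_space \<Rightarrow> real" where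
  "gauss_density \<sigma> x = (\<Prod>b\<in>Basis. normal_density 0 \<sigma> (x \<bullet> b))"

text \<open>Given by a density because the shift argument changes variables under the integral.
  \<open>is_gaussian\<close> prescribes one-dimensional projections instead;
  \<open>is_gaussian_mat_eq_gauss\<close> joins the two descriptions.\<close>

definition gauss :: "real \<Rightarrow> 'a::euclidean_space measure" where
  "gauss \<sigma> = density lborel (\<lambda>x. ennreal (gauss_density \<sigma> x))"

lemma norm_power2_Basis: "(norm (x::'a::euclidean_space))\<^sup>2 = (\<Sum>b\<in>Basis. (x \<bullet> b)\<^sup>2)"
  by (subst power2_norm_eq_inner, subst euclidean_inner) (simp add: power2_eq_square)

lemma gauss_density_eq:
  "gauss_density \<sigma> (x::'a::euclidean_space)
     = (1 / sqrt (2 * pi * \<sigma>\<^sup>2)) ^ DIM('a) * exp (- (norm x)\<^sup>2 / (2 * \<sigma>\<^sup>2))"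
  unfolding gauss_density_def normal_density_def prod.distrib norm_power2_Basis
  by (simp add: exp_sum sum_negf sum_divide_distrib flip: exp_sum)

lemma gauss_density_nonneg: "0 \<le> gauss_density \<sigma> x"
  unfolding gauss_density_def by (intro prod_nonneg) auto

lemma measurable_gauss_density [measurable]: "gauss_density \<sigma> \<in> borel_measurable borel"
  unfolding gauss_density_def by measurable

lemma space_gauss [simp]: "space (gauss \<sigma>) = UNIV"
  and sets_gauss [simp, measurable_cong]: "sets (gauss \<sigma>) = sets borel"
  by (simp_all add: gauss_def)

lemma prob_space_gauss:
  assumes "\<sigma> > 0" shows "prob_space (gauss \<sigma> :: 'a::euclidean_space measure)"
proof
  have 1: "(\<integral>\<^sup>+x. ennreal (normal_density 0 \<sigma> x) \<partial>lborel) = 1"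
    using prob_space.emeasure_space_1[OF prob_space_normal_density[of \<sigma> 0]] assms
    by (simp add: emeasure_density)
  have "emeasure (gauss \<sigma>) (space (gauss \<sigma> :: 'a measure)) = (\<integral>\<^sup>+x. ennreal (gauss_density \<sigma> (x::'a)) \<partial>lborel)"
    by (simp add: gauss_def emeasure_density)
  also have "\<dots> = (\<integral>\<^sup>+x. (\<Prod>b\<in>Basis. ennreal (normal_density 0 \<sigma> ((x::'a) \<bullet> b))) \<partial>lborel)"
    unfolding gauss_density_def by (simp add: prod_ennreal)
  also have "\<dots> = (\<Prod>b\<in>(Basis::'a set). (\<integral>\<^sup>+x. ennreal (normal_density 0 \<sigma> x) \<partial>lborel))"
    by (rule nn_integral_lborel_prod) auto
  finally show "emeasure (gauss \<sigma>) (space (gauss \<sigma> :: 'a measure)) = 1" by (simp add: 1)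
qed

lemma integral_normal_iexp:
  assumes "\<sigma> > 0"
  shows "integrable lborel (\<lambda>x. normal_density 0 \<sigma> x *\<^sub>R iexp (t * x))"
    "(\<integral>x. normal_density 0 \<sigma> x *\<^sub>R iexp (t * x) \<partial>lborel) = complex_of_real (exp (- (\<sigma>\<^sup>2 * t\<^sup>2) / 2))"
proof -
  have "integrable lborel (normal_density 0 \<sigma>)" using assms by (rule integrable_normal_density)
  then show "integrable lborel (\<lambda>x. normal_density 0 \<sigma> x *\<^sub>R iexp (t * x))"
    by (rule Bochner_Integration.integrable_bound) (auto simp: norm_mult)
  have "complex_of_real (exp (- ((\<sigma> * t)\<^sup>2) / 2)) = (\<integral>x. std_normal_density x *\<^sub>R iexp (\<sigma> * t * x) \<partial>lborel)"
    using fun_cong[OF char_std_normal_distribution, of "\<sigma> * t"] unfolding char_def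
    by (subst (asm) integral_density) auto
  also have "\<dots> = (\<integral>x. \<sigma> *\<^sub>R (normal_density 0 \<sigma> (\<sigma> * x) *\<^sub>R iexp (t * (\<sigma> * x))) \<partial>lborel)"
    using assms by (intro Bochner_Integration.integral_cong)
      (auto simp: normal_density_def real_sqrt_mult power_mult_distrib scaleR_conv_of_real field_simps)
  also have "\<dots> = (\<integral>x. normal_density 0 \<sigma> x *\<^sub>R iexp (t * x) \<partial>lborel)"
    using assms lborel_integral_real_affine[of \<sigma> "\<lambda>x. normal_density 0 \<sigma> x *\<^sub>R iexp (t * x)" 0]
    by (simp del: scaleR_scaleR)
  finally show "(\<integral>x. normal_density 0 \<sigma> x *\<^sub>R iexp (t * x) \<partial>lborel) = complex_of_real (exp (- (\<sigma>\<^sup>2 * t\<^sup>2) / 2))"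
    by (simp add: power_mult_distrib)
qed

text \<open>Density and exponential both factor over the coordinates, which reduces the claim to
  dimension one.\<close>

lemma char_gauss:
  fixes u :: "'a::euclidean_space"
  assumes "\<sigma> > 0"
  shows "(\<integral>x. iexp (u \<bullet> x) \<partial>gauss \<sigma>) = complex_of_real (exp (- (\<sigma>\<^sup>2 * (norm u)\<^sup>2) / 2))"
proof -
  have "(\<integral>x. iexp (u \<bullet> x) \<partial>gauss \<sigma>) = (\<integral>x. gauss_density \<sigma> x *\<^sub>R iexp (u \<bullet> x) \<partial>lborel)"
    unfolding gauss_def by (subst integral_density) (auto simp: gauss_density_nonneg)
  also have "\<dots> = (\<integral>x. (\<Prod>b\<in>Basis. normal_density 0 \<sigma> (x \<bullet> b) *\<^sub>R iexp ((u \<bullet> b) * (x \<bullet> b))) \<partial>lborel)"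
  proof (intro Bochner_Integration.integral_cong refl)
    fix x :: 'a
    have "iexp (u \<bullet> x) = (\<Prod>b\<in>Basis. iexp ((u \<bullet> b) * (x \<bullet> b)))"
      by (subst euclidean_inner) (simp add: sum_distrib_left exp_sum)
    then show "gauss_density \<sigma> x *\<^sub>R iexp (u \<bullet> x) =
        (\<Prod>b\<in>Basis. normal_density 0 \<sigma> (x \<bullet> b) *\<^sub>R iexp ((u \<bullet> b) * (x \<bullet> b)))"
      by (simp only: gauss_density_def prod.distrib scaleR_conv_of_real of_real_prod)
  qed
  also have "\<dots> = (\<Prod>b\<in>Basis. \<integral>x. normal_density 0 \<sigma> x *\<^sub>R iexp ((u \<bullet> b) * x) \<partial>lborel)"
    by (rule integral_lborel_prod) (rule integral_normal_iexp[OF assms])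
  also have "\<dots> = complex_of_real (\<Prod>b\<in>(Basis::'a set). exp (- (\<sigma>\<^sup>2 * (u \<bullet> b)\<^sup>2) / 2))"
    using integral_normal_iexp(2)[OF assms] by simp
  also have "(\<Prod>b\<in>(Basis::'a set). exp (- (\<sigma>\<^sup>2 * (u \<bullet> b)\<^sup>2) / 2)) = exp (- (\<sigma>\<^sup>2 * (norm u)\<^sup>2) / 2)"
    by (simp add: norm_power2_Basis sum_distrib_left sum_divide_distrib sum_negf flip: exp_sum)
  finally show ?thesis .
qed

lemma gauss_scale:
  assumes "\<sigma> > 0" shows "gauss \<sigma> = distr (gauss 1 :: 'a::euclidean_space measure) borel (\<lambda>x. \<sigma> *\<^sub>R x)"
proof (rule measure_eqI)
  fix A :: "'a set" assume "A \<in> sets (gauss \<sigma>)"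
  then have [measurable]: "A \<in> sets borel" by simp
  have [measurable]: "(\<lambda>x. \<sigma> *\<^sub>R x) -` A \<in> sets borel"
    using measurable_sets_borel[of "\<lambda>x. \<sigma> *\<^sub>R x" borel A] by simp
  have eq: "ennreal (\<sigma> ^ DIM('a)) * ennreal (gauss_density \<sigma> (\<sigma> *\<^sub>R x)) = ennreal (gauss_density 1 x)" for x :: 'a
  proof -
    have "sqrt (2 * pi * \<sigma>\<^sup>2) = sqrt (2 * pi) * \<sigma>" using assms by (simp add: real_sqrt_mult)
    then have "\<sigma> ^ DIM('a) * gauss_density \<sigma> (\<sigma> *\<^sub>R x) = gauss_density 1 x"
      using assms by (simp add: gauss_density_eq power_mult_distrib power_divide)
    then show ?thesis using assms by (simp flip: ennreal_mult' add: gauss_density_nonneg)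
  qed
  have "emeasure (gauss \<sigma>) A = (\<integral>\<^sup>+x. ennreal (gauss_density \<sigma> x) * indicator A x \<partial>lborel)"
    by (simp add: gauss_def emeasure_density)
  also have "\<dots> = (\<integral>\<^sup>+x. ennreal (gauss_density 1 x) * indicator A (\<sigma> *\<^sub>R x) \<partial>lborel)"
    using assms by (subst lborel_affine[of \<sigma> 0])
     (auto simp: nn_integral_density nn_integral_distr eq mult.assoc[symmetric])
  also have "\<dots> = emeasure (gauss 1) ((\<lambda>x. \<sigma> *\<^sub>R x) -` A)"
    by (subst gauss_def, subst emeasure_density) (auto simp: indicator_def intro!: nn_integral_cong)
  also have "\<dots> = emeasure (distr (gauss 1 :: 'a measure) borel (\<lambda>x. \<sigma> *\<^sub>R x)) A"
    by (subst emeasure_distr) auto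
  finally show "emeasure (gauss \<sigma>) A = emeasure (distr (gauss 1 :: 'a measure) borel (\<lambda>x. \<sigma> *\<^sub>R x)) A" .
qed simp

text \<open>Convolution with a Gaussian of variance \<open>\<sigma>\<^sup>2\<close> turns a measure into a density determined by
  its characteristic function; then \<open>\<sigma> \<rightarrow> 0\<close>.\<close>

lemma Levy_uniqueness_euclidean:
  fixes P Q :: "'a::euclidean_space measure"
  assumes P: "prob_space P" "sets P = sets borel" and Q: "prob_space Q" "sets Q = sets borel"
    and char: "\<And>u. (\<integral>x. iexp (u \<bullet> x) \<partial>P) = (\<integral>x. iexp (u \<bullet> x) \<partial>Q)"
  shows "P = Q"
proof -
  let ?G = "gauss 1 :: 'a measure"
  interpret G: prob_space ?G by (rule prob_space_gauss) simp
  \<comment> \<open>The Gaussian kernel is itself a characteristic function: exp(-|y - x|^2 / (2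
    \<sigma>^2)) is that of the standard Gaussian at (y - x)/\<sigma>. Exchanging the integrals
    expresses the smoothed measure through the characteristic function of R.\<close>
  have smooth: "complex_of_real (\<integral>x. exp (- (norm (y - x))\<^sup>2 / (2 * \<sigma>\<^sup>2)) \<partial>R)
      = (\<integral>u. iexp (u \<bullet> (y /\<^sub>R \<sigma>)) * (\<integral>x. iexp ((- u /\<^sub>R \<sigma>) \<bullet> x) \<partial>R) \<partial>?G)"
    if R: "prob_space R" "sets R = sets borel" and \<sigma>: "\<sigma> > 0" for R :: "'a measure" and y \<sigma>
  proof -
    interpret R: prob_space R by fact
    interpret RG: pair_prob_space R ?G ..
    note [measurable_cong] = R(2)
    have sc: "- (norm ((y - x) /\<^sub>R \<sigma>))\<^sup>2 / 2 = - (norm (y - x))\<^sup>2 / (2 * \<sigma>\<^sup>2)" for x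
    proof -
      have "norm ((y - x) /\<^sub>R \<sigma>) = norm (y - x) / \<sigma>" using \<sigma> by (simp add: divide_inverse mult.commute)
      then show ?thesis by (simp only: power_divide) simp
    qed
    have "complex_of_real (\<integral>x. exp (- (norm (y - x))\<^sup>2 / (2 * \<sigma>\<^sup>2)) \<partial>R)
       = (\<integral>x. complex_of_real (exp (- (norm ((y - x) /\<^sub>R \<sigma>))\<^sup>2 / 2)) \<partial>R)"
      unfolding sc by (rule integral_complex_of_real[symmetric])
    also have "\<dots> = (\<integral>x. (\<integral>u. iexp (((y - x) /\<^sub>R \<sigma>) \<bullet> u) \<partial>?G) \<partial>R)"
      by (subst char_gauss) auto
    also have "\<dots> = (\<integral>x. (\<integral>u. iexp (u \<bullet> (y /\<^sub>R \<sigma>)) * iexp ((- u /\<^sub>R \<sigma>) \<bullet> x) \<partial>?G) \<partial>R)"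
    proof (intro Bochner_Integration.integral_cong refl)
      fix x u :: 'a
      have "((y - x) /\<^sub>R \<sigma>) \<bullet> u = u \<bullet> (y /\<^sub>R \<sigma>) + (- u /\<^sub>R \<sigma>) \<bullet> x"
        by (simp add: scaleR_right_diff_distrib inner_diff_left inner_commute[of u])
      then show "iexp (((y - x) /\<^sub>R \<sigma>) \<bullet> u) = iexp (u \<bullet> (y /\<^sub>R \<sigma>)) * iexp ((- u /\<^sub>R \<sigma>) \<bullet> x)"
        by (simp only: of_real_add distrib_left exp_add)
    qed
    also have "\<dots> = (\<integral>u. (\<integral>x. iexp (u \<bullet> (y /\<^sub>R \<sigma>)) * iexp ((- u /\<^sub>R \<sigma>) \<bullet> x) \<partial>R) \<partial>?G)"
    proof (rule RG.Fubini_integral[symmetric])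
      show "integrable (R \<Otimes>\<^sub>M ?G) (\<lambda>(x, u). iexp (u \<bullet> (y /\<^sub>R \<sigma>)) * iexp ((- u /\<^sub>R \<sigma>) \<bullet> x))"
        by (rule RG.integrable_const_bound[where B=1]) (auto simp: norm_mult case_prod_unfold)
    qed
    finally show ?thesis by simp
  qed
  have dens: "(\<integral>\<^sup>+x. ennreal (gauss_density \<sigma> (y - x)) \<partial>P) = (\<integral>\<^sup>+x. ennreal (gauss_density \<sigma> (y - x)) \<partial>Q)"
    if \<sigma>: "\<sigma> > 0" for \<sigma> y
  proof -
    have "complex_of_real (\<integral>x. exp (- (norm (y - x))\<^sup>2 / (2 * \<sigma>\<^sup>2)) \<partial>P)
       = complex_of_real (\<integral>x. exp (- (norm (y - x))\<^sup>2 / (2 * \<sigma>\<^sup>2)) \<partial>Q)"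
      unfolding smooth[OF P \<sigma>] smooth[OF Q \<sigma>] char ..
    then have e: "(\<integral>x. exp (- (norm (y - x))\<^sup>2 / (2 * \<sigma>\<^sup>2)) \<partial>P) = (\<integral>x. exp (- (norm (y - x))\<^sup>2 / (2 * \<sigma>\<^sup>2)) \<partial>Q)"
      by (simp only: of_real_eq_iff)
    have R: "(\<integral>\<^sup>+x. ennreal (gauss_density \<sigma> (y - x)) \<partial>R)
        = ennreal ((1 / sqrt (2 * pi * \<sigma>\<^sup>2)) ^ DIM('a) * (\<integral>x. exp (- (norm (y - x))\<^sup>2 / (2 * \<sigma>\<^sup>2)) \<partial>R))"
      if R: "prob_space R" "sets R = sets borel" for R :: "'a measure"
    proof -
      interpret R: prob_space R by fact
      note [measurable_cong] = R(2)
      have "integrable R (\<lambda>x. gauss_density \<sigma> (y - x))" unfolding gauss_density_eq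
        by (intro integrable_mult_right R.integrable_const_bound[where B=1]) (auto simp: divide_nonpos_nonneg)
      then have "(\<integral>\<^sup>+x. ennreal (gauss_density \<sigma> (y - x)) \<partial>R) = ennreal (\<integral>x. gauss_density \<sigma> (y - x) \<partial>R)"
        by (intro nn_integral_eq_integral) (auto simp: gauss_density_nonneg)
      then show ?thesis unfolding gauss_density_eq by simp
    qed
    show ?thesis unfolding R[OF P] R[OF Q] e ..
  qed
  \<comment> \<open>The expectation of f at x + \<sigma> z, with x and z independent, becomes an
    integral against the density of the sum, which by \<open>dens\<close> is the same for P and
    Q.\<close>
  have conv_nn: "(\<integral>\<^sup>+x. \<integral>\<^sup>+z. f (x + \<sigma> *\<^sub>R z) \<partial>?G \<partial>R) = (\<integral>\<^sup>+y. f y * (\<integral>\<^sup>+x. ennreal (gauss_density \<sigma> (y - x)) \<partial>R) \<partial>lborel)"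
    if R: "prob_space R" "sets R = sets borel" and \<sigma>: "\<sigma> > 0" and [measurable]: "f \<in> borel_measurable borel"
    for f :: "'a \<Rightarrow> ennreal" and R :: "'a measure" and \<sigma>
  proof -
    interpret R: prob_space R by fact
    interpret RL: pair_sigma_finite R "lborel :: 'a measure" ..
    note [measurable_cong] = R(2)
    have "(\<integral>\<^sup>+z. f (x + \<sigma> *\<^sub>R z) \<partial>?G) = (\<integral>\<^sup>+y. f y * ennreal (gauss_density \<sigma> (y - x)) \<partial>lborel)" for x
    proof -
      have "(\<integral>\<^sup>+z. f (x + \<sigma> *\<^sub>R z) \<partial>?G) = (\<integral>\<^sup>+z. f (x + z) \<partial>gauss \<sigma>)"
        unfolding gauss_scale[OF \<sigma>] by (subst nn_integral_distr) auto
      also have "\<dots> = (\<integral>\<^sup>+z. f (x + z) * ennreal (gauss_density \<sigma> ((x + z) - x)) \<partial>lborel)"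
        unfolding gauss_def by (subst nn_integral_density) (auto simp: mult.commute)
      also have "\<dots> = (\<integral>\<^sup>+y. f y * ennreal (gauss_density \<sigma> (y - x)) \<partial>distr lborel borel ((+) x))"
        by (subst nn_integral_distr) auto
      finally show ?thesis unfolding lborel_distr_plus .
    qed
    then have "(\<integral>\<^sup>+x. \<integral>\<^sup>+z. f (x + \<sigma> *\<^sub>R z) \<partial>?G \<partial>R) = (\<integral>\<^sup>+x. \<integral>\<^sup>+y. f y * ennreal (gauss_density \<sigma> (y - x)) \<partial>lborel \<partial>R)"
      by simp
    also have "\<dots> = (\<integral>\<^sup>+y. \<integral>\<^sup>+x. f y * ennreal (gauss_density \<sigma> (y - x)) \<partial>R \<partial>lborel)"
      by (rule RL.Fubini'[symmetric]) measurable
    also have "\<dots> = (\<integral>\<^sup>+y. f y * (\<integral>\<^sup>+x. ennreal (gauss_density \<sigma> (y - x)) \<partial>R) \<partial>lborel)"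
      by (intro nn_integral_cong nn_integral_cmult) measurable
    finally show ?thesis .
  qed
  show ?thesis
  proof (rule measure_eqI_continuous[OF P Q])
    fix \<phi> :: "'a \<Rightarrow> real" assume \<phi>: "continuous_on UNIV \<phi>" "\<And>x. 0 \<le> \<phi> x" "\<And>x. \<phi> x \<le> 1"
    have [measurable]: "\<phi> \<in> borel_measurable borel" by (rule borel_measurable_continuous_onI[OF \<phi>(1)])
    have lim: "(\<lambda>n. \<integral>z. \<phi> (fst z + (1 / real (Suc n)) *\<^sub>R snd z) \<partial>(R \<Otimes>\<^sub>M ?G)) \<longlonglongrightarrow> (\<integral>x. \<phi> x \<partial>R)"
      and nn: "ennreal (\<integral>z. \<phi> (fst z + (1 / real (Suc n)) *\<^sub>R snd z) \<partial>(R \<Otimes>\<^sub>M ?G))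
         = (\<integral>\<^sup>+x. \<integral>\<^sup>+z. ennreal (\<phi> (x + (1 / real (Suc n)) *\<^sub>R z)) \<partial>?G \<partial>R)"
      if R: "prob_space R" "sets R = sets borel" for R :: "'a measure" and n
    proof -
      interpret R: prob_space R by fact
      interpret RG: pair_prob_space R ?G ..
      note [measurable_cong] = R(2)
      have "(\<lambda>n. \<integral>z. \<phi> (fst z + (1 / real (Suc n)) *\<^sub>R snd z) \<partial>(R \<Otimes>\<^sub>M ?G)) \<longlonglongrightarrow> (\<integral>z. \<phi> (fst z) \<partial>(R \<Otimes>\<^sub>M ?G))"
      proof (rule integral_dominated_convergence[where w="\<lambda>_. 1"])
        show "AE z in R \<Otimes>\<^sub>M ?G. (\<lambda>n. \<phi> (fst z + (1 / real (Suc n)) *\<^sub>R snd z)) \<longlonglongrightarrow> \<phi> (fst z)"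
        proof (rule AE_I2)
          fix z :: "'a \<times> 'a"
          have "(\<lambda>n. fst z + (1 / real (Suc n)) *\<^sub>R snd z) \<longlonglongrightarrow> fst z + 0 *\<^sub>R snd z"
            by (intro tendsto_intros LIMSEQ_Suc[OF lim_1_over_n])
          then show "(\<lambda>n. \<phi> (fst z + (1 / real (Suc n)) *\<^sub>R snd z)) \<longlonglongrightarrow> \<phi> (fst z)"
            using \<phi>(1) by (intro isCont_tendsto_compose[of _ \<phi>]) (auto simp: continuous_on_eq_continuous_at)
        qed
      qed (use \<phi> in auto)
      also have "(\<integral>z. \<phi> (fst z) \<partial>(R \<Otimes>\<^sub>M ?G)) = (\<integral>x. \<phi> x \<partial>R)"
      proof -
        have "integrable (R \<Otimes>\<^sub>M ?G) (\<lambda>z. \<phi> (fst z))"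
          using \<phi> by (intro RG.integrable_const_bound[where B=1]) auto
        then have "(\<integral>x. \<integral>u. \<phi> (fst (x, u)) \<partial>?G \<partial>R) = (\<integral>z. \<phi> (fst z) \<partial>(R \<Otimes>\<^sub>M ?G))"
          by (rule RG.integral_fst')
        then show ?thesis by (simp add: G.prob_space[simplified])
      qed
      finally show "(\<lambda>n. \<integral>z. \<phi> (fst z + (1 / real (Suc n)) *\<^sub>R snd z) \<partial>(R \<Otimes>\<^sub>M ?G)) \<longlonglongrightarrow> (\<integral>x. \<phi> x \<partial>R)" .
      have "ennreal (\<integral>z. \<phi> (fst z + (1 / real (Suc n)) *\<^sub>R snd z) \<partial>(R \<Otimes>\<^sub>M ?G))
        = (\<integral>\<^sup>+z. ennreal (\<phi> (fst z + (1 / real (Suc n)) *\<^sub>R snd z)) \<partial>(R \<Otimes>\<^sub>M ?G))"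
        using \<phi> by (intro nn_integral_eq_integral[symmetric] RG.integrable_const_bound[where B=1]) auto
      also have "\<dots> = (\<integral>\<^sup>+x. \<integral>\<^sup>+z. ennreal (\<phi> (x + (1 / real (Suc n)) *\<^sub>R z)) \<partial>?G \<partial>R)"
        by (subst G.nn_integral_fst[symmetric]) auto
      finally show "ennreal (\<integral>z. \<phi> (fst z + (1 / real (Suc n)) *\<^sub>R snd z) \<partial>(R \<Otimes>\<^sub>M ?G))
         = (\<integral>\<^sup>+x. \<integral>\<^sup>+z. ennreal (\<phi> (x + (1 / real (Suc n)) *\<^sub>R z)) \<partial>?G \<partial>R)" .
    qed
    have "(\<integral>z. \<phi> (fst z + (1 / real (Suc n)) *\<^sub>R snd z) \<partial>(P \<Otimes>\<^sub>M ?G)) = (\<integral>z. \<phi> (fst z + (1 / real (Suc n)) *\<^sub>R snd z) \<partial>(Q \<Otimes>\<^sub>M ?G))" for n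
    proof -
      have "(\<integral>\<^sup>+x. \<integral>\<^sup>+z. ennreal (\<phi> (x + (1 / real (Suc n)) *\<^sub>R z)) \<partial>?G \<partial>P) = (\<integral>\<^sup>+x. \<integral>\<^sup>+z. ennreal (\<phi> (x + (1 / real (Suc n)) *\<^sub>R z)) \<partial>?G \<partial>Q)"
        by (subst (1 2) conv_nn) (auto simp: P Q dens)
      then show ?thesis
        unfolding nn[OF P, symmetric] nn[OF Q, symmetric]
        using \<phi>(2) by (subst (asm) ennreal_inj) (auto intro!: Bochner_Integration.integral_nonneg)
    qed
    then show "(\<integral>x. \<phi> x \<partial>P) = (\<integral>x. \<phi> x \<partial>Q)"
      using lim[OF P] lim[OF Q] LIMSEQ_unique by auto
  qed
qed

section \<open>Projections and moments of Gaussian laws\<close>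

lemma inner_mat_mult: "(u::real ^ 'n) \<bullet> (mat v *v u) = v * (norm u)\<^sup>2"
proof -
  have "mat v *v u = v *\<^sub>R u"
    by (simp add: vec_eq_iff matrix_vector_mult_def mat_def if_distrib[where f="\<lambda>x. x * _"] cong: if_cong)
  then show ?thesis by (simp add: power2_norm_eq_inner)
qed

lemma char_normal_measure:
  assumes "w \<ge> 0"
  shows "(\<integral>y. iexp y \<partial>normal_measure 0 w) = complex_of_real (exp (- w / 2))"
proof (cases "w = 0")
  case True
  then show ?thesis by (simp add: normal_measure_def integral_return)
next
  case False
  then have "(\<integral>y. iexp y \<partial>normal_measure 0 w) = (\<integral>y. normal_density 0 (sqrt w) y *\<^sub>R iexp (1 * y) \<partial>lborel)"
    unfolding normal_measure_def by (subst if_not_P, simp, subst integral_density) auto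
  also have "\<dots> = complex_of_real (exp (- w / 2))"
    using False assms by (subst integral_normal_iexp(2)) auto
  finally show ?thesis .
qed

text \<open>The Cramer-Wold device: each projection on u is normal with variance v |u|^2, which
  fixes the characteristic function at u; uniqueness then supplies the density.\<close>

lemma is_gaussian_mat_eq_gauss:
  fixes P :: "(real ^ 'n::finite) measure"
  assumes P: "is_gaussian 0 (mat v) P" and v: "v > 0"
  shows "P = gauss (sqrt v)"
proof (rule Levy_uniqueness_euclidean)
  have ps: "prob_space P" and sets: "sets P = sets borel"
    and law: "\<And>u. distr P borel (\<lambda>x. u \<bullet> x) = normal_measure 0 (u \<bullet> (mat v *v u))"
    using P by (auto simp: is_gaussian_def)
  note [measurable_cong] = sets
  fix u :: "real ^ 'n"
  have "(\<integral>x. iexp (u \<bullet> x) \<partial>P) = (\<integral>y. iexp y \<partial>distr P borel (\<lambda>x. u \<bullet> x))"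
    by (subst integral_distr) auto
  also have "\<dots> = complex_of_real (exp (- (v * (norm u)\<^sup>2) / 2))"
    unfolding law inner_mat_mult using v by (intro char_normal_measure) auto
  also have "\<dots> = (\<integral>x. iexp (u \<bullet> x) \<partial>gauss (sqrt v))"
    using v by (subst char_gauss) auto
  finally show "(\<integral>x. iexp (u \<bullet> x) \<partial>P) = (\<integral>x. iexp (u \<bullet> x) \<partial>gauss (sqrt v))" .
qed (use assms in \<open>auto simp: is_gaussian_def prob_space_gauss\<close>)

text \<open>The quotient of factorials is the double factorial (2k - 1)!!. Variance 0 is covered as
  the Dirac case; at k = 0 both sides are then 1.\<close>

lemma normal_measure_moment:
  assumes "w \<ge> 0"
  shows "(\<integral>\<^sup>+y. ennreal ((y - m) ^ (2 * k)) \<partial>normal_measure m w) = ennreal (w ^ k * (fact (2 * k) / (2 ^ k * fact k)))"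
proof (cases "w = 0")
  case True
  then show ?thesis by (cases k) (auto simp: normal_measure_def nn_integral_return)
next
  case False
  then have w: "sqrt w > 0" using assms by simp
  have "(\<integral>\<^sup>+y. ennreal ((y - m) ^ (2 * k)) \<partial>normal_measure m w)
      = (\<integral>\<^sup>+y. ennreal (normal_density m (sqrt w) y * (y - m) ^ (2 * k)) \<partial>lborel)"
    using False unfolding normal_measure_def by (simp add: nn_integral_density ennreal_mult')
  also have "\<dots> = ennreal (fact (2 * k) / ((2 / (sqrt w)\<^sup>2)^k * fact k))"
    using normal_moment_even[OF w, of m k] by (intro nn_integral_eq_integral[THEN trans])
      (auto simp: has_bochner_integral_iff)
  also have "fact (2 * k) / ((2 / (sqrt w)\<^sup>2)^k * fact k) = w ^ k * (fact (2 * k) / (2 ^ k * fact k))"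
    using assms False by (simp add: power_divide)
  finally show ?thesis .
qed

lemma norm_power_le_sum_components:
  fixes y :: "real ^ 'n::finite"
  shows "norm y ^ (2 * k) \<le> real CARD('n) ^ k * (\<Sum>i\<in>UNIV. (y $ i) ^ (2 * k))"
proof -
  obtain j where j: "\<And>i. (y $ i)\<^sup>2 \<le> (y $ j)\<^sup>2"
    using Max_in[of "range (\<lambda>i. (y $ i)\<^sup>2)"] Max_ge[of "range (\<lambda>i. (y $ i)\<^sup>2)"] by fastforce
  have "(norm y)\<^sup>2 = (\<Sum>i\<in>UNIV. (y $ i)\<^sup>2)"
    by (subst power2_norm_eq_inner) (simp add: inner_vec_def power2_eq_square)
  also have "\<dots> \<le> (\<Sum>i\<in>(UNIV::'n set). (y $ j)\<^sup>2)" by (intro sum_mono j)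
  finally have "((norm y)\<^sup>2) ^ k \<le> (real CARD('n) * (y $ j)\<^sup>2) ^ k" by (intro power_mono) auto
  also have "\<dots> = real CARD('n) ^ k * (y $ j) ^ (2 * k)" by (simp add: power_mult_distrib power_mult)
  also have "(y $ j) ^ (2 * k) \<le> (\<Sum>i\<in>UNIV. (y $ i) ^ (2 * k))"
    by (rule member_le_sum) (auto simp: zero_le_even_power)
  finally show ?thesis by (simp add: power_mult)
qed

text \<open>Only the variances of the coordinates enter, so correlations are harmless. In the power
  k + 1 of the dimension, k comes from comparing the Euclidean norm with the largest coordinate and
  1 from the sum over the coordinates.\<close>

lemma gaussian_norm_moment:
  fixes P :: "(real ^ 'n::finite) measure"
  assumes P: "is_gaussian a C P" and C: "\<And>i. 0 \<le> C $ i $ i" "\<And>i. C $ i $ i \<le> w"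
  shows "(\<integral>\<^sup>+x. ennreal (norm (x - a) ^ (2 * k)) \<partial>P)
     \<le> ennreal (real CARD('n) ^ Suc k * (fact (2 * k) / (2 ^ k * fact k)) * w ^ k)"
proof -
  define c :: real where "c = fact (2 * k) / (2 ^ k * fact k)"
  have c: "c \<ge> 0" by (simp add: c_def)
  have sets: "sets P = sets borel"
    and law: "\<And>u. distr P borel (\<lambda>x. u \<bullet> x) = normal_measure (u \<bullet> a) (u \<bullet> (C *v u))"
    using P by (auto simp: is_gaussian_def)
  note [measurable_cong] = sets
  have one: "(\<integral>\<^sup>+x. ennreal ((x $ i - a $ i) ^ (2 * k)) \<partial>P) \<le> ennreal (w ^ k * c)" for i
  proof -
    have ax: "axis i 1 \<bullet> x = x $ i" for x :: "real ^ 'n" by (simp add: inner_axis')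
    have var: "axis i 1 \<bullet> (C *v axis i 1) = C $ i $ i"
      by (simp only: ax) (simp add: matrix_vector_mult_def axis_def if_distrib cong: if_cong)
    have "(\<integral>\<^sup>+x. ennreal ((x $ i - a $ i) ^ (2 * k)) \<partial>P)
        = (\<integral>\<^sup>+y. ennreal ((y - a $ i) ^ (2 * k)) \<partial>distr P borel (\<lambda>x. axis i 1 \<bullet> x))"
      by (subst nn_integral_distr) (auto simp: ax)
    also have "\<dots> = ennreal ((C $ i $ i) ^ k * c)"
      unfolding law var c_def unfolding ax using C by (intro normal_measure_moment) auto
    also have "\<dots> \<le> ennreal (w ^ k * c)" using C c by (intro ennreal_leI mult_right_mono power_mono) auto
    finally show ?thesis .
  qed
  have w: "w \<ge> 0" using C order_trans by blast
  have "(\<integral>\<^sup>+x. ennreal (norm (x - a) ^ (2 * k)) \<partial>P)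
     \<le> (\<integral>\<^sup>+x. ennreal (real CARD('n) ^ k) * (\<Sum>i\<in>UNIV. ennreal ((x $ i - a $ i) ^ (2 * k))) \<partial>P)"
    by (intro nn_integral_mono)
      (use norm_power_le_sum_components in \<open>auto simp: zero_le_even_power simp flip: ennreal_mult' intro!: ennreal_leI order_trans[OF norm_power_le_sum_components]\<close>)
  also have "\<dots> = ennreal (real CARD('n) ^ k) * (\<Sum>i\<in>UNIV. \<integral>\<^sup>+x. ennreal ((x $ i - a $ i) ^ (2 * k)) \<partial>P)"
    by (subst nn_integral_cmult, measurable, subst nn_integral_sum, measurable)
  also have "\<dots> \<le> ennreal (real CARD('n) ^ k) * (\<Sum>i\<in>(UNIV::'n set). ennreal (w ^ k * c))"
    by (intro mult_left_mono sum_mono one) auto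
  also have "\<dots> = ennreal (real CARD('n) ^ Suc k * c * w ^ k)"
    using w c by (simp add: ennreal_of_nat_eq_real_of_nat algebra_simps flip: ennreal_mult')
  finally show ?thesis by (simp add: c_def)
qed

section \<open>Entropy cost of shifting Gaussian noise\<close>

text \<open>Cameron-Martin combined with Jensen. For X = F(z + a) - (a . z)/v - |a|^2/(2v),
  translation invariance of Lebesgue measure gives E[exp X] = E[exp F], while E[X] is the left side
  minus |a|^2/(2v), because the linear term has mean 0.\<close>

lemma gauss_shift_entropy:
  fixes P :: "(real ^ 'n::finite) measure"
  assumes P: "is_gaussian 0 (mat v) P" and v: "v > 0"
    and F[measurable]: "F \<in> borel_measurable borel" and Fb: "\<And>z. \<bar>F z\<bar> \<le> b"
  shows "(\<integral>z. F (z + a) \<partial>P) \<le> (norm a)\<^sup>2 / (2 * v) + ln (\<integral>z. exp (F z) \<partial>P)"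
proof -
  have ps: "prob_space P" and sets[measurable_cong]: "sets P = sets borel"
    and law: "\<And>u. distr P borel (\<lambda>x. u \<bullet> x) = normal_measure 0 (u \<bullet> (mat v *v u))"
    using P by (auto simp: is_gaussian_def)
  interpret P: prob_space P by fact
  have PG: "P = gauss (sqrt v)" by (rule is_gaussian_mat_eq_gauss[OF P v])
  have mean: "integrable P (\<lambda>z. a \<bullet> z) \<and> (\<integral>z. a \<bullet> z \<partial>P) = 0"
  proof (cases "a = 0")
    case False
    define s where "s = sqrt (v * (norm a)\<^sup>2)"
    have s: "s > 0" using False v by (simp add: s_def)
    have law': "distr P borel (\<lambda>x. a \<bullet> x) = density lborel (\<lambda>x. ennreal (normal_density 0 s x))"
      unfolding law inner_mat_mult normal_measure_def s_def using False v by simp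
    have "integrable (distr P borel (\<lambda>x. a \<bullet> x)) (\<lambda>y. y) \<and> (\<integral>y. y \<partial>distr P borel (\<lambda>x. a \<bullet> x)) = 0"
      unfolding law' using integrable_normal_moment[OF s, of 0 1] integral_normal_moment_odd[OF s, of 0 0]
      by (subst integrable_density, simp, simp, simp, subst integral_density) auto
    then show ?thesis by (auto simp: integrable_distr_eq integral_distr)
  qed simp
  define X where "X z = F (z + a) - (a \<bullet> z) / v - (norm a)\<^sup>2 / (2 * v)" for z
  have [measurable]: "X \<in> borel_measurable borel" unfolding X_def by measurable
  have iF: "integrable P (\<lambda>z. F (z + a))" by (rule P.integrable_bounded[OF _ Fb]) measurable
  have iX: "integrable P X" unfolding X_def using iF mean by auto
  define m where "m = (\<integral>z. X z \<partial>P)"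
  have m: "m = (\<integral>z. F (z + a) \<partial>P) - (norm a)\<^sup>2 / (2 * v)"
    unfolding m_def X_def using iF mean by (simp add: P.prob_space)
  have dens: "exp (F (a + z)) * gauss_density (sqrt v) (a + z) = gauss_density (sqrt v) z * exp (X z)" for z
  proof -
    have "- (norm (a + z))\<^sup>2 / (2 * v) = - (norm z)\<^sup>2 / (2 * v) - (a \<bullet> z) / v - (norm a)\<^sup>2 / (2 * v)"
      using v by (simp add: power2_norm_eq_inner inner_add_left inner_add_right inner_commute[of z a] field_simps)
    then have e: "exp (- (norm (a + z))\<^sup>2 / (2 * v)) = exp (- (norm z)\<^sup>2 / (2 * v)) * exp (- (a \<bullet> z) / v - (norm a)\<^sup>2 / (2 * v))"
      by (simp flip: exp_add)
    have "exp (X z) = exp (F (a + z)) * exp (- (a \<bullet> z) / v - (norm a)\<^sup>2 / (2 * v))"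
      by (simp add: X_def add.commute flip: exp_add)
    then show ?thesis unfolding gauss_density_eq using v e by (simp add: mult_ac)
  qed
  have iE: "integrable P (\<lambda>z. exp (F z))" by (rule P.integrable_exp_bounded[OF _ Fb]) measurable
  have shift: "integrable lborel (\<lambda>z. gauss_density (sqrt v) z * exp (X z)) \<and>
      (\<integral>z. gauss_density (sqrt v) z * exp (X z) \<partial>lborel) = (\<integral>z. exp (F z) \<partial>P)"
  proof -
    have i: "integrable lborel (\<lambda>z. exp (F z) * gauss_density (sqrt v) z)"
      using iE unfolding PG gauss_def
      by (subst (asm) integrable_density) (auto simp: gauss_density_nonneg mult.commute)
    then have "integrable (distr lborel borel ((+) a)) (\<lambda>z. exp (F z) * gauss_density (sqrt v) z)"
      by (simp only: lborel_distr_plus)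
    then have 1: "integrable lborel (\<lambda>z. exp (F (a + z)) * gauss_density (sqrt v) (a + z))"
      by (subst (asm) integrable_distr_eq) auto
    have "(\<integral>z. exp (F z) \<partial>P) = (\<integral>z. exp (F z) * gauss_density (sqrt v) z \<partial>lborel)"
      unfolding PG gauss_def by (subst integral_density) (auto simp: gauss_density_nonneg mult.commute)
    also have "\<dots> = (\<integral>z. exp (F z) * gauss_density (sqrt v) z \<partial>distr lborel borel ((+) a))"
      by (simp only: lborel_distr_plus)
    also have "\<dots> = (\<integral>z. exp (F (a + z)) * gauss_density (sqrt v) (a + z) \<partial>lborel)"
      by (subst integral_distr) auto
    finally show ?thesis using 1 by (simp only: dens)
  qed
  have iEX: "integrable P (\<lambda>z. exp (X z))" and intEX: "(\<integral>z. exp (X z) \<partial>P) = (\<integral>z. exp (F z) \<partial>P)"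
    using shift unfolding PG gauss_def
    by (subst integrable_density integral_density; auto simp: gauss_density_nonneg)+
  \<comment> \<open>Jensen's inequality, obtained by integrating the tangent of exp at the mean
    m.\<close>
  have "exp m = (\<integral>z. exp m * (1 + (X z - m)) \<partial>P)"
    using iX by (simp add: P.prob_space m_def)
  also have "\<dots> \<le> (\<integral>z. exp (X z) \<partial>P)"
  proof (rule integral_mono)
    fix z
    have "exp m * (1 + (X z - m)) \<le> exp m * exp (X z - m)" by (intro mult_left_mono) auto
    then show "exp m * (1 + (X z - m)) \<le> exp (X z)" by (simp flip: exp_add)
  qed (use iX iEX in auto)
  finally have "exp m \<le> (\<integral>z. exp (F z) \<partial>P)" unfolding intEX .
  then have "m \<le> ln (\<integral>z. exp (F z) \<partial>P)"
    by (subst ln_ge_iff) (use P.integral_exp_bounded_pos[OF _ Fb] in auto)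
  then show ?thesis unfolding m by linarith
qed

text \<open>The chain rule of relative entropy in dual form. Given the earlier coordinates, the last
  shift is a constant, so the one-step inequality applies to it; the function of the earlier
  coordinates that remains is left to the induction hypothesis. \<open>a_dep\<close> makes the
  shifts predictable and the map triangular.\<close>

lemma triangular_shift_entropy:
  fixes P :: "(real ^ 'n::finite) measure" and a :: "nat \<Rightarrow> (nat \<Rightarrow> real ^ 'n) \<Rightarrow> real ^ 'n"
  assumes P: "is_gaussian 0 (mat v) P" and v: "v > 0"
    and a_meas: "\<And>j. a j \<in> borel_measurable (PiM {..<j} (\<lambda>_. borel))"
    and a_dep: "\<And>j z z'. (\<And>i. i < j \<Longrightarrow> z i = z' i) \<Longrightarrow> a j z = a j z'"
    and "F \<in> borel_measurable (PiM {..<n} (\<lambda>_. borel))" and "\<And>z. \<bar>F z\<bar> \<le> b"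
    and "(\<integral>\<^sup>+z. (\<Sum>j<n. ennreal ((norm (a j z))\<^sup>2 / (2 * v))) \<partial>PiM {..<n} (\<lambda>_. P)) \<le> ennreal c" and "c \<ge> 0"
  shows "(\<integral>z. F (\<lambda>j\<in>{..<n}. z j + a j z) \<partial>PiM {..<n} (\<lambda>_. P))
     \<le> c + ln (\<integral>z. exp (F z) \<partial>PiM {..<n} (\<lambda>_. P))"
  using assms(5-)
proof (induction n arbitrary: F c)
  case 0
  interpret E: prob_space "PiM {} (\<lambda>_::nat. P)" by (rule prob_space_PiM) (use P in \<open>auto simp: is_gaussian_def\<close>)
  have "(\<integral>z. F (\<lambda>j\<in>{..<0::nat}. z j + a j z) \<partial>PiM {} (\<lambda>_. P)) = F (\<lambda>_. undefined)"
    by (simp add: restrict_def E.prob_space)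
  moreover have "(\<integral>z. exp (F z) \<partial>PiM {} (\<lambda>_. P)) = (\<integral>z. exp (F (\<lambda>_. undefined)) \<partial>PiM {} (\<lambda>_::nat. P))"
    by (intro Bochner_Integration.integral_cong) (auto simp: space_PiM)
  ultimately show ?case using 0 by (simp add: E.prob_space)
next
  case (Suc n)
  have ps: "prob_space P" and sets[measurable_cong]: "sets P = sets borel"
    using P by (auto simp: is_gaussian_def)
  interpret P: prob_space P by fact
  interpret PP: product_sigma_finite "\<lambda>_::nat. P" ..
  define G where "G k = PiM {..<k} (\<lambda>_::nat. P)" for k
  interpret G: prob_space "G n" unfolding G_def by (rule prob_space_PiM) (rule ps)
  interpret GS: prob_space "G (Suc n)" unfolding G_def by (rule prob_space_PiM) (rule ps)
  interpret GP: pair_sigma_finite "G n" P ..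
  have setsG[measurable_cong]: "sets (G k) = sets (PiM {..<k} (\<lambda>_. borel))" for k
    unfolding G_def by (intro sets_PiM_cong) (auto simp: sets)
  have ins: "{..<Suc n} = insert n {..<n}" by auto
  have F[measurable]: "F \<in> borel_measurable (PiM {..<Suc n} (\<lambda>_. borel))" by fact
  have Fb: "\<bar>F z\<bar> \<le> b" for z by fact
  \<comment> \<open>\<open>a j\<close> reads only coordinates below j, so it factors through a
    restriction and is measurable on every longer product as well.\<close>
  have am: "a j \<in> borel_measurable (G k)" if "j \<le> k" for j k
  proof -
    have "(\<lambda>z. a j (restrict z {..<j})) \<in> borel_measurable (PiM {..<k} (\<lambda>_. borel))"
      using that by (intro measurable_compose[OF measurable_restrict_subset a_meas]) auto
    moreover have "(\<lambda>z. a j (restrict z {..<j})) = a j" by (intro ext a_dep) auto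
    ultimately show ?thesis by (simp add: measurable_cong_sets[OF setsG refl])
  qed
  have upd[measurable]: "(\<lambda>(z, y). z(n := y)) \<in> measurable (G n \<Otimes>\<^sub>M P) (PiM {..<Suc n} (\<lambda>_. borel))"
  proof -
    have "(\<lambda>(z, y). z(n := y)) \<in> measurable (PiM {..<n} (\<lambda>_. borel) \<Otimes>\<^sub>M borel) (PiM {..<Suc n} (\<lambda>_. borel :: (real ^ 'n) measure))"
      unfolding ins by (rule measurable_add_dim)
    then show ?thesis
      by (subst measurable_cong_sets[OF sets_pair_measure_cong[OF setsG sets] refl])
  qed
  have Fu[measurable]: "(\<lambda>p. F ((fst p)(n := snd p))) \<in> borel_measurable (G n \<Otimes>\<^sub>M P)"
    using measurable_compose[OF upd F] by (simp add: case_prod_unfold)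
  \<comment> \<open>The logarithm of the exponential moment over the last coordinate. As exp H
    integrates to the full exponential moment, the induction hypothesis for H produces the
    right-hand side.\<close>
  define H where "H w = ln (\<integral>y. exp (F (w(n := y))) \<partial>P)" for w
  have Hm: "H \<in> borel_measurable (G n)"
    unfolding H_def by (intro borel_measurable_ln P.borel_measurable_lebesgue_integral)
     (use Fu in \<open>auto simp: case_prod_unfold\<close>)
  then have Hm': "H \<in> borel_measurable (PiM {..<n} (\<lambda>_. borel))"
    by (simp add: measurable_cong_sets[OF setsG refl])
  have slice[measurable]: "(\<lambda>y. F (w(n := y))) \<in> borel_measurable borel" if "w \<in> space (G n)" for w
    using measurable_compose[OF measurable_Pair1'[OF that, of P] Fu] by (simp add: measurable_cong_sets[OF sets refl])
  have slice': "(\<lambda>y. F (w(n := y))) \<in> borel_measurable P" if "w \<in> space (G n)" for w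
    using slice[OF that] by (simp add: measurable_cong_sets[OF sets refl])
  have "\<bar>H w\<bar> \<le> b" if "w \<in> space (G n)" for w
    unfolding H_def by (rule P.abs_ln_integral_exp_le[OF slice'[OF that] Fb])
  \<comment> \<open>The induction hypothesis asks for a bound at every point, whereas the slices are
    known to be measurable only over points of the product space; hence the value 0
    elsewhere.\<close>
  define H' where "H' w = (if w \<in> space (G n) then H w else 0)" for w
  have b0: "b \<ge> 0" using Fb[of undefined] by linarith
  have H'b: "\<bar>H' w\<bar> \<le> b" for w
    using \<open>\<And>w. w \<in> space (G n) \<Longrightarrow> \<bar>H w\<bar> \<le> b\<close> b0 by (auto simp: H'_def)
  have spG: "space (G n) = space (PiM {..<n} (\<lambda>_. borel))" by (rule sets_eq_imp_space_eq[OF setsG])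
  have H'm: "H' \<in> borel_measurable (PiM {..<n} (\<lambda>_. borel))"
    using Hm' by (subst measurable_cong[where g=H]) (auto simp: H'_def spG)
  define \<tau> where "\<tau> k z = (\<lambda>j\<in>{..<k}. z j + a j z)" for k z
  have \<tau>m: "\<tau> k \<in> measurable (G k) (PiM {..<k} (\<lambda>_. borel))" for k
    unfolding \<tau>_def
  proof (intro measurable_restrict borel_measurable_add)
    fix j assume j: "j \<in> {..<k}"
    show "a j \<in> borel_measurable (G k)" using j by (intro am) auto
    have "(\<lambda>z. z j) \<in> borel_measurable (PiM {..<k} (\<lambda>_. borel :: (real ^ 'n) measure))"
      using j by (rule measurable_component_singleton)
    then show "(\<lambda>z. z j) \<in> borel_measurable (G k)" by (simp add: measurable_cong_sets[OF setsG refl])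
  qed
  have \<tau>sp: "\<tau> n z \<in> space (G n)" if "z \<in> space (G n)" for z
    using measurable_space[OF \<tau>m that] spG by simp
  \<comment> \<open>By predictability, changing coordinate n alters none of the shifts
    \<open>a j\<close> with j \<le> n; the new coordinate is moved by \<open>a n z\<close>, which
    depends on the old ones only.\<close>
  have \<tau>upd: "\<tau> (Suc n) (z(n := y)) = (\<tau> n z)(n := y + a n z)" for z y
  proof
    fix j
    have "a j (z(n := y)) = a j z" if "j \<le> n" using that by (intro a_dep) auto
    then show "\<tau> (Suc n) (z(n := y)) j = ((\<tau> n z)(n := y + a n z)) j"
      by (auto simp: \<tau>_def restrict_def)
  qed
  define q where "q z = (norm (a n z))\<^sup>2 / (2 * v)" for z
  have q0: "q z \<ge> 0" for z using v by (simp add: q_def)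
  have qm[measurable]: "q \<in> borel_measurable (G n)"
    using am[OF order_refl] unfolding q_def by measurable
  have nm: "(\<lambda>z. ennreal ((norm (a j z))\<^sup>2 / (2 * v))) \<in> borel_measurable (G k)" if "j \<le> k" for j k
  proof -
    note am[OF that, measurable]
    show ?thesis by measurable
  qed
  have costm: "(\<lambda>z. \<Sum>j<n. ennreal ((norm (a j z))\<^sup>2 / (2 * v))) \<in> borel_measurable (G n)"
    by (intro borel_measurable_sum nm) auto
  have costm': "(\<lambda>z. \<Sum>j<Suc n. ennreal ((norm (a j z))\<^sup>2 / (2 * v))) \<in> borel_measurable (G (Suc n))"
    by (intro borel_measurable_sum nm) auto
  have "(\<integral>\<^sup>+z. (\<Sum>j<Suc n. ennreal ((norm (a j z))\<^sup>2 / (2 * v))) \<partial>G (Suc n))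
      = (\<integral>\<^sup>+z. \<integral>\<^sup>+y. (\<Sum>j<Suc n. ennreal ((norm (a j (z(n := y))))\<^sup>2 / (2 * v))) \<partial>P \<partial>G n)"
    using costm' unfolding G_def ins by (subst PP.product_nn_integral_insert) auto
  also have "\<dots> = (\<integral>\<^sup>+z. \<integral>\<^sup>+y. (\<Sum>j<n. ennreal ((norm (a j z))\<^sup>2 / (2 * v))) + ennreal (q z) \<partial>P \<partial>G n)"
  proof (intro nn_integral_cong)
    fix z y
    have "a j (z(n := y)) = a j z" if "j \<le> n" for j using that by (intro a_dep) auto
    then show "(\<Sum>j<Suc n. ennreal ((norm (a j (z(n := y))))\<^sup>2 / (2 * v)))
        = (\<Sum>j<n. ennreal ((norm (a j z))\<^sup>2 / (2 * v))) + ennreal (q z)" by (simp add: q_def)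
  qed
  also have "\<dots> = (\<integral>\<^sup>+z. (\<Sum>j<n. ennreal ((norm (a j z))\<^sup>2 / (2 * v))) + ennreal (q z) \<partial>G n)"
    by (simp add: P.emeasure_space_1)
  also have "\<dots> = (\<integral>\<^sup>+z. (\<Sum>j<n. ennreal ((norm (a j z))\<^sup>2 / (2 * v))) \<partial>G n) + (\<integral>\<^sup>+z. ennreal (q z) \<partial>G n)"
    by (rule nn_integral_add) (use costm in auto)
  finally have cost: "(\<integral>\<^sup>+z. (\<Sum>j<n. ennreal ((norm (a j z))\<^sup>2 / (2 * v))) \<partial>G n) + (\<integral>\<^sup>+z. ennreal (q z) \<partial>G n) \<le> ennreal c"
    using Suc.prems(3) by (simp add: G_def)
  \<comment> \<open>The budget c splits into c1 for the earlier shifts and c2 for the last one; both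
    are finite because their sum is.\<close>
  define c1 where "c1 = enn2real (\<integral>\<^sup>+z. (\<Sum>j<n. ennreal ((norm (a j z))\<^sup>2 / (2 * v))) \<partial>G n)"
  define c2 where "c2 = enn2real (\<integral>\<^sup>+z. ennreal (q z) \<partial>G n)"
  have fin: "(\<integral>\<^sup>+z. (\<Sum>j<n. ennreal ((norm (a j z))\<^sup>2 / (2 * v))) \<partial>G n) < \<infinity>" "(\<integral>\<^sup>+z. ennreal (q z) \<partial>G n) < \<infinity>"
    using order.strict_trans1[OF cost ennreal_less_top] by (auto simp: ennreal_add_less_top)
  then have e1: "(\<integral>\<^sup>+z. (\<Sum>j<n. ennreal ((norm (a j z))\<^sup>2 / (2 * v))) \<partial>G n) = ennreal c1"
    and e2: "(\<integral>\<^sup>+z. ennreal (q z) \<partial>G n) = ennreal c2"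
    unfolding c1_def c2_def by (auto simp: ennreal_enn2real_if less_top)
  have c12: "c1 + c2 \<le> c" "c1 \<ge> 0" "c2 \<ge> 0"
  proof -
    show "c1 \<ge> 0" "c2 \<ge> 0" by (auto simp: c1_def c2_def)
    then show "c1 + c2 \<le> c"
      using cost Suc.prems(4) unfolding e1 e2 by (simp flip: ennreal_plus add: ennreal_le_iff)
  qed
  have iq: "integrable (G n) q" using fin(2) q0 by (intro integrableI_nonneg) auto
  have Iq: "(\<integral>z. q z \<partial>G n) = c2"
    unfolding c2_def using q0 by (intro integral_eq_nn_integral) auto
  have IH: "(\<integral>z. H' (\<tau> n z) \<partial>G n) \<le> c1 + ln (\<integral>z. exp (H' z) \<partial>G n)"
    unfolding G_def \<tau>_def
    by (rule Suc.IH[OF H'm H'b]) (use e1 c12 in \<open>auto simp: G_def\<close>)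
  have iF: "integrable (G (Suc n)) (\<lambda>z. F (\<tau> (Suc n) z))"
    by (rule GS.integrable_bounded[OF _ Fb]) (rule measurable_compose[OF \<tau>m F])
  have Ftau_m: "(\<lambda>p. F (\<tau> (Suc n) ((fst p)(n := snd p)))) \<in> borel_measurable (G n \<Otimes>\<^sub>M P)"
    using measurable_compose[OF upd measurable_compose[OF \<tau>m[unfolded measurable_cong_sets[OF setsG refl]] F]]
    by (simp add: case_prod_unfold)
  have "(\<integral>z. F (\<tau> (Suc n) z) \<partial>G (Suc n)) = (\<integral>z. \<integral>y. F (\<tau> (Suc n) (z(n := y))) \<partial>P \<partial>G n)"
    using iF unfolding G_def ins by (subst PP.product_integral_insert) auto
  also have "\<dots> \<le> (\<integral>z. q z + H' (\<tau> n z) \<partial>G n)"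
  proof (rule integral_mono)
    show "integrable (G n) (\<lambda>z. \<integral>y. F (\<tau> (Suc n) (z(n := y))) \<partial>P)"
    proof (rule G.integrable_const_bound[where B=b])
      show "(\<lambda>z. \<integral>y. F (\<tau> (Suc n) (z(n := y))) \<partial>P) \<in> borel_measurable (G n)"
        by (intro P.borel_measurable_lebesgue_integral) (use Ftau_m in \<open>simp add: case_prod_unfold\<close>)
      show "AE z in G n. norm (\<integral>y. F (\<tau> (Suc n) (z(n := y))) \<partial>P) \<le> b"
      proof (rule AE_I2)
        fix z assume z: "z \<in> space (G n)"
        have "(\<lambda>y. F (\<tau> (Suc n) (z(n := y)))) \<in> borel_measurable P"
          using measurable_compose[OF measurable_Pair1'[OF z, of P] Ftau_m] by simp
        then have "integrable P (\<lambda>y. F (\<tau> (Suc n) (z(n := y))))" by (rule P.integrable_bounded[OF _ Fb])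
        then have "(\<integral>y. norm (F (\<tau> (Suc n) (z(n := y)))) \<partial>P) \<le> (\<integral>y. b \<partial>P)"
          using Fb by (intro integral_mono) auto
        then have "(\<integral>y. norm (F (\<tau> (Suc n) (z(n := y)))) \<partial>P) \<le> b" by (simp add: P.prob_space)
        then show "norm (\<integral>y. F (\<tau> (Suc n) (z(n := y))) \<partial>P) \<le> b"
          by (rule order_trans[OF integral_norm_bound])
      qed
    qed
    show "integrable (G n) (\<lambda>z. q z + H' (\<tau> n z))"
      by (intro Bochner_Integration.integrable_add iq G.integrable_bounded[OF _ H'b] measurable_compose[OF \<tau>m H'm])
    fix z assume z: "z \<in> space (G n)"
    have "(\<integral>y. F (\<tau> (Suc n) (z(n := y))) \<partial>P) = (\<integral>y. F ((\<tau> n z)(n := y + a n z)) \<partial>P)"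
      unfolding \<tau>upd ..
    also have "\<dots> \<le> (norm (a n z))\<^sup>2 / (2 * v) + ln (\<integral>y. exp (F ((\<tau> n z)(n := y))) \<partial>P)"
      by (rule gauss_shift_entropy[OF P v slice[OF \<tau>sp[OF z]] Fb])
    also have "\<dots> = q z + H' (\<tau> n z)" using \<tau>sp[OF z] by (simp add: q_def H'_def H_def)
    finally show "(\<integral>y. F (\<tau> (Suc n) (z(n := y))) \<partial>P) \<le> q z + H' (\<tau> n z)" .
  qed
  also have "\<dots> = c2 + (\<integral>z. H' (\<tau> n z) \<partial>G n)"
    using iq Iq by (subst Bochner_Integration.integral_add)
      (auto intro!: G.integrable_bounded[OF _ H'b] measurable_compose[OF \<tau>m H'm])
  also have "\<dots> \<le> c + ln (\<integral>z. exp (H' z) \<partial>G n)" using IH c12 by linarith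
  also have "(\<integral>z. exp (H' z) \<partial>G n) = (\<integral>z. \<integral>y. exp (F (z(n := y))) \<partial>P \<partial>G n)"
  proof (intro Bochner_Integration.integral_cong refl)
    fix z assume z: "z \<in> space (G n)"
    then show "exp (H' z) = (\<integral>y. exp (F (z(n := y))) \<partial>P)"
      using P.integral_exp_bounded_pos[OF slice'[OF z] Fb] by (simp add: H'_def H_def)
  qed
  also have "\<dots> = (\<integral>z. exp (F z) \<partial>G (Suc n))"
  proof -
    have "integrable (G (Suc n)) (\<lambda>z. exp (F z))"
      by (rule GS.integrable_exp_bounded[OF _ Fb]) (simp add: measurable_cong_sets[OF setsG refl] F)
    then show ?thesis unfolding G_def ins by (subst PP.product_integral_insert) auto
  qed
  finally show ?case unfolding G_def \<tau>_def .
qed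

section \<open>Euler schemes\<close>

text \<open>\<open>\<xi>\<close> is an arbitrary sequence, so that one recursion serves random
  increments, shifted increments and zero noise, and convergence can be studied path by
  path.\<close>

primrec euler :: "real \<Rightarrow> (real \<Rightarrow> 'a \<Rightarrow> 'a::real_vector) \<Rightarrow> 'a \<Rightarrow> (nat \<Rightarrow> 'a) \<Rightarrow> nat \<Rightarrow> 'a" where
  "euler \<Delta> g x \<xi> 0 = x"
| "euler \<Delta> g x \<xi> (Suc j) = euler \<Delta> g x \<xi> j + \<Delta> *\<^sub>R g (real j * \<Delta>) (euler \<Delta> g x \<xi> j) + \<xi> j"

lemma euler_cong:
  assumes "\<And>i. i < j \<Longrightarrow> \<xi> i = \<xi>' i"
  shows "euler \<Delta> g x \<xi> j = euler \<Delta> g x \<xi>' j"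
  using assms by (induction j) auto

text \<open>A discrete Girsanov transformation: the difference of the drifts is absorbed into the
  noise. The correction at step i is evaluated along the scheme with drift b, which up to that step
  depends only on the noise before i.\<close>

lemma euler_change_drift:
  "euler \<Delta> b x \<xi> j = euler \<Delta> g x (\<lambda>i. \<xi> i +
     \<Delta> *\<^sub>R (b (real i * \<Delta>) (euler \<Delta> b x \<xi> i) - g (real i * \<Delta>) (euler \<Delta> b x \<xi> i))) j"
  by (induction j) (simp_all add: algebra_simps)

text \<open>No global Lipschitz bound is needed: the bound on the error keeps the scheme within
  distance 1 of the path, where the local Lipschitz bound applies.\<close>

lemma euler_converges:
  fixes y w :: "real \<Rightarrow> 'a::euclidean_space"
  assumes T: "T > 0" and L: "L \<ge> 0"
    and sol: "\<And>t. t \<in> {0..T} \<Longrightarrow> y t = y 0 + integral {0..t} (\<lambda>s. g s (y s)) + w t"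
    and cont: "continuous_on {0..T} (\<lambda>s. g s (y s))"
    and lip: "\<And>t x. t \<in> {0..T} \<Longrightarrow> norm (x - y t) \<le> 1 \<Longrightarrow> norm (g t x - g t (y t)) \<le> L * norm (x - y t)"
    and e: "e > 0"
  shows "\<exists>N. \<forall>n\<ge>N. \<forall>j\<le>n. norm (euler (T / real n) g (y 0)
     (\<lambda>j. w (real (Suc j) * (T / real n)) - w (real j * (T / real n))) j - y (real j * (T / real n))) \<le> e"
proof -
  define G where "G s = g s (y s)" for s
  define e' where "e' = min e 1"
  have e': "e' > 0" "e' \<le> 1" "e' \<le> e" using e by (auto simp: e'_def)
  \<comment> \<open>Chosen so that the final Gronwall bound \<eta> T exp(L T) equals e'. As e' \<le>
    1, every iterate stays where \<open>lip\<close> holds.\<close>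
  define \<eta> where "\<eta> = e' / (T * exp (L * T))"
  have \<eta>: "\<eta> > 0" "\<eta> * T * exp (L * T) = e'" using e' T by (auto simp: \<eta>_def)
  have contG: "continuous_on {0..T} G" using cont by (simp add: G_def[abs_def])
  then have "uniformly_continuous_on {0..T} G" by (intro compact_uniformly_continuous) auto
  then obtain d where d: "d > 0" "\<And>s t. s \<in> {0..T} \<Longrightarrow> t \<in> {0..T} \<Longrightarrow> dist s t < d \<Longrightarrow> dist (G s) (G t) < \<eta>"
    unfolding uniformly_continuous_on_def using \<eta>(1) by metis
  obtain N where N: "T / d < real N" using reals_Archimedean2 by blast
  show ?thesis
  proof (intro exI[of _ "Suc N"] allI impI)
    fix n j assume n: "Suc N \<le> n" and "j \<le> n"
    define \<Delta> where "\<Delta> = T / real n"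
    have npos: "real n > 0" using n by simp
    have "T / d < real n" using N n by linarith
    then have \<Delta>: "\<Delta> > 0" "\<Delta> < d" "real n * \<Delta> = T"
      using T d(1) npos by (auto simp: \<Delta>_def field_simps)
    define E where "E = euler \<Delta> g (y 0) (\<lambda>j. w (real (Suc j) * \<Delta>) - w (real j * \<Delta>))"
    have main: "norm (E j - y (real j * \<Delta>)) \<le> \<eta> * (real j * \<Delta>) * exp (L * (real j * \<Delta>))" if "j \<le> n" for j
      using that
    proof (induction j)
      case 0
      then show ?case by (simp add: E_def)
    next
      case (Suc j)
      define s t where "s = real j * \<Delta>" and "t = real (Suc j) * \<Delta>"
      have "real (Suc j) * \<Delta> \<le> real n * \<Delta>" using Suc.prems \<Delta>(1) by (intro mult_right_mono) auto
      then have st: "0 \<le> s" "s < t" "t \<le> T" "t - s = \<Delta>"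
        unfolding s_def t_def using \<Delta> by (auto simp: algebra_simps)
      then have sT: "s \<in> {0..T}" "t \<in> {0..T}" by auto
      have IH: "norm (E j - y s) \<le> \<eta> * s * exp (L * s)" using Suc by (simp add: s_def)
      also have "\<dots> \<le> \<eta> * T * exp (L * T)"
        using st \<eta>(1) L T by (intro mult_mono) (auto intro: mult_left_mono)
      also have "\<dots> \<le> 1" using \<eta> e' by simp
      finally have small: "norm (E j - y s) \<le> 1" .
      have iG: "G integrable_on {0..t}"
        using st by (intro integrable_continuous_real continuous_on_subset[OF contG]) auto
      have "integral {0..s} G + integral {s..t} G = integral {0..t} G"
        using st iG by (intro Henstock_Kurzweil_Integration.integral_combine) auto
      then have ydiff: "y t - y s = integral {s..t} G + (w t - w s)"
        unfolding sol[OF sT(1)] sol[OF sT(2)] G_def[symmetric] by (simp add: algebra_simps)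
      have "norm (integral {s..t} (\<lambda>r. G s - G r)) \<le> \<eta> * (t - s)"
      proof (rule integral_bound)
        show "continuous_on {s..t} (\<lambda>r. G s - G r)"
          using st by (intro continuous_intros continuous_on_subset[OF contG]) auto
        fix r assume "r \<in> {s..t}"
        then have "dist (G s) (G r) < \<eta>"
          using st \<Delta> sT by (intro d(2)) (auto simp: dist_real_def)
        then show "norm (G s - G r) \<le> \<eta>" by (simp add: dist_norm)
      qed (use st in auto)
      also have "integral {s..t} (\<lambda>r. G s - G r) = \<Delta> *\<^sub>R G s - integral {s..t} G"
        using st by (subst Henstock_Kurzweil_Integration.integral_diff)
          (auto intro!: integrable_continuous_real continuous_on_subset[OF contG])
      finally have q: "norm (\<Delta> *\<^sub>R G s - integral {s..t} G) \<le> \<eta> * \<Delta>" using st by simp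
      have Es: "E (Suc j) = E j + \<Delta> *\<^sub>R g s (E j) + (w t - w s)"
        by (simp only: E_def euler.simps s_def t_def)
      \<comment> \<open>The noise increments cancel. What remains is the old error, the drift error
        controlled by \<open>lip\<close>, and the quadrature error over one step, controlled by the
        modulus of continuity of G.\<close>
      have "E (Suc j) - y t = (E j - y s) + \<Delta> *\<^sub>R (g s (E j) - g s (y s)) + (\<Delta> *\<^sub>R G s - integral {s..t} G)"
        using ydiff unfolding Es by (simp add: G_def algebra_simps)
      also have "norm \<dots> \<le> norm (E j - y s) + \<Delta> * norm (g s (E j) - g s (y s)) + \<eta> * \<Delta>"
        using q \<Delta>(1) by (intro order_trans[OF norm_triangle_ineq] add_mono) auto
      also have "\<dots> \<le> norm (E j - y s) + \<Delta> * (L * norm (E j - y s)) + \<eta> * \<Delta>"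
        using lip[OF sT(1) small] \<Delta>(1) \<eta>(1) by (intro add_mono mult_left_mono) auto
      also have "\<dots> = (1 + L * \<Delta>) * norm (E j - y s) + \<eta> * \<Delta>" by (simp add: algebra_simps)
      also have "\<dots> \<le> exp (L * \<Delta>) * (\<eta> * s * exp (L * s)) + \<eta> * \<Delta> * exp (L * t)"
      proof (rule add_mono)
        show "(1 + L * \<Delta>) * norm (E j - y s) \<le> exp (L * \<Delta>) * (\<eta> * s * exp (L * s))"
          using IH by (intro mult_mono) auto
        have "\<eta> * \<Delta> * 1 \<le> \<eta> * \<Delta> * exp (L * t)"
          using \<eta> \<Delta> L st by (intro mult_left_mono) auto
        then show "\<eta> * \<Delta> \<le> \<eta> * \<Delta> * exp (L * t)" by simp
      qed
      also have "\<dots> = \<eta> * t * exp (L * t)"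
      proof -
        have "exp (L * t) = exp (L * \<Delta>) * exp (L * s)" using st by (simp add: algebra_simps flip: exp_add)
        moreover have "t = s + \<Delta>" using st by simp
        ultimately show ?thesis by (simp add: algebra_simps)
      qed
      finally show ?case by (simp add: t_def)
    qed
    have "real j * \<Delta> \<le> T" using \<open>j \<le> n\<close> \<Delta> by (metis mult_right_mono of_nat_le_iff less_imp_le)
    then have "\<eta> * (real j * \<Delta>) * exp (L * (real j * \<Delta>)) \<le> \<eta> * T * exp (L * T)"
      using \<eta>(1) L T \<Delta> by (intro mult_mono) (auto intro: mult_left_mono)
    then have "norm (E j - y (real j * \<Delta>)) \<le> e" using main[OF \<open>j \<le> n\<close>] \<eta> e' by linarith
    then show "norm (euler (T / real n) g (y 0)
     (\<lambda>j. w (real (Suc j) * (T / real n)) - w (real j * (T / real n))) j - y (real j * (T / real n))) \<le> e"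
      by (simp only: E_def \<Delta>_def)
  qed
qed

definition grid_index :: "real \<Rightarrow> nat \<Rightarrow> real \<Rightarrow> nat" where
  "grid_index T n t = nat \<lfloor>t * real n / T\<rfloor>"

lemma grid_index:
  assumes "T > 0" "t \<in> {0..T}"
  shows "grid_index T n t \<le> n" "0 < n \<Longrightarrow> \<bar>real (grid_index T n t) * (T / real n) - t\<bar> \<le> T / real n"
proof -
  have 0: "0 \<le> t * real n / T" using assms by auto
  have 1: "t * real n / T \<le> real n" using assms by (simp add: field_simps mult_right_mono)
  have 2: "real (grid_index T n t) \<le> t * real n / T" "t * real n / T < real (grid_index T n t) + 1"
    unfolding grid_index_def using 0 by linarith+
  show "grid_index T n t \<le> n" using 1 2 by linarith
  assume n: "0 < n"
  have "\<bar>real (grid_index T n t) - t * real n / T\<bar> \<le> 1" using 2 by linarith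
  then have "\<bar>real (grid_index T n t) - t * real n / T\<bar> * (T / real n) \<le> 1 * (T / real n)"
    using assms by (intro mult_right_mono) auto
  also have "\<bar>real (grid_index T n t) - t * real n / T\<bar> * (T / real n) = \<bar>(real (grid_index T n t) - t * real n / T) * (T / real n)\<bar>"
    using assms by (simp add: abs_mult)
  also have "(real (grid_index T n t) - t * real n / T) * (T / real n) = real (grid_index T n t) * (T / real n) - t"
    using n assms by (simp add: left_diff_distrib diff_divide_distrib)
  finally show "\<bar>real (grid_index T n t) * (T / real n) - t\<bar> \<le> T / real n" by simp
qed

text \<open>The error on the grid is uniform in the index, and the grid point next to t approaches
  t, where y is continuous.\<close>

lemma euler_tendsto:
  fixes y w :: "real \<Rightarrow> 'a::euclidean_space"
  assumes T: "T > 0" and L: "L \<ge> 0"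
    and sol: "\<And>t. t \<in> {0..T} \<Longrightarrow> y t = y 0 + integral {0..t} (\<lambda>s. g s (y s)) + w t"
    and cont: "continuous_on {0..T} (\<lambda>s. g s (y s))"
    and lip: "\<And>t x. t \<in> {0..T} \<Longrightarrow> norm (x - y t) \<le> 1 \<Longrightarrow> norm (g t x - g t (y t)) \<le> L * norm (x - y t)"
    and y: "continuous_on {0..T} y" and t: "t \<in> {0..T}"
  shows "(\<lambda>n. euler (T / real n) g (y 0)
     (\<lambda>j. w (real (Suc j) * (T / real n)) - w (real j * (T / real n))) (grid_index T n t)) \<longlonglongrightarrow> y t"
proof (rule LIMSEQ_I)
  fix e :: real assume e: "e > 0"
  obtain N where N: "\<And>n j. n \<ge> N \<Longrightarrow> j \<le> n \<Longrightarrow> norm (euler (T / real n) g (y 0)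
     (\<lambda>j. w (real (Suc j) * (T / real n)) - w (real j * (T / real n))) j - y (real j * (T / real n))) \<le> e / 2"
    using euler_converges[OF T L sol cont lip, of "e / 2"] e by auto
  obtain d where d: "d > 0" "\<And>s. s \<in> {0..T} \<Longrightarrow> dist s t < d \<Longrightarrow> dist (y s) (y t) < e / 2"
    using y t e unfolding continuous_on_iff by (metis half_gt_zero)
  obtain N' where N': "T / d < real N'" using reals_Archimedean2 by blast
  show "\<exists>no. \<forall>n\<ge>no. norm (euler (T / real n) g (y 0)
     (\<lambda>j. w (real (Suc j) * (T / real n)) - w (real j * (T / real n))) (grid_index T n t) - y t) < e"
  proof (intro exI[of _ "max N (Suc N')"] allI impI)
    fix n assume n: "max N (Suc N') \<le> n"
    define k where "k = grid_index T n t"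
    have n0: "n > 0" using n by auto
    have "T / d < real n" using n N' by linarith
    then have Tn: "T / real n < d" using d(1) n0 by (simp add: field_simps)
    have k: "k \<le> n" "\<bar>real k * (T / real n) - t\<bar> \<le> T / real n"
      unfolding k_def using grid_index[OF T t] n0 by auto
    have "real k * (T / real n) \<le> real n * (T / real n)" using k T by (intro mult_right_mono) auto
    then have "real k * (T / real n) \<in> {0..T}" using T n0 by auto
    then have 1: "dist (y (real k * (T / real n))) (y t) < e / 2"
      using k Tn by (intro d(2)) (auto simp: dist_real_def)
    have 2: "norm (euler (T / real n) g (y 0)
     (\<lambda>j. w (real (Suc j) * (T / real n)) - w (real j * (T / real n))) k - y (real k * (T / real n))) \<le> e / 2"
      by (rule N) (use n k in auto)
    show "norm (euler (T / real n) g (y 0)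
     (\<lambda>j. w (real (Suc j) * (T / real n)) - w (real j * (T / real n))) (grid_index T n t) - y t) < e"
      unfolding k_def[symmetric]
      using norm_triangle_lt[OF add_le_less_mono[OF 2 1[unfolded dist_norm]]] by simp
  qed
qed

text \<open>Subtracting the partial sums s of the noise leaves u, which obeys a recursion forced
  only by A applied to s; discrete Gronwall finishes. The bound thus involves partial sums, which in
  the application are values of the driving path, and not the sum of the norms of the increments,
  which would blow up as the step tends to 0.\<close>

lemma euler_linear_bound:
  fixes A :: "real \<Rightarrow> 'a::euclidean_space \<Rightarrow> 'a"
  assumes A: "\<And>j x. j < n \<Longrightarrow> norm (A (real j * \<Delta>) x) \<le> L * norm x" and L: "L \<ge> 0" and \<Delta>: "\<Delta> \<ge> 0"
    and "j \<le> n"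
  shows "norm (euler \<Delta> A x \<xi> j) \<le> norm (\<Sum>i<j. \<xi> i)
     + exp (L * (real n * \<Delta>)) * (norm x + L * \<Delta> * (\<Sum>i<n. norm (\<Sum>k<i. \<xi> k)))"
proof -
  define s where "s i = (\<Sum>k<i. \<xi> k)" for i
  define u where "u i = euler \<Delta> A x \<xi> i - s i" for i
  have main: "norm (u j) \<le> exp (L * (real j * \<Delta>)) * (norm x + L * \<Delta> * (\<Sum>i<j. norm (s i)))" if "j \<le> n" for j
    using that
  proof (induction j)
    case 0
    then show ?case by (simp add: u_def s_def)
  next
    case (Suc j)
    have "u (Suc j) = u j + \<Delta> *\<^sub>R A (real j * \<Delta>) (u j + s j)"
      by (simp add: u_def s_def algebra_simps)
    also have "norm \<dots> \<le> norm (u j) + \<Delta> * (L * norm (u j + s j))"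
      using A[of j "u j + s j"] Suc.prems \<Delta> by (intro order_trans[OF norm_triangle_ineq] add_mono) (auto intro: mult_left_mono)
    also have "\<dots> \<le> norm (u j) + \<Delta> * (L * (norm (u j) + norm (s j)))"
      using L \<Delta> by (intro add_left_mono mult_left_mono norm_triangle_ineq) auto
    also have "\<dots> = (1 + L * \<Delta>) * norm (u j) + L * \<Delta> * norm (s j)" by (simp add: algebra_simps)
    also have "\<dots> \<le> exp (L * \<Delta>) * (exp (L * (real j * \<Delta>)) * (norm x + L * \<Delta> * (\<Sum>i<j. norm (s i))))
        + exp (L * (real (Suc j) * \<Delta>)) * (L * \<Delta> * norm (s j))"
    proof (rule add_mono)
      show "(1 + L * \<Delta>) * norm (u j) \<le>
          exp (L * \<Delta>) * (exp (L * (real j * \<Delta>)) * (norm x + L * \<Delta> * (\<Sum>i<j. norm (s i))))"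
        using Suc by (intro mult_mono) auto
      have "1 * (L * \<Delta> * norm (s j)) \<le> exp (L * (real (Suc j) * \<Delta>)) * (L * \<Delta> * norm (s j))"
        using L \<Delta> by (intro mult_right_mono) auto
      then show "L * \<Delta> * norm (s j) \<le> exp (L * (real (Suc j) * \<Delta>)) * (L * \<Delta> * norm (s j))" by simp
    qed
    also have "\<dots> = exp (L * (real (Suc j) * \<Delta>)) * (norm x + L * \<Delta> * (\<Sum>i<Suc j. norm (s i)))"
    proof -
      have "exp (L * (real (Suc j) * \<Delta>)) = exp (L * \<Delta>) * exp (L * (real j * \<Delta>))"
        by (simp add: algebra_simps flip: exp_add)
      then show ?thesis by (simp add: algebra_simps)
    qed
    finally show ?case .
  qed
  have "norm (euler \<Delta> A x \<xi> j) \<le> norm (s j) + norm (u j)"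
    using norm_triangle_ineq[of "s j" "u j"] by (simp add: u_def)
  also have "norm (u j) \<le> exp (L * (real n * \<Delta>)) * (norm x + L * \<Delta> * (\<Sum>i<n. norm (s i)))"
  proof (rule order_trans[OF main[OF \<open>j \<le> n\<close>]], rule mult_mono)
    show "exp (L * (real j * \<Delta>)) \<le> exp (L * (real n * \<Delta>))"
      using L \<Delta> \<open>j \<le> n\<close> by (simp add: mult_left_mono mult_right_mono)
    have "(\<Sum>i<j. norm (s i)) \<le> (\<Sum>i<n. norm (s i))"
      using \<open>j \<le> n\<close> by (intro sum_mono2) auto
    then show "norm x + L * \<Delta> * (\<Sum>i<j. norm (s i)) \<le> norm x + L * \<Delta> * (\<Sum>i<n. norm (s i))"
      using L \<Delta> by (intro add_left_mono mult_left_mono) auto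
  qed (use L \<Delta> in \<open>auto intro!: add_nonneg_nonneg mult_nonneg_nonneg sum_nonneg\<close>)
  finally show ?thesis by (simp add: s_def)
qed

lemma power_mean:
  fixes x :: "nat \<Rightarrow> real"
  assumes n: "n > 0"
  shows "((\<Sum>i<n. x i) / real n) ^ (2 * k) \<le> (\<Sum>i<n. x i ^ (2 * k)) / real n"
proof -
  have "(\<Sum>i<n. (1 / real n) *\<^sub>R x i) ^ (2 * k) \<le> (\<Sum>i<n. (1 / real n) * x i ^ (2 * k))"
    using convex_on_sum[OF _ _ convex_power_even[of "2 * k"], of "{..<n}" "\<lambda>_. 1 / real n" x] n by auto
  then show ?thesis by (simp add: sum_divide_distrib)
qed

lemma power_sum3:
  fixes a b c :: real
  assumes "a \<ge> 0" "b \<ge> 0" "c \<ge> 0"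
  shows "(a + b + c) ^ p \<le> 3 ^ p * (a ^ p + b ^ p + c ^ p)"
proof -
  define m where "m = max a (max b c)"
  have "(a + b + c) ^ p \<le> (3 * m) ^ p" using assms by (intro power_mono) (auto simp: m_def)
  also have "\<dots> = 3 ^ p * m ^ p" by (simp add: power_mult_distrib)
  also have "m ^ p \<le> a ^ p + b ^ p + c ^ p"
    using assms zero_le_power[of a p] zero_le_power[of b p] zero_le_power[of c p]
    by (auto simp: m_def max_def)
  finally show ?thesis by simp
qed

section \<open>The square root of a positive definite matrix\<close>

lemma inner_matrix_transpose:
  fixes A :: "real ^ 'n::finite ^ 'n"
  shows "(transpose A *v x) \<bullet> y = x \<bullet> (A *v y)"
  by (simp add: dot_lmul_matrix)

lemma inner_symmetric_matrix:
  fixes A :: "real ^ 'n::finite ^ 'n"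
  assumes "transpose A = A" shows "(A *v x) \<bullet> y = x \<bullet> (A *v y)"
  using inner_matrix_transpose[of A x y] assms by simp

lemma matrix_entry_inner:
  fixes A :: "real ^ 'n::finite ^ 'n"
  shows "A $ i $ j = axis i 1 \<bullet> (A *v axis j 1)"
  by (simp only: inner_axis') (simp add: matrix_vector_mult_def axis_def if_distrib cong: if_cong)

lemma transpose_eqI:
  fixes A :: "real ^ 'n::finite ^ 'n"
  assumes "\<And>x y. (A *v x) \<bullet> y = x \<bullet> (A *v y)" shows "transpose A = A"
proof -
  have "transpose A $ i $ j = A $ i $ j" for i j
  proof -
    have "transpose A $ i $ j = A $ j $ i" by (simp add: transpose_def)
    also have "\<dots> = (A *v axis i 1) \<bullet> axis j 1" by (subst matrix_entry_inner) (simp add: inner_commute)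
    also have "\<dots> = A $ i $ j" unfolding assms by (rule matrix_entry_inner[symmetric])
    finally show ?thesis .
  qed
  then show ?thesis by (simp add: vec_eq_iff)
qed

lemma pos_def_lower_bound:
  fixes A :: "real ^ 'n::finite ^ 'n"
  assumes A: "pos_def A"
  obtains c where "c > 0" "\<And>x. c * (norm x)\<^sup>2 \<le> x \<bullet> (A *v x)"
proof -
  let ?S = "sphere 0 1 :: (real ^ 'n) set"
  have "axis undefined 1 \<in> ?S" by simp
  then have ne: "?S \<noteq> {}" by blast
  have cont: "continuous_on ?S (\<lambda>x. x \<bullet> (A *v x))"
    by (intro continuous_intros linear_continuous_on matrix_vector_mul_bounded_linear)
  obtain u where u: "u \<in> ?S" "\<And>x. x \<in> ?S \<Longrightarrow> u \<bullet> (A *v u) \<le> x \<bullet> (A *v x)"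
    using continuous_attains_inf[OF compact_sphere ne cont] by blast
  show thesis
  proof (rule that)
    have "u \<noteq> 0" using u(1) by auto
    then show "u \<bullet> (A *v u) > 0" using A by (simp add: pos_def_def)
    fix x
    show "(u \<bullet> (A *v u)) * (norm x)\<^sup>2 \<le> x \<bullet> (A *v x)"
    proof (cases "x = 0")
      case False
      define y where "y = x /\<^sub>R norm x"
      have xy: "x = norm x *\<^sub>R y" using False by (simp add: y_def)
      have "y \<in> ?S" using False by (simp add: y_def)
      then have "(u \<bullet> (A *v u)) * (norm x)\<^sup>2 \<le> (y \<bullet> (A *v y)) * (norm x)\<^sup>2"
        by (intro mult_right_mono u) auto
      also have "\<dots> = (norm x *\<^sub>R y) \<bullet> (A *v (norm x *\<^sub>R y))"
        by (simp add: matrix_vector_mult_scaleR power2_eq_square)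
      also have "\<dots> = x \<bullet> (A *v x)" by (simp only: xy[symmetric])
      finally show ?thesis .
    qed simp
  qed
qed

text \<open>Such a y minimises the nonnegative quadratic form, so the first-order term in the
  direction S y, whose coefficient is 2 |S y|^2, must vanish.\<close>

lemma pos_semidef_null:
  fixes S :: "real ^ 'n::finite ^ 'n"
  assumes S: "pos_semidef S" and y: "y \<bullet> (S *v y) = 0"
  shows "S *v y = 0"
proof -
  define p r where "p = (norm (S *v y))\<^sup>2" and "r = (S *v y) \<bullet> (S *v (S *v y))"
  have sym: "transpose S = S" and psd: "\<And>x. 0 \<le> x \<bullet> (S *v x)" using S by (auto simp: pos_semidef_def)
  have r: "r \<ge> 0" unfolding r_def by (rule psd)
  \<comment> \<open>Taking r + 1 instead of r avoids a division by 0 and leaves 2 - r/s strictly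
    positive.\<close>
  define s where "s = r + 1"
  have s: "s > 0" "r < s" using r by (auto simp: s_def)
  define t where "t = - p / s"
  have "0 \<le> (y + t *\<^sub>R (S *v y)) \<bullet> (S *v (y + t *\<^sub>R (S *v y)))" by (rule psd)
  also have "\<dots> = y \<bullet> (S *v y) + 2 * t * p + t * t * r"
  proof -
    have "y \<bullet> (S *v (S *v y)) = (S *v y) \<bullet> (S *v y)"
      using inner_symmetric_matrix[OF sym, of y "S *v y"] by simp
    then show ?thesis
      by (simp add: p_def r_def power2_norm_eq_inner matrix_vector_right_distrib matrix_vector_mult_scaleR
         inner_add_left inner_add_right algebra_simps)
  qed
  finally have "0 \<le> 2 * t * p + t * t * r" using y by simp
  also have "\<dots> = - (p\<^sup>2 / s) * (2 - r / s)"
    using s by (simp add: t_def power2_eq_square field_simps)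
  finally have le: "(p\<^sup>2 / s) * (2 - r / s) \<le> 0" by simp
  have "2 - r / s > 0" using s by (simp add: field_simps)
  with le have "p\<^sup>2 / s \<le> 0" by (simp only: mult_le_0_iff) auto
  then have "p\<^sup>2 \<le> 0" using s by (simp add: divide_le_0_iff)
  then show ?thesis by (simp add: p_def)
qed

text \<open>With \<open>X = S - R\<close> one has \<open>S X + X R = 0\<close>, so \<open>tr (X S X) = - tr (X R X)\<close>; both traces are
  nonnegative.\<close>

lemma matrix_sqrt_unique:
  fixes S R :: "real ^ 'n::finite ^ 'n"
  assumes S: "pos_semidef S" and R: "pos_semidef R" and eq: "S ** S = R ** R" and A: "pos_def (S ** S)"
  shows "S = R"
proof -
  define X where "X = S - R"
  have symX: "transpose X = X" using S R by (simp add: X_def pos_semidef_def transpose_def vec_eq_iff)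
  have "S ** X = S ** S - S ** R" "X ** R = S ** R - R ** R"
    by (simp_all add: X_def matrix_matrix_mult_def vec_eq_iff left_diff_distrib right_diff_distrib sum_subtractf)
  then have "S ** X + X ** R = 0" using eq by simp
  then have SX: "S ** X = - (X ** R)" by (simp add: eq_neg_iff_add_eq_0)
  have tr: "trace (X ** M ** X) = (\<Sum>i\<in>UNIV. (X *v axis i 1) \<bullet> (M *v (X *v axis i 1)))" for M
    unfolding trace_def by (subst matrix_entry_inner)
     (simp add: inner_symmetric_matrix[OF symX] flip: matrix_vector_mul_assoc)
  have "trace (X ** S ** X) = trace (X ** (S ** X))" by (simp add: matrix_mul_assoc)
  also have "\<dots> = - trace (X ** (X ** R))" unfolding SX
    by (simp add: trace_def matrix_matrix_mult_def sum_negf)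
  also have "trace (X ** (X ** R)) = trace (X ** R ** X)" by (rule trace_mul_sym)
  finally have "trace (X ** S ** X) \<le> 0"
    unfolding tr using R by (simp add: pos_semidef_def sum_nonneg)
  then have "(\<Sum>i\<in>UNIV. (X *v axis i 1) \<bullet> (S *v (X *v axis i 1))) = 0"
    unfolding tr using S sum_nonneg[of UNIV "\<lambda>i. (X *v axis i 1) \<bullet> (S *v (X *v axis i 1))"]
    by (auto simp: pos_semidef_def)
  then have 0: "(X *v axis i 1) \<bullet> (S *v (X *v axis i 1)) = 0" for i
    using S by (subst (asm) sum_nonneg_eq_0_iff) (auto simp: pos_semidef_def)
  \<comment> \<open>Vanishing of the quadratic form makes S annihilate X e_i, and S S is
    definite.\<close>
  have X0: "X *v axis i 1 = 0" for i
  proof -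
    have "S *v (X *v axis i 1) = 0" by (rule pos_semidef_null[OF S 0])
    then have "(S ** S) *v (X *v axis i 1) = 0" by (simp flip: matrix_vector_mul_assoc)
    then show ?thesis using A unfolding pos_def_def by (metis inner_zero_right less_irrefl)
  qed
  have "X $ i $ j = 0" for i j by (subst matrix_entry_inner) (simp add: X0)
  then have "X = 0" by (simp add: vec_eq_iff)
  then show ?thesis by (simp add: X_def)
qed

text \<open>\<open>I - Y\<close> is a square root of \<open>I - B\<close> as soon as \<open>Y = (B + Y\<^sup>2) / 2\<close>, a contraction when
  \<open>B\<close> is small; the constant \<open>c = 1 - sqrt (1 - q)\<close> solves \<open>c = (q + c\<^sup>2) / 2\<close>.\<close>

lemma matrix_sqrt_exists:
  fixes A :: "real ^ 'n::finite ^ 'n"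
  assumes A: "pos_def A"
  shows "\<exists>S. pos_semidef S \<and> S ** S = A"
proof -
  have symA: "transpose A = A" using A by (simp add: pos_def_def)
  obtain c0 where c0: "c0 > 0" "\<And>x. c0 * (norm x)\<^sup>2 \<le> x \<bullet> (A *v x)" using pos_def_lower_bound[OF A] by blast
  obtain M where M: "M > 0" "\<And>x. norm (A *v x) \<le> norm x * M"
    using bounded_linear.pos_bounded[OF matrix_vector_mul_bounded_linear[of A]] by blast
  \<comment> \<open>The map I - A/k has squared norm at most 1 - 2 c0/k + M^2/k^2; the choice k =
    M^2/c0 minimises this and gives 1 - c0^2/M^2 < 1.\<close>
  define k where "k = M\<^sup>2 / c0"
  have k: "k > 0" using M c0 by (simp add: k_def)
  define \<beta> :: "(real ^ 'n) \<Rightarrow>\<^sub>L (real ^ 'n)" where "\<beta> = id_blinfun - (1 / k) *\<^sub>R Blinfun ((*v) A)"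
  have \<beta>: "blinfun_apply \<beta> x = x - (1 / k) *\<^sub>R (A *v x)" for x
    by (simp add: \<beta>_def blinfun.diff_left blinfun.scaleR_left bounded_linear_Blinfun_apply matrix_vector_mul_bounded_linear)
  define q2 where "q2 = 1 - c0\<^sup>2 / M\<^sup>2"
  have \<beta>2: "(norm (\<beta> x))\<^sup>2 \<le> q2 * (norm x)\<^sup>2" for x
  proof -
    have "(norm (\<beta> x))\<^sup>2 = (norm x)\<^sup>2 - 2 / k * (x \<bullet> (A *v x)) + (norm (A *v x))\<^sup>2 / k\<^sup>2"
      unfolding \<beta> power2_norm_eq_inner
      by (simp add: inner_diff_left inner_diff_right inner_commute[of "A *v x" x] power2_eq_square diff_divide_distrib)
    also have "\<dots> \<le> (norm x)\<^sup>2 - 2 / k * (c0 * (norm x)\<^sup>2) + (norm x * M)\<^sup>2 / k\<^sup>2"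
      using k c0(2)[of x] M(2)[of x]
      by (intro add_mono diff_mono divide_right_mono power_mono mult_left_mono) auto
    also have "\<dots> = q2 * (norm x)\<^sup>2"
      using c0(1) M(1) by (simp add: q2_def k_def field_simps power2_eq_square)
    finally show ?thesis .
  qed
  have q2: "0 \<le> q2" "q2 < 1"
  proof -
    \<comment> \<open>Nonnegativity of \<open>q2\<close> is read off from its own bound at a unit
      vector.\<close>
    have "0 \<le> q2 * (norm (axis undefined 1 :: real ^ 'n))\<^sup>2" by (rule order_trans[OF _ \<beta>2]) auto
    then show "0 \<le> q2" by simp
    show "q2 < 1" using c0(1) M(1) by (simp add: q2_def)
  qed
  define q where "q = sqrt q2"
  have q: "0 \<le> q" "q < 1" "q\<^sup>2 = q2" using q2 by (auto simp: q_def)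
  have n\<beta>: "norm \<beta> \<le> q"
  proof (rule norm_blinfun_bound)
    fix x
    have "(norm (\<beta> x))\<^sup>2 \<le> (q * norm x)\<^sup>2" using \<beta>2 q by (simp add: power_mult_distrib)
    then show "norm (\<beta> x) \<le> q * norm x" by (rule power2_le_imp_le) (use q in auto)
  qed (rule q)
  define c where "c = 1 - sqrt (1 - q)"
  have "(1 - sqrt (1 - q))\<^sup>2 = 2 - q - 2 * sqrt (1 - q)" using q by (simp add: power2_diff)
  then have c: "0 \<le> c" "c < 1" "(q + c\<^sup>2) / 2 = c"
    using q by (auto simp: c_def)
  \<comment> \<open>Symmetry is built into the invariant set, so the fixed point is symmetric. The
    ball of radius c is mapped into itself because (q + c^2)/2 = c.\<close>
  define X where "X = {Y :: (real ^ 'n) \<Rightarrow>\<^sub>L (real ^ 'n). norm Y \<le> c \<and> (\<forall>x y. blinfun_apply Y x \<bullet> y = x \<bullet> blinfun_apply Y y)}"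
  define F where "F Y = (1 / 2) *\<^sub>R (\<beta> + (Y o\<^sub>L Y))" for Y
  have clX: "closed X" unfolding X_def
    by (intro closed_Collect_conj closed_Collect_all closed_Collect_le closed_Collect_eq continuous_intros)
  note iffD2[OF complete_eq_closed clX]
  moreover have "0 \<in> X" using c by (simp add: X_def)
  then have "X \<noteq> {}" by blast
  moreover have "F ` X \<subseteq> X"
  proof safe
    fix Y assume Y: "Y \<in> X"
    have "norm (F Y) \<le> (norm \<beta> + norm Y * norm Y) / 2"
      unfolding F_def using norm_triangle_ineq[of \<beta> "Y o\<^sub>L Y"] norm_blinfun_compose[of Y Y] by simp
    also have "\<dots> \<le> (q + c * c) / 2"
      using n\<beta> Y c by (intro divide_right_mono add_mono mult_mono) (auto simp: X_def)
    finally have "norm (F Y) \<le> c" using c(3) by (simp add: power2_eq_square)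
    moreover have "F Y x \<bullet> y = x \<bullet> F Y y" for x y
      using Y by (simp add: F_def X_def blinfun.scaleR_left blinfun.add_left \<beta> inner_add_left inner_add_right
        inner_diff_left inner_diff_right inner_symmetric_matrix[OF symA])
    ultimately show "F Y \<in> X" by (simp add: X_def)
  qed
  moreover have "\<forall>Y\<in>X. \<forall>Z\<in>X. dist (F Y) (F Z) \<le> c * dist Y Z"
  proof safe
    fix Y Z assume YZ: "Y \<in> X" "Z \<in> X"
    \<comment> \<open>The noncommutative difference of squares Y Y - Z Z = Y (Y - Z) + (Y - Z) Z
      yields the contraction factor c < 1.\<close>
    have "F Y - F Z = (1 / 2) *\<^sub>R ((Y o\<^sub>L (Y - Z)) + ((Y - Z) o\<^sub>L Z))"
      by (rule blinfun_eqI) (simp add: F_def blinfun.scaleR_left blinfun.add_left blinfun.diff_left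
        blinfun.diff_right scaleR_diff_right[symmetric])
    then have "norm (F Y - F Z) \<le> (norm (Y o\<^sub>L (Y - Z)) + norm ((Y - Z) o\<^sub>L Z)) / 2"
      using norm_triangle_ineq[of "Y o\<^sub>L (Y - Z)" "(Y - Z) o\<^sub>L Z"] by simp
    also have "\<dots> \<le> (c * norm (Y - Z) + norm (Y - Z) * c) / 2"
      using YZ c by (intro divide_right_mono add_mono order_trans[OF norm_blinfun_compose] mult_mono)
        (auto simp: X_def)
    finally show "dist (F Y) (F Z) \<le> c * dist Y Z" by (simp add: dist_norm)
  qed
  ultimately obtain Y where Y: "Y \<in> X" "F Y = Y"
    using Banach_fix[of X c F] c by blast
  have YY: "Y (Y x) = 2 *\<^sub>R Y x - \<beta> x" for x
  proof -
    have "2 *\<^sub>R F Y x = \<beta> x + Y (Y x)"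
      by (simp add: F_def blinfun.scaleR_left blinfun.add_left)
    then show ?thesis using Y(2) by (simp add: algebra_simps)
  qed
  \<comment> \<open>(I - Y)^2 = I - \<beta> = A/k, so the factor sqrt k restores A. Positivity holds
    because the norm of Y is at most c < 1.\<close>
  define f where "f x = sqrt k *\<^sub>R (x - Y x)" for x
  have linf: "linear f"
    unfolding f_def by (rule linearI) (simp_all add: blinfun.add_right blinfun.scaleR_right algebra_simps)
  define S where "S = matrix f"
  have S: "S *v x = f x" for x unfolding S_def by (rule matrix_works[OF linf[folded linear_matrix_vector_mul_eq]])
  have symY: "Y x \<bullet> y = x \<bullet> Y y" for x y using Y(1) by (auto simp: X_def)
  have "transpose S = S"
    by (rule transpose_eqI) (simp add: S f_def inner_diff_left inner_diff_right symY)
  moreover have "0 \<le> x \<bullet> (S *v x)" for x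
  proof -
    have "x \<bullet> Y x \<le> norm x * norm (Y x)" by (rule norm_cauchy_schwarz)
    also have "\<dots> \<le> norm x * (c * norm x)"
      using Y(1) norm_blinfun[of Y x] mult_right_mono[of "norm Y" c "norm x"]
      by (intro mult_left_mono) (auto simp: X_def)
    also have "\<dots> \<le> norm x * (1 * norm x)" using c by (intro mult_left_mono mult_right_mono) auto
    also have "\<dots> = x \<bullet> x" by (simp add: dot_square_norm power2_eq_square)
    finally show ?thesis using k by (simp add: S f_def inner_diff_right)
  qed
  moreover have "S ** S = A"
  proof -
    have "(S ** S) *v x = A *v x" for x
    proof -
      have "(S ** S) *v x = f (f x)" by (simp add: S flip: matrix_vector_mul_assoc)
      also have "\<dots> = (sqrt k * sqrt k) *\<^sub>R (x - 2 *\<^sub>R Y x + Y (Y x))"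
        unfolding f_def by (simp add: blinfun.scaleR_right blinfun.diff_right algebra_simps scaleR_2)
      also have "\<dots> = A *v x" using k by (simp add: YY \<beta>)
      finally show ?thesis .
    qed
    then show ?thesis by (simp add: matrix_eq)
  qed
  ultimately show ?thesis unfolding pos_semidef_def by blast
qed

lemma matrix_sqrt_pos_def:
  fixes A :: "real ^ 'n::finite ^ 'n"
  assumes A: "pos_def A"
  shows "pos_semidef (matrix_sqrt A)" "matrix_sqrt A ** matrix_sqrt A = A"
proof -
  have "\<exists>!S. pos_semidef S \<and> S ** S = A"
    using matrix_sqrt_exists[OF A] matrix_sqrt_unique A by metis
  from theI'[OF this] show "pos_semidef (matrix_sqrt A)" "matrix_sqrt A ** matrix_sqrt A = A"
    unfolding matrix_sqrt_def by auto
qed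

text \<open>The upper bound on the noise and the bound on the inverse of the square root are both
  read off from this identity.\<close>

lemma norm_matrix_sqrt:
  fixes A :: "real ^ 'n::finite ^ 'n"
  assumes A: "pos_def A"
  shows "(norm (matrix_sqrt A *v x))\<^sup>2 = x \<bullet> (A *v x)"
proof -
  have "transpose (matrix_sqrt A) = matrix_sqrt A" using matrix_sqrt_pos_def(1)[OF A] by (simp add: pos_semidef_def)
  then have "(norm (matrix_sqrt A *v x))\<^sup>2 = x \<bullet> (matrix_sqrt A *v (matrix_sqrt A *v x))"
    by (simp add: power2_norm_eq_inner inner_symmetric_matrix)
  also have "\<dots> = x \<bullet> (A *v x)"
    using matrix_sqrt_pos_def(2)[OF A] by (simp add: matrix_vector_mul_assoc)
  finally show ?thesis .
qed

lemma pos_def_scaleR: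
  assumes "pos_def A" "e > 0" shows "pos_def (e *\<^sub>R A)"
  using assms by (auto simp: pos_def_def transpose_def vec_eq_iff scaleR_matrix_vector_assoc[symmetric])

section \<open>Second-order Taylor bounds\<close>

lemma frechet_derivative_eq_sum_partial:
  fixes g :: "real ^ 'n::finite \<Rightarrow> real"
  assumes "g differentiable (at x)"
  shows "frechet_derivative g (at x) h = (\<Sum>i\<in>UNIV. h $ i * partial i g x)"
proof -
  have lin: "linear (frechet_derivative g (at x))" by (rule linear_frechet_derivative[OF assms])
  have "h = (\<Sum>i\<in>UNIV. h $ i *\<^sub>R axis i 1)"
    using basis_expansion[of h] by (simp add: scalar_mult_eq_scaleR)
  then have "frechet_derivative g (at x) h = frechet_derivative g (at x) (\<Sum>i\<in>UNIV. h $ i *\<^sub>R axis i 1)" by simp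
  also have "\<dots> = (\<Sum>i\<in>UNIV. h $ i * partial i g x)"
    by (simp add: linear_sum[OF lin] linear_cmul[OF lin] partial_def)
  finally show ?thesis .
qed

lemma DERIV_along_line:
  fixes g :: "real ^ 'n::finite \<Rightarrow> real"
  assumes g: "g differentiable (at (y + t *\<^sub>R h))"
  shows "DERIV (\<lambda>t. g (y + t *\<^sub>R h)) t :> (\<Sum>i\<in>UNIV. h $ i * partial i g (y + t *\<^sub>R h))"
proof -
  let ?D = "frechet_derivative g (at (y + t *\<^sub>R h))"
  have D: "(g has_derivative ?D) (at (y + t *\<^sub>R h))" using g by (simp add: frechet_derivative_works)
  have "((\<lambda>t. y + t *\<^sub>R h) has_derivative (\<lambda>s. s *\<^sub>R h)) (at t)" by (auto intro!: derivative_eq_intros)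
  from diff_chain_at[OF this D] have "((\<lambda>t. g (y + t *\<^sub>R h)) has_derivative (\<lambda>s. ?D (s *\<^sub>R h))) (at t)"
    by (simp add: o_def)
  moreover have "?D (s *\<^sub>R h) = s * ?D h" for s
    using linear_cmul[OF linear_frechet_derivative[OF g]] by simp
  ultimately have "((\<lambda>t. g (y + t *\<^sub>R h)) has_derivative (\<lambda>s. ?D h * s)) (at t)" by (simp add: mult.commute)
  then show ?thesis unfolding has_field_derivative_def frechet_derivative_eq_sum_partial[OF g] by simp
qed

lemma C_class_2:
  assumes "C_class 2 g"
  shows "g differentiable (at x)" "partial i g differentiable (at x)"
  using assms by (auto simp: numeral_2_eq_2)

text \<open>Lagrange remainder of order two along the segment from y to x. The intermediate point
  has norm at most |y| + |x - y|, the squared dimension counts the second partial derivatives, and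
  the factor 1/2 is given away.\<close>

lemma Taylor_remainder_scalar:
  fixes g :: "real ^ 'n::finite \<Rightarrow> real"
  assumes g: "C_class 2 g" and c: "c > 0"
    and bound: "\<And>i j u. \<bar>partial i (partial j g) u\<bar> \<le> c * (1 + norm u ^ s)"
  shows "\<bar>g x - g y - frechet_derivative g (at y) (x - y)\<bar>
     \<le> real CARD('n) ^ 2 * c * (1 + (norm y + norm (x - y)) ^ s) * (norm (x - y))\<^sup>2"
proof -
  define h where "h = x - y"
  \<comment> \<open>\<open>\<phi> k\<close> is the k-th derivative of g along the segment, for k up
    to 2; the second one contains the iterated partial derivatives to which the growth bound
    applies.\<close>
  define \<phi> :: "nat \<Rightarrow> real \<Rightarrow> real" where "\<phi> k t = (if k = 0 then g (y + t *\<^sub>R h)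
     else if k = 1 then \<Sum>i\<in>UNIV. h $ i * partial i g (y + t *\<^sub>R h)
     else \<Sum>i\<in>UNIV. h $ i * (\<Sum>j\<in>UNIV. h $ j * partial j (partial i g) (y + t *\<^sub>R h)))" for k t
  have 0: "DERIV (\<phi> 0) t :> \<phi> 1 t" for t
    unfolding \<phi>_def using DERIV_along_line[OF C_class_2(1)[OF g]] by simp
  have 1: "DERIV (\<phi> 1) t :> \<phi> 2 t" for t
    unfolding \<phi>_def by (auto intro!: DERIV_sum DERIV_cmult DERIV_along_line C_class_2(2)[OF g])
  have "\<exists>t. 0 < t \<and> t < 1 \<and> \<phi> 0 1 = (\<Sum>k<2. \<phi> k 0 / fact k * 1 ^ k) + \<phi> 2 t / fact 2 * 1 ^ 2"
  proof (rule Maclaurin)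
    show "\<forall>m t. m < 2 \<and> 0 \<le> t \<and> t \<le> 1 \<longrightarrow> DERIV (\<phi> m) t :> \<phi> (Suc m) t"
    proof safe
      fix m :: nat and t :: real assume "m < 2"
      then have "m = 0 \<or> m = 1" by auto
      then show "DERIV (\<phi> m) t :> \<phi> (Suc m) t" using 0 1 by (auto simp: numeral_2_eq_2)
    qed
  qed auto
  then obtain t where t: "0 < t" "t < 1" "\<phi> 0 1 = \<phi> 0 0 + \<phi> 1 0 + \<phi> 2 t / 2"
    by (auto simp: numeral_2_eq_2 fact_numeral)
  have "\<phi> 1 0 = frechet_derivative g (at y) (x - y)"
    unfolding frechet_derivative_eq_sum_partial[OF C_class_2(1)[OF g]] by (simp add: \<phi>_def h_def)
  then have "g x - g y - frechet_derivative g (at y) (x - y) = \<phi> 2 t / 2"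
    using t(3) by (simp add: \<phi>_def h_def)
  also have "\<bar>\<dots>\<bar> \<le> \<bar>\<phi> 2 t\<bar>" by simp
  also have "\<dots> \<le> (\<Sum>i\<in>(UNIV::'n set). \<Sum>j\<in>(UNIV::'n set). norm h * (norm h * (c * (1 + (norm y + norm h) ^ s))))"
  proof -
    have "norm (y + t *\<^sub>R h) \<le> norm y + norm h"
      using t norm_triangle_ineq[of y "t *\<^sub>R h"] mult_left_le_one_le[of "norm h" t] by simp
    then have "norm (y + t *\<^sub>R h) ^ s \<le> (norm y + norm h) ^ s" by (intro power_mono) auto
    then have b: "\<bar>partial j (partial i g) (y + t *\<^sub>R h)\<bar> \<le> c * (1 + (norm y + norm h) ^ s)" for i j
      using c by (intro order_trans[OF bound] mult_left_mono) auto
    have "\<bar>\<phi> 2 t\<bar> = \<bar>\<Sum>i\<in>UNIV. \<Sum>j\<in>UNIV. h $ i * (h $ j * partial j (partial i g) (y + t *\<^sub>R h))\<bar>"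
      by (simp add: \<phi>_def sum_distrib_left)
    also have "\<dots> \<le> (\<Sum>i\<in>UNIV. \<bar>\<Sum>j\<in>UNIV. h $ i * (h $ j * partial j (partial i g) (y + t *\<^sub>R h))\<bar>)"
      by (rule sum_abs)
    also have "\<dots> \<le> (\<Sum>i\<in>UNIV. \<Sum>j\<in>UNIV. \<bar>h $ i * (h $ j * partial j (partial i g) (y + t *\<^sub>R h))\<bar>)"
      by (intro sum_mono sum_abs)
    also have "\<dots> \<le> (\<Sum>i\<in>(UNIV::'n set). \<Sum>j\<in>(UNIV::'n set). norm h * (norm h * (c * (1 + (norm y + norm h) ^ s))))"
      unfolding abs_mult by (intro sum_mono mult_mono b component_le_norm_cart) auto
    finally show ?thesis .
  qed
  also have "\<dots> = real CARD('n) ^ 2 * c * (1 + (norm y + norm (x - y)) ^ s) * (norm (x - y))\<^sup>2"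
    by (simp add: h_def power2_eq_square algebra_simps)
  finally show ?thesis .
qed

text \<open>Links the Jacobian of the linearised drift with the scalar partial derivatives in which
  smoothness and growth are stated.\<close>

lemma jacobian_component:
  fixes f :: "real ^ 'n::finite \<Rightarrow> real ^ 'n"
  assumes f: "\<And>d. C_class 2 (\<lambda>x. f x $ d)"
  shows "f differentiable (at y)"
    "(jacobian f (at y) *v h) $ d = frechet_derivative (\<lambda>x. f x $ d) (at y) h"
    "jacobian f (at y) $ d $ i = partial i (\<lambda>x. f x $ d) y"
proof -
  have "((\<lambda>x. f x) has_derivative (\<lambda>h. \<chi> d. frechet_derivative (\<lambda>x. f x $ d) (at y) h)) (at y)"
    unfolding has_derivative_componentwise_within[of f]
  proof
    fix b :: "real ^ 'n" assume "b \<in> Basis"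
    then obtain d where b: "b = axis d 1" by (auto simp: Basis_vec_def)
    show "((\<lambda>x. f x \<bullet> b) has_derivative (\<lambda>x. (\<chi> d. frechet_derivative (\<lambda>x. f x $ d) (at y) x) \<bullet> b)) (at y)"
      using C_class_2(1)[OF f[of d], of y] by (simp add: b inner_axis frechet_derivative_works)
  qed
  then show diff: "f differentiable (at y)" by (auto simp: differentiable_def)
  have "(f has_derivative (\<lambda>h. jacobian f (at y) *v h)) (at y)"
    using diff by (simp only: jacobian_works)
  from bounded_linear.has_derivative[OF bounded_linear_vec_nth this]
  have "((\<lambda>x. f x $ d) has_derivative (\<lambda>h. (jacobian f (at y) *v h) $ d)) (at y)" for d .
  then have comp: "(jacobian f (at y) *v h) $ d = frechet_derivative (\<lambda>x. f x $ d) (at y) h" for d h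
    using frechet_derivative_at by metis
  then show "(jacobian f (at y) *v h) $ d = frechet_derivative (\<lambda>x. f x $ d) (at y) h" .
  have "(jacobian f (at y) *v axis i 1) $ d = jacobian f (at y) $ d $ i"
    by (simp add: matrix_vector_mult_def axis_def if_distrib cong: if_cong)
  then show "jacobian f (at y) $ d $ i = partial i (\<lambda>x. f x $ d) y"
    unfolding comp by (simp add: partial_def)
qed

lemma continuous_on_jacobian:
  fixes f :: "real ^ 'n::finite \<Rightarrow> real ^ 'n"
  assumes f: "\<And>d. C_class 2 (\<lambda>x. f x $ d)"
  shows "continuous_on UNIV (\<lambda>y. jacobian f (at y) $ d $ i)" "continuous_on UNIV f"
  unfolding jacobian_component(3)[OF f]
  by (auto intro!: continuous_at_imp_continuous_on differentiable_imp_continuous_within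
     C_class_2(2)[OF f] jacobian_component(1)[OF f])

lemma continuous_on_jacobian_mult:
  fixes f :: "real ^ 'n::finite \<Rightarrow> real ^ 'n"
  assumes f: "\<And>d. C_class 2 (\<lambda>x. f x $ d)" and "continuous_on S m" "continuous_on S z"
  shows "continuous_on S (\<lambda>s. jacobian f (at (m s)) *v z s)"
  unfolding matrix_vector_mult_def using assms
  by (intro continuous_intros continuous_on_compose2[OF continuous_on_jacobian(1)[OF f]]) auto

lemma jacobian_bounded:
  fixes f :: "real ^ 'n::finite \<Rightarrow> real ^ 'n"
  assumes f: "\<And>d. C_class 2 (\<lambda>x. f x $ d)"
  obtains L where "L \<ge> 0" "\<And>y h. norm y \<le> R \<Longrightarrow> norm (jacobian f (at y) *v h) \<le> L * norm h"
proof -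
  define S where "S y = (\<Sum>d\<in>UNIV. \<Sum>i\<in>UNIV. \<bar>jacobian f (at y) $ d $ i\<bar>)" for y
  have "continuous_on (cball 0 R) S" unfolding S_def
    by (intro continuous_intros continuous_on_subset[OF continuous_on_jacobian(1)[OF f]]) auto
  then have "bounded (S ` cball 0 R)" by (intro compact_imp_bounded compact_continuous_image) auto
  then obtain L where L: "L > 0" "\<And>y. y \<in> cball 0 R \<Longrightarrow> norm (S y) \<le> L"
    by (auto simp: bounded_pos)
  show thesis
  proof
    show "L \<ge> 0" using L by simp
    fix y h :: "real ^ 'n" assume y: "norm y \<le> R"
    have "norm (jacobian f (at y) *v h) \<le> (\<Sum>d\<in>UNIV. \<bar>(jacobian f (at y) *v h) $ d\<bar>)" by (rule norm_le_l1_cart)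
    also have "\<dots> \<le> (\<Sum>d\<in>UNIV. \<Sum>i\<in>UNIV. \<bar>jacobian f (at y) $ d $ i\<bar> * norm h)"
    proof (rule sum_mono)
      fix d
      have "\<bar>(jacobian f (at y) *v h) $ d\<bar> \<le> (\<Sum>i\<in>UNIV. \<bar>jacobian f (at y) $ d $ i * h $ i\<bar>)"
        unfolding matrix_vector_mult_def by simp
      also have "\<dots> \<le> (\<Sum>i\<in>UNIV. \<bar>jacobian f (at y) $ d $ i\<bar> * norm h)"
        unfolding abs_mult by (intro sum_mono mult_left_mono component_le_norm_cart) auto
      finally show "\<bar>(jacobian f (at y) *v h) $ d\<bar> \<le> (\<Sum>i\<in>UNIV. \<bar>jacobian f (at y) $ d $ i\<bar> * norm h)" .
    qed
    also have "\<dots> = S y * norm h" by (simp add: S_def sum_distrib_right)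
    also have "\<dots> \<le> L * norm h" using L(2)[of y] y by (intro mult_right_mono) auto
    finally show "norm (jacobian f (at y) *v h) \<le> L * norm h" .
  qed
qed

text \<open>For y in a fixed ball the growth in |y| becomes a constant, which leaves a bound in r =
  |x - y| alone. When the remainder is squared, the powers r^2 and r^(s + 2) lead to moments of
  order 4 and 2s + 4.\<close>

lemma Taylor_remainder:
  fixes f :: "real ^ 'n::finite \<Rightarrow> real ^ 'n"
  assumes f: "\<And>d. C_class 2 (\<lambda>x. f x $ d)" and c: "c > 0"
    and bound: "\<And>d i j u. \<bar>partial i (partial j (\<lambda>x. f x $ d)) u\<bar> \<le> c * (1 + norm u ^ s)"
  obtains C where "C \<ge> 0" "\<And>x y. norm y \<le> R \<Longrightarrow>
    norm (f x - f y - jacobian f (at y) *v (x - y)) \<le> C * (norm (x - y) ^ 2 + norm (x - y) ^ (s + 2))"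
proof
  \<comment> \<open>The absolute value keeps the constants nonnegative for negative R too, where no
    y qualifies.\<close>
  define R' where "R' = \<bar>R\<bar>"
  \<comment> \<open>Two factors of the dimension come from the scalar remainder, the third from
    bounding the norm by the sum of the components.\<close>
  define C1 where "C1 = real CARD('n) ^ 3 * c"
  define C where "C = C1 * (1 + 2 ^ s * R' ^ s + 2 ^ s)"
  have C1: "C1 \<ge> 0" using c by (simp add: C1_def)
  then show "C \<ge> 0" by (simp add: C_def R'_def)
  fix x y :: "real ^ 'n" assume y: "norm y \<le> R"
  define r where "r = norm (x - y)"
  have r: "r \<ge> 0" by (simp add: r_def)
  have "norm (f x - f y - jacobian f (at y) *v (x - y))
      \<le> (\<Sum>d\<in>UNIV. \<bar>(f x - f y - jacobian f (at y) *v (x - y)) $ d\<bar>)" by (rule norm_le_l1_cart)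
  also have "\<dots> \<le> (\<Sum>d\<in>(UNIV::'n set). real CARD('n) ^ 2 * c * (1 + (norm y + r) ^ s) * r\<^sup>2)"
    unfolding r_def vector_minus_component jacobian_component(2)[OF f]
    by (intro sum_mono Taylor_remainder_scalar f c bound)
  also have "\<dots> = C1 * (1 + (norm y + r) ^ s) * r\<^sup>2" by (simp add: C1_def power3_eq_cube power2_eq_square)
  also have "\<dots> \<le> C1 * ((1 + 2 ^ s * R' ^ s + 2 ^ s) * (1 + r ^ s)) * r\<^sup>2"
  proof (intro mult_right_mono mult_left_mono C1)
    have "(norm y + r) ^ s \<le> (2 * max R' r) ^ s" using y r by (intro power_mono) (auto simp: R'_def)
    also have "\<dots> \<le> 2 ^ s * (R' ^ s + r ^ s)"
      unfolding power_mult_distrib using r by (intro mult_left_mono) (auto simp: max_def R'_def)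
    finally have "1 + (norm y + r) ^ s \<le> 1 + 2 ^ s * R' ^ s + 2 ^ s * r ^ s" by (simp add: algebra_simps)
    also have "\<dots> \<le> (1 + 2 ^ s * R' ^ s + 2 ^ s) * (1 + r ^ s)"
      using r by (simp add: algebra_simps R'_def)
    finally show "1 + (norm y + r) ^ s \<le> (1 + 2 ^ s * R' ^ s + 2 ^ s) * (1 + r ^ s)" .
  qed auto
  also have "\<dots> = C * (r ^ 2 + r ^ (s + 2))" by (simp add: C_def algebra_simps power_add power2_eq_square)
  finally show "norm (f x - f y - jacobian f (at y) *v (x - y)) \<le> C * (norm (x - y) ^ 2 + norm (x - y) ^ (s + 2))"
    by (simp add: r_def)
qed

text \<open>Taylor's bound at y plus the bound on the Jacobian; for |x - y| \<le> 1 both powers in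
  the remainder are at most |x - y|. The ball confines y, which is the exact path in the Euler
  argument, while x is the iterate near it.\<close>

lemma locally_Lipschitz:
  fixes f :: "real ^ 'n::finite \<Rightarrow> real ^ 'n"
  assumes f: "\<And>d. C_class 2 (\<lambda>x. f x $ d)" and c: "c > 0"
    and bound: "\<And>d i j u. \<bar>partial i (partial j (\<lambda>x. f x $ d)) u\<bar> \<le> c * (1 + norm u ^ s)"
  obtains L where "L \<ge> 0" "\<And>x y. norm y \<le> R \<Longrightarrow> norm (x - y) \<le> 1 \<Longrightarrow> norm (f x - f y) \<le> L * norm (x - y)"
proof -
  obtain C where C: "C \<ge> 0" "\<And>x y. norm y \<le> R \<Longrightarrow>
    norm (f x - f y - jacobian f (at y) *v (x - y)) \<le> C * (norm (x - y) ^ 2 + norm (x - y) ^ (s + 2))"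
    using Taylor_remainder[OF assms] by blast
  obtain L where L: "L \<ge> 0" "\<And>y h. norm y \<le> R \<Longrightarrow> norm (jacobian f (at y) *v h) \<le> L * norm h"
    using jacobian_bounded[OF f] by blast
  show thesis
  proof
    show "L + 2 * C \<ge> 0" using L C by simp
    fix x y :: "real ^ 'n" assume y: "norm y \<le> R" and xy: "norm (x - y) \<le> 1"
    define r where "r = norm (x - y)"
    have r: "0 \<le> r" "r \<le> 1" using xy by (auto simp: r_def)
    have rp: "r ^ Suc k \<le> r" for k using r power_decreasing[of 1 "Suc k" r] by simp
    have "r ^ 2 + r ^ (s + 2) \<le> 2 * r" using rp[of 1] rp[of "s + 1"] by (simp add: numeral_2_eq_2)
    then have "C * (r ^ 2 + r ^ (s + 2)) \<le> C * (2 * r)" using C by (intro mult_left_mono)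
    then have "norm (f x - f y - jacobian f (at y) *v (x - y)) \<le> C * (2 * r)"
      using C(2)[OF y, of x] by (simp add: r_def)
    moreover have "norm (f x - f y) \<le> norm (f x - f y - jacobian f (at y) *v (x - y)) + norm (jacobian f (at y) *v (x - y))"
      by norm
    ultimately show "norm (f x - f y) \<le> (L + 2 * C) * norm (x - y)"
      using L(2)[OF y, of "x - y"] by (simp add: r_def algebra_simps)
  qed
qed

section \<open>From Euler schemes to stochastic differential equations\<close>

lemma tendsto_fun_coordinatewise:
  fixes X :: "nat \<Rightarrow> nat \<Rightarrow> 'b::topological_space"
  assumes "\<And>i. (\<lambda>n. X n i) \<longlonglongrightarrow> l i"
  shows "X \<longlonglongrightarrow> l"
proof -
  have "limitin (product_topology (\<lambda>_. euclidean) UNIV) X l sequentially"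
    unfolding limitin_componentwise using assms by auto
  then show ?thesis by (simp add: euclidean_product_topology)
qed

text \<open>Restricted to {..<n} so that its values are points of the product space over
  {..<n}.\<close>

definition increments :: "(real \<Rightarrow> 'a \<Rightarrow> 'b::minus) \<Rightarrow> real \<Rightarrow> nat \<Rightarrow> 'a \<Rightarrow> nat \<Rightarrow> 'b" where
  "increments W \<Delta> n \<omega> = (\<lambda>j\<in>{..<n}. W (real (Suc j) * \<Delta>) \<omega> - W (real j * \<Delta>) \<omega>)"

lemma grid_points:
  assumes "n > 0" "real n * \<Delta> = T" "\<Delta> > 0" "j < n"
  shows "real j * \<Delta> \<in> {0..T}" "real (Suc j) * \<Delta> \<in> {0..T}" "real j * \<Delta> < real (Suc j) * \<Delta>"
proof -
  have "real (Suc j) * \<Delta> \<le> real n * \<Delta>" using assms by (intro mult_right_mono) auto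
  then show "real j * \<Delta> \<in> {0..T}" "real (Suc j) * \<Delta> \<in> {0..T}" "real j * \<Delta> < real (Suc j) * \<Delta>"
    using assms by (auto simp: algebra_simps)
qed

text \<open>The input of the scheme has a law determined by \<rho>, n and \<Delta>, which is how
  schemes on unrelated probability spaces become comparable. It is a product because the increments
  are a measurable function of the restricted Wiener path, which is independent of the initial
  value.\<close>

lemma joint_law_initial_increments:
  fixes W :: "real \<Rightarrow> 'a \<Rightarrow> real ^ 'n::finite"
  assumes T: "T > 0" and sol: "sde_solution T b S \<rho> M W X"
    and n: "n > 0" and \<Delta>: "real n * \<Delta> = T"
  shows "(\<lambda>\<omega>. (X \<omega> 0, increments W \<Delta> n \<omega>)) \<in> measurable M (borel \<Otimes>\<^sub>M PiM {..<n} (\<lambda>_. borel))"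
    "distr M (borel \<Otimes>\<^sub>M PiM {..<n} (\<lambda>_. borel)) (\<lambda>\<omega>. (X \<omega> 0, increments W \<Delta> n \<omega>))
       = \<rho> \<Otimes>\<^sub>M PiM {..<n} (\<lambda>_. gauss (sqrt \<Delta>))"
    "is_gaussian 0 (mat \<Delta>) (gauss (sqrt \<Delta>) :: (real ^ 'n) measure)"
proof -
  have \<Delta>0: "\<Delta> > 0" using \<Delta> T n by (metis mult.commute of_nat_0_less_iff zero_less_mult_pos)
  interpret prob_space M using sol by (simp add: sde_solution_def)
  have wp: "wiener_process T M W" and X: "X \<in> measurable M (path_space T)"
    and \<rho>: "distr M borel (\<lambda>\<omega>. X \<omega> 0) = \<rho>"
    and ind: "indep_set (sets (vimage_algebra (space M) (\<lambda>\<omega>. X \<omega> 0) borel))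
       (sets (vimage_algebra (space M) (\<lambda>\<omega>. \<lambda>t\<in>{0..T}. W t \<omega>) (PiM {0..T} (\<lambda>_. borel))))"
    using sol by (auto simp: sde_solution_def)
  have Wm: "W t \<in> borel_measurable M" if "t \<in> {0..T}" for t using wp that by (simp add: wiener_process_def)
  note grid = grid_points[OF n \<Delta> \<Delta>0]
  have X0[measurable]: "(\<lambda>\<omega>. X \<omega> 0) \<in> borel_measurable M"
    using T by (intro measurable_compose[OF X measurable_path_eval]) auto
  let ?P = "PiM {..<n} (\<lambda>_. borel :: (real ^ 'n) measure)"
  have incm: "(\<lambda>\<omega>. W (real (Suc j) * \<Delta>) \<omega> - W (real j * \<Delta>) \<omega>) \<in> borel_measurable M" if "j < n" for j
    using grid[OF that] by (intro borel_measurable_diff Wm) auto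
  have Dm[measurable]: "increments W \<Delta> n \<in> measurable M ?P"
    unfolding increments_def by (intro measurable_restrict incm) auto
  show XD[measurable]: "(\<lambda>\<omega>. (X \<omega> 0, increments W \<Delta> n \<omega>)) \<in> measurable M (borel \<Otimes>\<^sub>M ?P)" by measurable
  have gaussian: "is_gaussian 0 (mat \<Delta>) (distr M borel (\<lambda>\<omega>. W (real (Suc j) * \<Delta>) \<omega> - W (real j * \<Delta>) \<omega>))" if "j < n" for j
  proof -
    have "real (Suc j) * \<Delta> - real j * \<Delta> = \<Delta>" by (simp add: algebra_simps)
    then show ?thesis using wp grid[OF that] unfolding wiener_process_def by (metis atLeastAtMost_iff)
  qed
  have law: "distr M borel (\<lambda>\<omega>. W (real (Suc j) * \<Delta>) \<omega> - W (real j * \<Delta>) \<omega>) = gauss (sqrt \<Delta>)" if "j < n" for j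
    by (rule is_gaussian_mat_eq_gauss[OF gaussian[OF that] \<Delta>0])
  show "is_gaussian 0 (mat \<Delta>) (gauss (sqrt \<Delta>) :: (real ^ 'n) measure)"
    using gaussian[of 0] law[of 0] n by simp
  have iv: "indep_vars (\<lambda>_. borel) (\<lambda>j \<omega>. W (real (Suc j) * \<Delta>) \<omega> - W (real j * \<Delta>) \<omega>) {..<n}"
    using wp grid \<Delta> unfolding wiener_process_def
    by (elim conjE allE[of _ n] allE[of _ "\<lambda>j. real j * \<Delta>"]) auto
  have "distr M ?P (\<lambda>\<omega>. \<lambda>j\<in>{..<n}. W (real (Suc j) * \<Delta>) \<omega> - W (real j * \<Delta>) \<omega>)
      = PiM {..<n} (\<lambda>j. distr M borel (\<lambda>\<omega>. W (real (Suc j) * \<Delta>) \<omega> - W (real j * \<Delta>) \<omega>))"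
    using iv n incm by (subst (asm) indep_vars_iff_distr_eq_PiM') auto
  also have "\<dots> = PiM {..<n} (\<lambda>_. gauss (sqrt \<Delta>))" by (intro PiM_cong) (auto simp: law simp del: of_nat_Suc)
  finally have D_law: "distr M ?P (increments W \<Delta> n) = PiM {..<n} (\<lambda>_. gauss (sqrt \<Delta>))"
    by (simp add: increments_def[abs_def])
  interpret G: prob_space "gauss (sqrt \<Delta>) :: (real ^ 'n) measure" by (rule prob_space_gauss) (simp add: \<Delta>0)
  interpret PG: prob_space "PiM {..<n} (\<lambda>_. gauss (sqrt \<Delta>) :: (real ^ 'n) measure)"
    by (rule prob_space_PiM) (rule G.prob_space_axioms)
  interpret R: prob_space \<rho> unfolding \<rho>[symmetric] by (rule prob_space_distr) measurable
  have sets\<rho>[simp, measurable_cong]: "sets \<rho> = sets borel" unfolding \<rho>[symmetric] by simp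
  have setsPG[simp, measurable_cong]: "sets (PiM {..<n} (\<lambda>_. gauss (sqrt \<Delta>))) = sets ?P"
    by (intro sets_PiM_cong) auto
  show "distr M (borel \<Otimes>\<^sub>M ?P) (\<lambda>\<omega>. (X \<omega> 0, increments W \<Delta> n \<omega>)) = \<rho> \<Otimes>\<^sub>M PiM {..<n} (\<lambda>_. gauss (sqrt \<Delta>))"
  proof (rule pair_measure_eqI[symmetric])
    show "sets (\<rho> \<Otimes>\<^sub>M PiM {..<n} (\<lambda>_. gauss (sqrt \<Delta>)))
      = sets (distr M (borel \<Otimes>\<^sub>M ?P) (\<lambda>\<omega>. (X \<omega> 0, increments W \<Delta> n \<omega>)))"
      by (simp cong: sets_pair_measure_cong)
    fix A and B :: "(nat \<Rightarrow> real ^ 'n) set"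
    assume "A \<in> sets \<rho>" "B \<in> sets (PiM {..<n} (\<lambda>_. gauss (sqrt \<Delta>)))"
    then have A: "A \<in> sets borel" and B: "B \<in> sets ?P" by auto
    \<comment> \<open>\<open>d\<close> computes the increments from the restricted path
      \<open>Z\<close>, so every event about increments lies in the sigma-algebra generated by
      W.\<close>
    define d where "d p = (\<lambda>j\<in>{..<n}. p (real (Suc j) * \<Delta>) - p (real j * \<Delta>))" for p :: "real \<Rightarrow> real ^ 'n"
    define Z where "Z \<omega> = (\<lambda>t\<in>{0..T}. W t \<omega>)" for \<omega>
    have dm: "d \<in> measurable (PiM {0..T} (\<lambda>_. borel)) ?P"
      unfolding d_def using grid by (intro measurable_restrict borel_measurable_diff measurable_component_singleton) auto
    have Zsp: "Z \<in> space M \<rightarrow> space (PiM {0..T} (\<lambda>_. borel))" by (auto simp: Z_def space_PiM)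
    have dZ: "d (Z \<omega>) = increments W \<Delta> n \<omega>" for \<omega>
      unfolding d_def Z_def increments_def using grid by (intro restrict_ext) auto
    have 1: "(\<lambda>\<omega>. X \<omega> 0) -` A \<inter> space M \<in> sets (vimage_algebra (space M) (\<lambda>\<omega>. X \<omega> 0) borel)"
      by (rule in_vimage_algebra[OF A])
    have "Z -` (d -` B \<inter> space (PiM {0..T} (\<lambda>_. borel))) \<inter> space M \<in> sets (vimage_algebra (space M) Z (PiM {0..T} (\<lambda>_. borel)))"
      by (rule in_vimage_algebra[OF measurable_sets[OF dm B]])
    also have "Z -` (d -` B \<inter> space (PiM {0..T} (\<lambda>_. borel))) \<inter> space M = increments W \<Delta> n -` B \<inter> space M"
      using Zsp dZ by auto
    finally have 2: "increments W \<Delta> n -` B \<inter> space M \<in> sets (vimage_algebra (space M) (\<lambda>\<omega>. \<lambda>t\<in>{0..T}. W t \<omega>) (PiM {0..T} (\<lambda>_. borel)))"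
      unfolding Z_def[abs_def] .
    have "emeasure (distr M (borel \<Otimes>\<^sub>M ?P) (\<lambda>\<omega>. (X \<omega> 0, increments W \<Delta> n \<omega>))) (A \<times> B)
       = emeasure M (((\<lambda>\<omega>. X \<omega> 0) -` A \<inter> space M) \<inter> (increments W \<Delta> n -` B \<inter> space M))"
      using A B by (subst emeasure_distr) (auto intro!: arg_cong[where f="emeasure M"])
    also have "\<dots> = emeasure M ((\<lambda>\<omega>. X \<omega> 0) -` A \<inter> space M) * emeasure M (increments W \<Delta> n -` B \<inter> space M)"
      unfolding emeasure_eq_measure indep_setD[OF ind 1 2] by (simp add: ennreal_mult)
    also have "\<dots> = emeasure \<rho> A * emeasure (PiM {..<n} (\<lambda>_. gauss (sqrt \<Delta>))) B"
      unfolding \<rho>[symmetric] D_law[symmetric] using A B by (simp add: emeasure_distr)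
    finally show "emeasure \<rho> A * emeasure (PiM {..<n} (\<lambda>_. gauss (sqrt \<Delta>))) B
      = emeasure (distr M (borel \<Otimes>\<^sub>M ?P) (\<lambda>\<omega>. (X \<omega> 0, increments W \<Delta> n \<omega>))) (A \<times> B)" ..
  qed (rule prob_space_imp_sigma_finite, rule R.prob_space_axioms PG.prob_space_axioms)+
qed

lemma measurable_matrix_mult:
  fixes A :: "real ^ 'n::finite ^ 'n"
  assumes "f \<in> borel_measurable M" shows "(\<lambda>x. A *v f x) \<in> borel_measurable M"
  by (rule measurable_compose[OF assms], rule borel_measurable_continuous_onI)
    (intro linear_continuous_on matrix_vector_mul_bounded_linear)

lemma measurable_euler:
  fixes S :: "real ^ 'n::finite ^ 'n"
  assumes g: "\<And>t. continuous_on UNIV (g t)"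
    and h: "h \<in> borel_measurable N" and \<zeta>: "\<And>i. i < j \<Longrightarrow> (\<lambda>p. \<zeta> p i) \<in> borel_measurable N"
  shows "(\<lambda>p. euler \<Delta> g (h p) (\<lambda>i. S *v \<zeta> p i) j) \<in> borel_measurable N"
  using \<zeta>
proof (induction j)
  case 0
  then show ?case using h by simp
next
  case (Suc j)
  have [measurable]: "(\<lambda>p. euler \<Delta> g (h p) (\<lambda>i. S *v \<zeta> p i) j) \<in> borel_measurable N" using Suc by simp
  have [measurable]: "g t \<in> borel_measurable borel" for t by (rule borel_measurable_continuous_onI[OF g])
  have [measurable]: "(\<lambda>p. S *v \<zeta> p j) \<in> borel_measurable N" using Suc.prems by (intro measurable_matrix_mult) auto
  show ?case by simp
qed

text \<open>The chain rule across the initial value: for almost every x the inequality for shifted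
  noise bounds the conditional expectation by the conditional cost plus H x, and the dual bound for
  the initial laws is tested with H.\<close>

lemma discrete_entropy_bound:
  fixes S S' :: "real ^ 'n::finite ^ 'n" and \<phi> :: "(nat \<Rightarrow> real ^ 'n) \<Rightarrow> real"
  assumes nu: "prob_space \<nu>0" "sets \<nu>0 = sets borel" and mu: "prob_space \<mu>0" "sets \<mu>0 = sets borel"
    and K0: "entropy_bound K0 \<nu>0 \<mu>0"
    and P: "is_gaussian 0 (mat \<Delta>) P" and \<Delta>: "\<Delta> > 0"
    and S: "\<And>y. S *v (S' *v y) = y"
    and b: "\<And>t. continuous_on UNIV (b t)" and f: "\<And>t. continuous_on UNIV (f t)"
    and \<phi>: "\<phi> \<in> borel_measurable borel" "\<And>x. \<bar>\<phi> x\<bar> \<le> B" and k: "\<And>i. k i \<le> n"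
    and c: "c \<ge> 0" and cost: "(\<integral>\<^sup>+x. \<integral>\<^sup>+z. (\<Sum>j<n. ennreal ((norm (S' *v (\<Delta> *\<^sub>R
        (b (real j * \<Delta>) (euler \<Delta> b x (\<lambda>i. S *v z i) j) - f (real j * \<Delta>) (euler \<Delta> b x (\<lambda>i. S *v z i) j)))))\<^sup>2 / (2 * \<Delta>)))
        \<partial>PiM {..<n} (\<lambda>_. P) \<partial>\<nu>0) \<le> ennreal c"
  shows "(\<integral>x. \<integral>z. \<phi> (\<lambda>i. euler \<Delta> b x (\<lambda>i. S *v z i) (k i)) \<partial>PiM {..<n} (\<lambda>_. P) \<partial>\<nu>0)
     \<le> c + K0 + ln (\<integral>x. \<integral>z. exp (\<phi> (\<lambda>i. euler \<Delta> f x (\<lambda>i. S *v z i) (k i))) \<partial>PiM {..<n} (\<lambda>_. P) \<partial>\<mu>0)"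
proof -
  have ps: "prob_space P" and setsP: "sets P = sets borel" using P by (auto simp: is_gaussian_def)
  interpret P: prob_space P by fact
  interpret nu: prob_space \<nu>0 by fact
  interpret mu: prob_space \<mu>0 by fact
  define \<Gamma> where "\<Gamma> = PiM {..<n} (\<lambda>_. P)"
  interpret G: prob_space \<Gamma> unfolding \<Gamma>_def by (rule prob_space_PiM) (rule ps)
  have sets\<Gamma>[measurable_cong]: "sets \<Gamma> = sets (PiM {..<n} (\<lambda>_. borel))"
    unfolding \<Gamma>_def by (intro sets_PiM_cong) (auto simp: setsP)
  note [measurable_cong] = nu(2) mu(2)
  note [measurable] = \<phi>(1)
  have comp: "(\<lambda>z. z i) \<in> borel_measurable (PiM {..<j} (\<lambda>_. borel :: (real ^ 'n) measure))" if "i < j" for i j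
    using that by (intro measurable_component_singleton) auto
  have e\<Gamma>: "(\<lambda>z. euler \<Delta> g x (\<lambda>i. S *v z i) j) \<in> borel_measurable (PiM {..<m} (\<lambda>_. borel))"
    if "\<And>t. continuous_on UNIV (g t)" "j \<le> m" for g x j m
    using that by (intro measurable_euler comp) auto
  have ep: "(\<lambda>p. euler \<Delta> g (fst p) (\<lambda>i. S *v snd p i) j) \<in> borel_measurable (R \<Otimes>\<^sub>M \<Gamma>)"
    if "\<And>t. continuous_on UNIV (g t)" "j \<le> n" "sets R = sets borel" for g j R
  proof -
    have "(\<lambda>p. snd p i) \<in> borel_measurable (R \<Otimes>\<^sub>M \<Gamma>)" if "i < n" for i
      using comp[OF that] measurable_compose[OF measurable_snd, of "\<lambda>z. z i" \<Gamma> borel R]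
      by (simp add: measurable_cong_sets[OF sets\<Gamma> refl])
    moreover have "fst \<in> borel_measurable (R \<Otimes>\<^sub>M \<Gamma>)"
      using measurable_fst[of R \<Gamma>] by (simp add: measurable_cong_sets[OF refl that(3)])
    ultimately show ?thesis using that by (intro measurable_euler) auto
  qed
  have seq: "(\<lambda>p i. h i p) \<in> borel_measurable R" if "\<And>i. h i \<in> borel_measurable R" for h :: "nat \<Rightarrow> _ \<Rightarrow> real ^ 'n" and R
  proof -
    have "(\<lambda>p i. h i p) \<in> measurable R (PiM UNIV (\<lambda>_. borel))"
      by (rule measurable_PiM_single') (use that in \<open>auto simp: space_PiM\<close>)
    then show ?thesis by (simp add: measurable_cong_sets[OF refl sets_PiM_equal_borel])
  qed
  define F where "F x z = \<phi> (\<lambda>i. euler \<Delta> f x (\<lambda>i. S *v z i) (k i))" for x z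
  define FB where "FB x z = \<phi> (\<lambda>i. euler \<Delta> b x (\<lambda>i. S *v z i) (k i))" for x z
  have Fb: "\<bar>F x z\<bar> \<le> B" "\<bar>FB x z\<bar> \<le> B" for x z by (auto simp: F_def FB_def \<phi>(2))
  have Fz: "F x \<in> borel_measurable (PiM {..<n} (\<lambda>_. borel))" for x
    unfolding F_def by (intro measurable_compose[OF seq \<phi>(1)] e\<Gamma> f k)
  have Fm: "(\<lambda>p. F (fst p) (snd p)) \<in> borel_measurable (R \<Otimes>\<^sub>M \<Gamma>)"
    and FBm: "(\<lambda>p. FB (fst p) (snd p)) \<in> borel_measurable (R \<Otimes>\<^sub>M \<Gamma>)" if "sets R = sets borel" for R
    unfolding F_def FB_def by (intro measurable_compose[OF seq \<phi>(1)] ep f b k that)+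
  define H where "H x = ln (\<integral>z. exp (F x z) \<partial>\<Gamma>)" for x
  have F\<Gamma>: "F x \<in> borel_measurable \<Gamma>" for x using Fz by (simp add: measurable_cong_sets[OF sets\<Gamma> refl])
  have Hm: "H \<in> borel_measurable borel"
  proof -
    have "(\<lambda>p. exp (F (fst p) (snd p))) \<in> borel_measurable (borel \<Otimes>\<^sub>M \<Gamma>)" using Fm[of borel] by measurable
    then show ?thesis unfolding H_def
      by (intro borel_measurable_ln G.borel_measurable_lebesgue_integral) (simp add: case_prod_unfold)
  qed
  have Hb: "\<bar>H x\<bar> \<le> B" for x unfolding H_def by (rule G.abs_ln_integral_exp_le[OF F\<Gamma> Fb(1)])
  \<comment> \<open>Since \<open>S'\<close> is a right inverse of \<open>S\<close>, applying
    \<open>S\<close> to this shift gives \<Delta> (b - f); moving the increments by it makes the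
    scheme with drift f reproduce the one with drift b.\<close>
  define a where "a x j z = S' *v (\<Delta> *\<^sub>R
    (b (real j * \<Delta>) (euler \<Delta> b x (\<lambda>i. S *v z i) j) - f (real j * \<Delta>) (euler \<Delta> b x (\<lambda>i. S *v z i) j)))" for x j z
  have a_dep: "a x j z = a x j z'" if "\<And>i. i < j \<Longrightarrow> z i = z' i" for x j z z'
  proof -
    have "euler \<Delta> b x (\<lambda>i. S *v z i) j = euler \<Delta> b x (\<lambda>i. S *v z' i) j" using that by (intro euler_cong) auto
    then show ?thesis by (simp add: a_def)
  qed
  have gm: "g \<in> borel_measurable borel" if "continuous_on UNIV g" for g :: "real ^ 'n \<Rightarrow> real ^ 'n"
    using that by (rule borel_measurable_continuous_onI)
  have a_meas: "a x j \<in> borel_measurable (PiM {..<j} (\<lambda>_. borel))" for x j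
    unfolding a_def
    by (intro measurable_matrix_mult borel_measurable_scaleR borel_measurable_const borel_measurable_diff
      measurable_compose[OF e\<Gamma>[OF b order_refl] gm[OF b]] measurable_compose[OF e\<Gamma>[OF b order_refl] gm[OF f]])
  define C where "C x z = (\<Sum>j<n. ennreal ((norm (a x j z))\<^sup>2 / (2 * \<Delta>)))" for x z
  have am: "(\<lambda>p. a (fst p) j (snd p)) \<in> borel_measurable (\<nu>0 \<Otimes>\<^sub>M \<Gamma>)" if "j < n" for j
    unfolding a_def using that
    by (intro measurable_matrix_mult borel_measurable_scaleR borel_measurable_const borel_measurable_diff
      measurable_compose[OF ep[OF b _ nu(2)] gm[OF b]] measurable_compose[OF ep[OF b _ nu(2)] gm[OF f]]) auto
  have Cm: "(\<lambda>p. C (fst p) (snd p)) \<in> borel_measurable (\<nu>0 \<Otimes>\<^sub>M \<Gamma>)"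
    unfolding C_def
  proof (intro borel_measurable_sum)
    fix j assume "j \<in> {..<n}"
    then have [measurable]: "(\<lambda>p. a (fst p) j (snd p)) \<in> borel_measurable (\<nu>0 \<Otimes>\<^sub>M \<Gamma>)" using am by auto
    show "(\<lambda>p. ennreal ((norm (a (fst p) j (snd p)))\<^sup>2 / (2 * \<Delta>))) \<in> borel_measurable (\<nu>0 \<Otimes>\<^sub>M \<Gamma>)" by measurable
  qed
  define E where "E x = (\<integral>\<^sup>+z. C x z \<partial>\<Gamma>)" for x
  have Em[measurable]: "E \<in> borel_measurable \<nu>0"
    unfolding E_def using Cm by (intro G.borel_measurable_nn_integral) (simp add: case_prod_unfold)
  have costE: "(\<integral>\<^sup>+x. E x \<partial>\<nu>0) \<le> ennreal c"
    using cost by (simp add: E_def C_def a_def \<Gamma>_def)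
  \<comment> \<open>The conditional cost could be infinite for exceptional x; its integral is
    finite, so these form a null set.\<close>
  have finE: "AE x in \<nu>0. E x \<noteq> \<infinity>"
    using costE by (intro nn_integral_PInf_AE) (auto simp: top_unique)
  have eE: "AE x in \<nu>0. ennreal (enn2real (E x)) = E x"
    using finE by eventually_elim (auto simp: less_top)
  have iE: "integrable \<nu>0 (\<lambda>x. enn2real (E x))" and IE: "(\<integral>x. enn2real (E x) \<partial>\<nu>0) \<le> c"
  proof -
    have nn: "(\<integral>\<^sup>+x. ennreal (enn2real (E x)) \<partial>\<nu>0) \<le> ennreal c"
      using costE eE by (subst nn_integral_cong_AE[OF eE]) auto
    then show "integrable \<nu>0 (\<lambda>x. enn2real (E x))"
      by (intro integrableI_nonneg) (auto intro: order.strict_trans1)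
    have "(\<integral>x. enn2real (E x) \<partial>\<nu>0) = enn2real (\<integral>\<^sup>+x. ennreal (enn2real (E x)) \<partial>\<nu>0)"
      by (intro integral_eq_nn_integral) auto
    also have "\<dots> \<le> c" using nn c by (metis enn2real_ennreal enn2real_mono ennreal_less_top)
    finally show "(\<integral>x. enn2real (E x) \<partial>\<nu>0) \<le> c" .
  qed
  have step: "(\<integral>z. FB x z \<partial>\<Gamma>) \<le> enn2real (E x) + H x" if e: "ennreal (enn2real (E x)) = E x" for x
  proof -
    have "FB x z = F x (\<lambda>j\<in>{..<n}. z j + a x j z)" for z
    proof -
      have "euler \<Delta> b x (\<lambda>i. S *v z i) j = euler \<Delta> f x (\<lambda>i. S *v (\<lambda>j\<in>{..<n}. z j + a x j z) i) j" if "j \<le> n" for j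
      proof -
        have "euler \<Delta> b x (\<lambda>i. S *v z i) j = euler \<Delta> f x (\<lambda>i. S *v z i + S *v a x i z) j"
          by (subst euler_change_drift[of _ _ _ _ _ f]) (simp add: a_def S)
        also have "\<dots> = euler \<Delta> f x (\<lambda>i. S *v (\<lambda>j\<in>{..<n}. z j + a x j z) i) j"
          using that by (intro euler_cong) (simp add: matrix_vector_right_distrib)
        finally show ?thesis .
      qed
      then show ?thesis using k by (simp add: FB_def F_def)
    qed
    then have "(\<integral>z. FB x z \<partial>\<Gamma>) = (\<integral>z. F x (\<lambda>j\<in>{..<n}. z j + a x j z) \<partial>\<Gamma>)" by simp
    also have "\<dots> \<le> enn2real (E x) + ln (\<integral>z. exp (F x z) \<partial>\<Gamma>)"
      unfolding \<Gamma>_def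
      by (rule triangular_shift_entropy[OF P \<Delta> a_meas a_dep Fz Fb(1)])
        (use e in \<open>auto simp: E_def C_def \<Gamma>_def\<close>)
    finally show ?thesis by (simp add: H_def)
  qed
  have H\<nu>: "integrable \<nu>0 H" by (rule nu.integrable_bounded[OF _ Hb]) (use Hm in measurable)
  have "(\<integral>x. \<integral>z. FB x z \<partial>\<Gamma> \<partial>\<nu>0) \<le> (\<integral>x. enn2real (E x) + H x \<partial>\<nu>0)"
  proof (rule integral_mono_AE)
    show "integrable \<nu>0 (\<lambda>x. \<integral>z. FB x z \<partial>\<Gamma>)"
    proof (rule nu.integrable_const_bound[where B=B])
      show "(\<lambda>x. \<integral>z. FB x z \<partial>\<Gamma>) \<in> borel_measurable \<nu>0"
        using FBm[OF nu(2)] by (intro G.borel_measurable_lebesgue_integral) (simp add: case_prod_unfold)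
      have "norm (\<integral>z. FB x z \<partial>\<Gamma>) \<le> B" if "x \<in> space \<nu>0" for x
      proof -
        have m: "FB x \<in> borel_measurable \<Gamma>"
          using measurable_compose[OF measurable_Pair1'[OF that, of \<Gamma>] FBm[OF nu(2)]] by simp
        have "(\<integral>z. norm (FB x z) \<partial>\<Gamma>) \<le> (\<integral>z. B \<partial>\<Gamma>)"
          using G.integrable_bounded[OF m Fb(2)] Fb(2) by (intro integral_mono) auto
        then have "(\<integral>z. norm (FB x z) \<partial>\<Gamma>) \<le> B" by (simp add: G.prob_space)
        then show ?thesis by (rule order_trans[OF integral_norm_bound])
      qed
      then show "AE x in \<nu>0. norm (\<integral>z. FB x z \<partial>\<Gamma>) \<le> B" by (auto intro: AE_I2)
    qed
    show "AE x in \<nu>0. (\<integral>z. FB x z \<partial>\<Gamma>) \<le> enn2real (E x) + H x"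
      using eE by eventually_elim (rule step)
  qed (use iE H\<nu> in auto)
  also have "\<dots> = (\<integral>x. enn2real (E x) \<partial>\<nu>0) + (\<integral>x. H x \<partial>\<nu>0)" using iE H\<nu> by simp
  also have "\<dots> \<le> c + (K0 + ln (\<integral>x. exp (H x) \<partial>\<mu>0))"
  proof (intro add_mono IE)
    have "H \<in> borel_measurable \<mu>0" using Hm by measurable
    then show "(\<integral>x. H x \<partial>\<nu>0) \<le> K0 + ln (\<integral>x. exp (H x) \<partial>\<mu>0)"
      using K0 Hb unfolding entropy_bound_def by blast
  qed
  also have "(\<integral>x. exp (H x) \<partial>\<mu>0) = (\<integral>x. \<integral>z. exp (F x z) \<partial>\<Gamma> \<partial>\<mu>0)"
    unfolding H_def using G.integral_exp_bounded_pos[OF F\<Gamma> Fb(1)] by simp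
  finally show ?thesis by (simp add: FB_def F_def \<Gamma>_def)
qed

text \<open>Convergence in the space of sequences is coordinatewise, which is enough for a
  continuous functional of all samples at once; its bound dominates.\<close>

lemma (in prob_space) tendsto_expectation_bounded_continuous:
  fixes \<phi> :: "(nat \<Rightarrow> real ^ 'n::finite) \<Rightarrow> real"
  assumes \<phi>: "continuous_on UNIV \<phi>" and B: "\<And>x. \<bar>\<phi> x\<bar> \<le> B"
    and Xm: "\<And>n. (\<lambda>\<omega>. \<phi> (X n \<omega>)) \<in> borel_measurable M" "(\<lambda>\<omega>. \<phi> (Y \<omega>)) \<in> borel_measurable M"
    and lim: "AE \<omega> in M. \<forall>i. (\<lambda>n. X n \<omega> i) \<longlonglongrightarrow> Y \<omega> i"
  shows "(\<lambda>n. \<integral>\<omega>. \<phi> (X n \<omega>) \<partial>M) \<longlonglongrightarrow> (\<integral>\<omega>. \<phi> (Y \<omega>) \<partial>M)"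
proof (rule integral_dominated_convergence[where w="\<lambda>_. B"])
  show "AE \<omega> in M. (\<lambda>n. \<phi> (X n \<omega>)) \<longlonglongrightarrow> \<phi> (Y \<omega>)"
    using lim
  proof eventually_elim
    case (elim \<omega>)
    then have "(\<lambda>n. X n \<omega>) \<longlonglongrightarrow> Y \<omega>" by (intro tendsto_fun_coordinatewise) auto
    then show ?case using \<phi> by (intro isCont_tendsto_compose[of _ \<phi>]) (auto simp: continuous_on_eq_continuous_at)
  qed
qed (use Xm B in auto)

text \<open>With additive noise the equation is, for almost every \<omega>, an integral equation
  perturbed by \<open>S *v W t \<omega>\<close>, so the deterministic convergence applies. R bounds
  the path of this \<omega>, and the Lipschitz constant may depend on it. \<open>Suc n\<close>
  avoids the step size T/0.\<close>

lemma sde_euler_tendsto: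
  fixes W :: "real \<Rightarrow> 'a \<Rightarrow> real ^ 'n::finite"
  assumes T: "T > 0" and sol: "sde_solution T b S \<rho> M W X"
    and b: "\<And>h. continuous_on {0..T} h \<Longrightarrow> continuous_on {0..T} (\<lambda>s. b s (h s))"
    and lip: "\<And>R. \<exists>L\<ge>0. \<forall>t\<in>{0..T}. \<forall>x y. norm y \<le> R \<longrightarrow> norm (x - y) \<le> 1 \<longrightarrow> norm (b t x - b t y) \<le> L * norm (x - y)"
  shows "AE \<omega> in M. \<forall>i. (\<lambda>n. euler (T / real (Suc n)) b (X \<omega> 0)
     (\<lambda>i. S *v increments W (T / real (Suc n)) (Suc n) \<omega> i) (grid_index T (Suc n) (rational_time T i)))
      \<longlonglongrightarrow> sample_path T (X \<omega>) i"
proof -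
  have Xm: "X \<in> measurable M (path_space T)" using sol by (simp add: sde_solution_def)
  have path: "continuous_on {0..T} (X \<omega>)" if "\<omega> \<in> space M" for \<omega>
    using measurable_space[OF Xm that] by (simp add: space_path_space mspace_path_metric)
  have "AE \<omega> in M. \<forall>t\<in>{0..T}. X \<omega> t = X \<omega> 0 + integral {0..t} (\<lambda>s. b s (X \<omega> s)) + S *v W t \<omega>"
    using sol by (auto simp: sde_solution_def)
  then show ?thesis using AE_space
  proof eventually_elim
    case (elim \<omega>)
    define y w where "y = X \<omega>" and "w t = S *v W t \<omega>" for t
    have y: "continuous_on {0..T} y" using path[OF elim(2)] by (simp add: y_def)
    have "bounded (y ` {0..T})" using y by (intro compact_imp_bounded compact_continuous_image) auto
    then obtain R where "\<forall>x\<in>y ` {0..T}. norm x \<le> R" unfolding bounded_iff by blast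
    then have R: "\<And>t. t \<in> {0..T} \<Longrightarrow> norm (y t) \<le> R" by blast
    obtain L where L: "L \<ge> 0" "\<And>t x y. t \<in> {0..T} \<Longrightarrow> norm y \<le> R \<Longrightarrow> norm (x - y) \<le> 1 \<Longrightarrow> norm (b t x - b t y) \<le> L * norm (x - y)"
      using lip[of R] by blast
    show ?case
    proof
      fix i
      have q: "rational_time T i \<in> {0..T}" by (rule rational_time_in[OF T])
      have "(\<lambda>n. euler (T / real n) b (y 0) (\<lambda>j. w (real (Suc j) * (T / real n)) - w (real j * (T / real n)))
          (grid_index T n (rational_time T i))) \<longlonglongrightarrow> y (rational_time T i)"
      proof (rule euler_tendsto[where g=b and y=y and w=w, OF T L(1) _ b[OF y] _ y q])
        fix t assume t: "t \<in> {0..T}"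
        show "y t = y 0 + integral {0..t} (\<lambda>s. b s (y s)) + w t"
          using elim(1) t unfolding y_def w_def by blast
        fix x assume "norm (x - y t) \<le> 1"
        then show "norm (b t x - b t (y t)) \<le> L * norm (x - y t)" by (rule L(2)[OF t R[OF t]])
      qed
      from LIMSEQ_Suc[OF this]
      have "(\<lambda>n. euler (T / real (Suc n)) b (y 0) (\<lambda>j. w (real (Suc j) * (T / real (Suc n))) - w (real j * (T / real (Suc n))))
          (grid_index T (Suc n) (rational_time T i))) \<longlonglongrightarrow> y (rational_time T i)" .
      moreover have "euler (T / real (Suc n)) b (y 0) (\<lambda>j. w (real (Suc j) * (T / real (Suc n))) - w (real j * (T / real (Suc n))))
          (grid_index T (Suc n) (rational_time T i)) = euler (T / real (Suc n)) b (X \<omega> 0)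
     (\<lambda>i. S *v increments W (T / real (Suc n)) (Suc n) \<omega> i) (grid_index T (Suc n) (rational_time T i))" for n
        unfolding y_def
      proof (rule euler_cong)
        fix j assume "j < grid_index T (Suc n) (rational_time T i)"
        then have "j < Suc n" using grid_index(1)[OF T q, of "Suc n"] by linarith
        then show "w (real (Suc j) * (T / real (Suc n))) - w (real j * (T / real (Suc n)))
          = S *v increments W (T / real (Suc n)) (Suc n) \<omega> j"
          by (simp add: w_def increments_def matrix_vector_mult_diff_distrib del: of_nat_Suc)
      qed
      ultimately show "(\<lambda>n. euler (T / real (Suc n)) b (X \<omega> 0)
     (\<lambda>i. S *v increments W (T / real (Suc n)) (Suc n) \<omega> i) (grid_index T (Suc n) (rational_time T i)))
      \<longlonglongrightarrow> sample_path T (X \<omega>) i" by (simp add: sample_path_def y_def)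
    qed
  qed
qed

lemma euler_functional_measurable:
  fixes \<phi> :: "(nat \<Rightarrow> real ^ 'n::finite) \<Rightarrow> real" and S :: "real ^ 'n ^ 'n"
  assumes "\<phi> \<in> borel_measurable borel" "\<And>t. continuous_on UNIV (b t)" "\<And>i. k i \<le> n"
  shows "(\<lambda>p. \<phi> (\<lambda>i. euler \<Delta> b (fst p) (\<lambda>j. S *v snd p j) (k i)))
     \<in> borel_measurable (borel \<Otimes>\<^sub>M PiM {..<n} (\<lambda>_. borel))"
proof -
  have "(\<lambda>p i. euler \<Delta> b (fst p) (\<lambda>j. S *v snd p j) (k i))
      \<in> measurable (borel \<Otimes>\<^sub>M PiM {..<n} (\<lambda>_. borel)) (PiM UNIV (\<lambda>_. borel))"
  proof (rule measurable_PiM_single')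
    fix i
    show "(\<lambda>p. euler \<Delta> b (fst p) (\<lambda>j. S *v snd p j) (k i)) \<in> borel_measurable (borel \<Otimes>\<^sub>M PiM {..<n} (\<lambda>_. borel))"
    proof (rule measurable_euler[OF assms(2)])
      fix j assume "j < k i"
      then have "j < n" using assms(3)[of i] by linarith
      then show "(\<lambda>p. snd p j) \<in> borel_measurable (borel \<Otimes>\<^sub>M PiM {..<n} (\<lambda>_. borel))"
        by (intro measurable_compose[OF measurable_snd measurable_component_singleton]) auto
    qed simp
  qed (auto simp: space_PiM)
  then show ?thesis
    by (intro measurable_compose[OF _ assms(1)]) (simp add: measurable_cong_sets[OF refl sets_PiM_equal_borel])
qed

text \<open>The grid inequality is passed to the limit for bounded continuous functionals of the
  rational samples. The cost is required only up to \<eta> and on fine grids, which leaves room for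
  the discretisation error of the noise-free scheme.\<close>

lemma sde_entropy_bound:
  fixes W :: "real \<Rightarrow> 'a \<Rightarrow> real ^ 'n::finite" and B :: "real \<Rightarrow> 'b \<Rightarrow> real ^ 'n" and S S' :: "real ^ 'n ^ 'n"
  assumes T: "T > 0"
    and v: "sde_solution T f S \<mu>0 M W v" and l: "sde_solution T b S \<nu>0 N B l"
    and K0: "entropy_bound K0 \<nu>0 \<mu>0" and S: "\<And>y. S *v (S' *v y) = y"
    and b: "\<And>h. continuous_on {0..T} h \<Longrightarrow> continuous_on {0..T} (\<lambda>s. b s (h s))" "\<And>t. continuous_on UNIV (b t)"
    and f: "\<And>h. continuous_on {0..T} h \<Longrightarrow> continuous_on {0..T} (\<lambda>s. f s (h s))" "\<And>t. continuous_on UNIV (f t)"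
    and lip_b: "\<And>R. \<exists>L\<ge>0. \<forall>t\<in>{0..T}. \<forall>x y. norm y \<le> R \<longrightarrow> norm (x - y) \<le> 1 \<longrightarrow> norm (b t x - b t y) \<le> L * norm (x - y)"
    and lip_f: "\<And>R. \<exists>L\<ge>0. \<forall>t\<in>{0..T}. \<forall>x y. norm y \<le> R \<longrightarrow> norm (x - y) \<le> 1 \<longrightarrow> norm (f t x - f t y) \<le> L * norm (x - y)"
    and c: "c \<ge> 0"
    and cost: "\<And>\<eta>. \<eta> > 0 \<Longrightarrow> \<forall>\<^sub>F n in sequentially.
      (\<integral>\<^sup>+\<omega>. (\<Sum>j<Suc n. ennreal ((norm (S' *v ((T / real (Suc n)) *\<^sub>R
        (b (real j * (T / real (Suc n))) (euler (T / real (Suc n)) b (l \<omega> 0) (\<lambda>i. S *v increments B (T / real (Suc n)) (Suc n) \<omega> i) j)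
       - f (real j * (T / real (Suc n))) (euler (T / real (Suc n)) b (l \<omega> 0) (\<lambda>i. S *v increments B (T / real (Suc n)) (Suc n) \<omega> i) j)))))\<^sup>2
        / (2 * (T / real (Suc n))))) \<partial>N) \<le> ennreal (c + \<eta>)"
  shows "entropy_bound (c + K0) (distr N (path_space T) l) (distr M (path_space T) v)"
proof -
  interpret N: prob_space N using l by (simp add: sde_solution_def)
  interpret M: prob_space M using v by (simp add: sde_solution_def)
  have lm[measurable]: "l \<in> measurable N (path_space T)" and vm[measurable]: "v \<in> measurable M (path_space T)"
    using l v by (auto simp: sde_solution_def)
  have l0[measurable]: "(\<lambda>\<omega>. l \<omega> 0) \<in> borel_measurable N" and v0[measurable]: "(\<lambda>\<omega>. v \<omega> 0) \<in> borel_measurable M"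
    using T by (auto intro!: measurable_compose[OF lm measurable_path_eval] measurable_compose[OF vm measurable_path_eval])
  have \<nu>0: "\<nu>0 = distr N borel (\<lambda>\<omega>. l \<omega> 0)" and \<mu>0: "\<mu>0 = distr M borel (\<lambda>\<omega>. v \<omega> 0)"
    using l v by (auto simp: sde_solution_def)
  have ps\<nu>: "prob_space \<nu>0" "sets \<nu>0 = sets borel" unfolding \<nu>0 by (auto intro!: N.prob_space_distr)
  have ps\<mu>: "prob_space \<mu>0" "sets \<mu>0 = sets borel" unfolding \<mu>0 by (auto intro!: M.prob_space_distr)
  have sm[measurable]: "sample_path T \<in> borel_measurable (path_space T)" by (rule measurable_sample_path[OF T])
  show ?thesis
  proof (rule entropy_bound_from_continuous[where J="sample_path T"])
    show "prob_space (distr N (path_space T) l)" "prob_space (distr M (path_space T) v)"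
      by (auto intro!: N.prob_space_distr M.prob_space_distr)
    show "sets (distr N (path_space T) l) = sets (distr M (path_space T) v)" by simp
    show "sample_path T \<in> borel_measurable (distr M (path_space T) v)" by simp
    fix A assume "A \<in> sets (distr M (path_space T) v)"
    then show "\<exists>A'\<in>sets borel. A = sample_path T -` A' \<inter> space (distr M (path_space T) v)"
      using path_space_sets_from_samples[OF T, of A] by simp
  next
    fix \<phi> :: "(nat \<Rightarrow> real ^ 'n) \<Rightarrow> real" and D
    assume \<phi>: "continuous_on UNIV \<phi>" "\<And>x. \<bar>\<phi> x\<bar> \<le> D"
    have \<phi>m[measurable]: "\<phi> \<in> borel_measurable borel" by (rule borel_measurable_continuous_onI[OF \<phi>(1)])
    have \<phi>e: "continuous_on UNIV (\<lambda>x. exp (\<phi> x))" by (intro continuous_intros \<phi>)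
    have \<phi>eb: "\<bar>exp (\<phi> x)\<bar> \<le> exp D" for x using \<phi>(2)[of x] by auto
    have \<phi>em: "(\<lambda>x. exp (\<phi> x)) \<in> borel_measurable borel" by measurable
    define \<Delta> where "\<Delta> n = T / real (Suc n)" for n
    define k where "k n i = grid_index T (Suc n) (rational_time T i)" for n i
    have kn: "k n i \<le> Suc n" for n i unfolding k_def by (rule grid_index(1)[OF T rational_time_in[OF T]])
    have \<Delta>0: "\<Delta> n > 0" and \<Delta>n: "real (Suc n) * \<Delta> n = T" for n using T by (auto simp: \<Delta>_def)
    define X where "X n \<omega> i = euler (\<Delta> n) b (l \<omega> 0) (\<lambda>i. S *v increments B (\<Delta> n) (Suc n) \<omega> i) (k n i)" for n \<omega> i
    define Y where "Y n \<omega> i = euler (\<Delta> n) f (v \<omega> 0) (\<lambda>i. S *v increments W (\<Delta> n) (Suc n) \<omega> i) (k n i)" for n \<omega> i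
    note jl = joint_law_initial_increments[OF T l zero_less_Suc \<Delta>n]
    note jv = joint_law_initial_increments[OF T v zero_less_Suc \<Delta>n]
    define \<Gamma> where "\<Gamma> n = PiM {..<Suc n} (\<lambda>_. gauss (sqrt (\<Delta> n)) :: (real ^ 'n) measure)" for n
    have ps\<Gamma>: "prob_space (\<Gamma> n)" for n
      unfolding \<Gamma>_def by (rule prob_space_PiM) (auto intro!: prob_space_gauss simp: \<Delta>0)
    have sets\<Gamma>: "sets (\<Gamma> n) = sets (PiM {..<Suc n} (\<lambda>_. borel))" for n
      unfolding \<Gamma>_def by (intro sets_PiM_cong) auto
    \<comment> \<open>Identifies the iterated integral over initial law and Gaussian product, the
      form of the grid inequality, with an expectation on the probability space of the equation. It
      is used once for \<open>l\<close> and once for \<open>v\<close>.\<close>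
    have real_transfer: "(\<integral>x. \<integral>z. \<Phi> (x, z) \<partial>\<Gamma> n \<partial>\<rho>) = (\<integral>\<omega>. \<Phi> (I \<omega>) \<partial>R)"
      if R: "distr R (borel \<Otimes>\<^sub>M PiM {..<Suc n} (\<lambda>_. borel)) I = \<rho> \<Otimes>\<^sub>M \<Gamma> n"
        "I \<in> measurable R (borel \<Otimes>\<^sub>M PiM {..<Suc n} (\<lambda>_. borel))" "prob_space \<rho>" "sets \<rho> = sets borel"
        and \<Phi>: "\<Phi> \<in> borel_measurable (borel \<Otimes>\<^sub>M PiM {..<Suc n} (\<lambda>_. borel))" "\<And>p. \<bar>\<Phi> p\<bar> \<le> d"
      for R :: "'c measure" and I \<rho> n d and \<Phi> :: "_ \<Rightarrow> real"
    proof -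
      interpret \<rho>: prob_space \<rho> by fact
      interpret G: prob_space "\<Gamma> n" by (rule ps\<Gamma>)
      interpret pair_prob_space \<rho> "\<Gamma> n" ..
      have s: "sets (\<rho> \<Otimes>\<^sub>M \<Gamma> n) = sets (borel \<Otimes>\<^sub>M PiM {..<Suc n} (\<lambda>_. borel))"
        by (intro sets_pair_measure_cong R sets\<Gamma>)
      have "\<Phi> \<in> borel_measurable (\<rho> \<Otimes>\<^sub>M \<Gamma> n)" using \<Phi>(1) by (simp add: measurable_cong_sets[OF s refl])
      then have "integrable (\<rho> \<Otimes>\<^sub>M \<Gamma> n) \<Phi>" using \<Phi>(2) by (rule integrable_bounded)
      then have "(\<integral>x. \<integral>z. \<Phi> (x, z) \<partial>\<Gamma> n \<partial>\<rho>) = (\<integral>p. \<Phi> p \<partial>(\<rho> \<Otimes>\<^sub>M \<Gamma> n))" by (rule integral_fst')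
      also have "\<dots> = (\<integral>\<omega>. \<Phi> (I \<omega>) \<partial>R)" unfolding R(1)[symmetric] using R(2) \<Phi>(1) by (rule integral_distr)
      finally show ?thesis .
    qed
    have Xm: "(\<lambda>\<omega>. \<phi> (X n \<omega>)) \<in> borel_measurable N" for n
      using measurable_compose[OF jl(1) euler_functional_measurable[where b=b and k="k n" and \<Delta>="\<Delta> n" and S=S, OF \<phi>m b(2) kn]] by (simp add: X_def[abs_def])
    have Ym: "(\<lambda>\<omega>. exp (\<phi> (Y n \<omega>))) \<in> borel_measurable M" for n
      using measurable_compose[OF jv(1) euler_functional_measurable[where b=f and k="k n" and \<Delta>="\<Delta> n" and S=S, OF \<phi>em f(2) kn]] by (simp add: Y_def[abs_def])
    have limX: "(\<lambda>n. \<integral>\<omega>. \<phi> (X n \<omega>) \<partial>N) \<longlonglongrightarrow> (\<integral>\<omega>. \<phi> (sample_path T (l \<omega>)) \<partial>N)"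
    proof (rule N.tendsto_expectation_bounded_continuous[OF \<phi> Xm])
      show "AE \<omega> in N. \<forall>i. (\<lambda>n. X n \<omega> i) \<longlonglongrightarrow> sample_path T (l \<omega>) i"
        unfolding X_def \<Delta>_def k_def by (rule sde_euler_tendsto[OF T l b(1) lip_b])
    qed measurable
    have limY: "(\<lambda>n. \<integral>\<omega>. exp (\<phi> (Y n \<omega>)) \<partial>M) \<longlonglongrightarrow> (\<integral>\<omega>. exp (\<phi> (sample_path T (v \<omega>))) \<partial>M)"
    proof (rule M.tendsto_expectation_bounded_continuous[OF \<phi>e \<phi>eb Ym])
      show "AE \<omega> in M. \<forall>i. (\<lambda>n. Y n \<omega> i) \<longlonglongrightarrow> sample_path T (v \<omega>) i"
        unfolding Y_def \<Delta>_def k_def by (rule sde_euler_tendsto[OF T v f(1) lip_f])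
    qed measurable
    have posY: "0 < (\<integral>\<omega>. exp (\<phi> (sample_path T (v \<omega>))) \<partial>M)"
      by (rule M.integral_exp_bounded_pos[OF _ \<phi>(2)]) measurable
    have "(\<integral>\<omega>. \<phi> (sample_path T (l \<omega>)) \<partial>N) \<le> c + K0 + ln (\<integral>\<omega>. exp (\<phi> (sample_path T (v \<omega>))) \<partial>M)"
    proof (rule field_le_epsilon)
      fix \<eta> :: real assume \<eta>: "\<eta> > 0"
      have "\<forall>\<^sub>F n in sequentially. (\<integral>\<omega>. \<phi> (X n \<omega>) \<partial>N) \<le> (c + \<eta>) + K0 + ln (\<integral>\<omega>. exp (\<phi> (Y n \<omega>)) \<partial>M)"
        using cost[OF \<eta>]
      proof eventually_elim
        case (elim n)
        define Q where "Q x z = (\<Sum>j<Suc n. ennreal ((norm (S' *v (\<Delta> n *\<^sub>R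
        (b (real j * \<Delta> n) (euler (\<Delta> n) b x (\<lambda>i. S *v z i) j) - f (real j * \<Delta> n) (euler (\<Delta> n) b x (\<lambda>i. S *v z i) j)))))\<^sup>2 / (2 * \<Delta> n)))"
          for x z
        interpret \<rho>: prob_space \<nu>0 by (rule ps\<nu>)
        interpret G: prob_space "\<Gamma> n" by (rule ps\<Gamma>)
        interpret pair_prob_space \<nu>0 "\<Gamma> n" ..
        have s: "sets (\<nu>0 \<Otimes>\<^sub>M \<Gamma> n) = sets (borel \<Otimes>\<^sub>M PiM {..<Suc n} (\<lambda>_. borel))"
          by (intro sets_pair_measure_cong ps\<nu> sets\<Gamma>)
        have Qm: "(\<lambda>p. Q (fst p) (snd p)) \<in> borel_measurable (borel \<Otimes>\<^sub>M PiM {..<Suc n} (\<lambda>_. borel))"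
          unfolding Q_def
        proof (intro borel_measurable_sum)
          fix j assume j: "j \<in> {..<Suc n}"
          have e: "(\<lambda>p. euler (\<Delta> n) b (fst p) (\<lambda>i. S *v snd p i) j)
              \<in> borel_measurable (borel \<Otimes>\<^sub>M PiM {..<Suc n} (\<lambda>_. borel))"
          proof (rule measurable_euler[OF b(2)])
            fix i assume "i < j"
            then show "(\<lambda>p. snd p i) \<in> borel_measurable (borel \<Otimes>\<^sub>M PiM {..<Suc n} (\<lambda>_. borel))"
              using j by (intro measurable_compose[OF measurable_snd measurable_component_singleton]) auto
          qed simp
          have [measurable]: "(\<lambda>p. S' *v (\<Delta> n *\<^sub>R (b (real j * \<Delta> n) (euler (\<Delta> n) b (fst p) (\<lambda>i. S *v snd p i) j)
              - f (real j * \<Delta> n) (euler (\<Delta> n) b (fst p) (\<lambda>i. S *v snd p i) j))))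
              \<in> borel_measurable (borel \<Otimes>\<^sub>M PiM {..<Suc n} (\<lambda>_. borel))"
            by (intro measurable_matrix_mult borel_measurable_scaleR borel_measurable_const borel_measurable_diff
              measurable_compose[OF e borel_measurable_continuous_onI[OF b(2)]]
              measurable_compose[OF e borel_measurable_continuous_onI[OF f(2)]])
          show "(\<lambda>p. ennreal ((norm (S' *v (\<Delta> n *\<^sub>R (b (real j * \<Delta> n) (euler (\<Delta> n) b (fst p) (\<lambda>i. S *v snd p i) j)
              - f (real j * \<Delta> n) (euler (\<Delta> n) b (fst p) (\<lambda>i. S *v snd p i) j)))))\<^sup>2 / (2 * \<Delta> n)))
              \<in> borel_measurable (borel \<Otimes>\<^sub>M PiM {..<Suc n} (\<lambda>_. borel))" by measurable
        qed
        have "(\<integral>\<^sup>+x. \<integral>\<^sup>+z. Q x z \<partial>\<Gamma> n \<partial>\<nu>0) = (\<integral>\<^sup>+p. Q (fst p) (snd p) \<partial>(\<nu>0 \<Otimes>\<^sub>M \<Gamma> n))"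
          using G.nn_integral_fst[of "\<lambda>p. Q (fst p) (snd p)" \<nu>0] Qm by (simp add: measurable_cong_sets[OF s refl])
        also have "\<dots> = (\<integral>\<^sup>+\<omega>. Q (l \<omega> 0) (increments B (\<Delta> n) (Suc n) \<omega>) \<partial>N)"
          unfolding \<Gamma>_def jl(2)[symmetric] using nn_integral_distr[OF jl(1)[of n], of "\<lambda>p. Q (fst p) (snd p)"] Qm by simp
        also have "\<dots> \<le> ennreal (c + \<eta>)" using elim by (simp only: Q_def \<Delta>_def)
        finally have costQ: "(\<integral>\<^sup>+x. \<integral>\<^sup>+z. Q x z \<partial>\<Gamma> n \<partial>\<nu>0) \<le> ennreal (c + \<eta>)" .
        have "(\<integral>x. \<integral>z. \<phi> (\<lambda>i. euler (\<Delta> n) b x (\<lambda>i. S *v z i) (k n i)) \<partial>\<Gamma> n \<partial>\<nu>0)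
          \<le> (c + \<eta>) + K0 + ln (\<integral>x. \<integral>z. exp (\<phi> (\<lambda>i. euler (\<Delta> n) f x (\<lambda>i. S *v z i) (k n i))) \<partial>\<Gamma> n \<partial>\<mu>0)"
          unfolding \<Gamma>_def
          by (rule discrete_entropy_bound[where b=b and f=f and k="k n" and n="Suc n" and S=S and S'=S',
                OF ps\<nu> ps\<mu> K0 jl(3) \<Delta>0 S b(2) f(2) \<phi>m \<phi>(2) kn _ costQ[unfolded Q_def \<Gamma>_def]])
            (use c \<eta> in simp)
        also have "(\<integral>x. \<integral>z. \<phi> (\<lambda>i. euler (\<Delta> n) b x (\<lambda>i. S *v z i) (k n i)) \<partial>\<Gamma> n \<partial>\<nu>0) = (\<integral>\<omega>. \<phi> (X n \<omega>) \<partial>N)"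
          using real_transfer[OF jl(2)[folded \<Gamma>_def] jl(1) ps\<nu> euler_functional_measurable[where b=b and k="k n" and \<Delta>="\<Delta> n" and S=S, OF \<phi>m b(2) kn] \<phi>(2)]
          by (simp add: X_def[abs_def])
        also have "(\<integral>x. \<integral>z. exp (\<phi> (\<lambda>i. euler (\<Delta> n) f x (\<lambda>i. S *v z i) (k n i))) \<partial>\<Gamma> n \<partial>\<mu>0) = (\<integral>\<omega>. exp (\<phi> (Y n \<omega>)) \<partial>M)"
          using real_transfer[OF jv(2)[folded \<Gamma>_def] jv(1) ps\<mu> euler_functional_measurable[where b=f and k="k n" and \<Delta>="\<Delta> n" and S=S, OF \<phi>em f(2) kn] \<phi>eb]
          by (simp add: Y_def[abs_def])
        finally show ?case .
      qed
      moreover have "(\<lambda>n. (c + \<eta>) + K0 + ln (\<integral>\<omega>. exp (\<phi> (Y n \<omega>)) \<partial>M)) \<longlonglongrightarrow>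
          (c + \<eta>) + K0 + ln (\<integral>\<omega>. exp (\<phi> (sample_path T (v \<omega>))) \<partial>M)"
        using posY by (intro tendsto_intros limY) auto
      ultimately have "(\<integral>\<omega>. \<phi> (sample_path T (l \<omega>)) \<partial>N) \<le> (c + \<eta>) + K0 + ln (\<integral>\<omega>. exp (\<phi> (sample_path T (v \<omega>))) \<partial>M)"
        using limX by (intro tendsto_le[OF sequentially_bot])
      then show "(\<integral>\<omega>. \<phi> (sample_path T (l \<omega>)) \<partial>N) \<le> c + K0 + ln (\<integral>\<omega>. exp (\<phi> (sample_path T (v \<omega>))) \<partial>M) + \<eta>" by simp
    qed
    then show "(\<integral>x. \<phi> (sample_path T x) \<partial>distr N (path_space T) l)
      \<le> c + K0 + ln (\<integral>x. exp (\<phi> (sample_path T x)) \<partial>distr M (path_space T) v)"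
      by (simp add: integral_distr)
  qed
qed

section \<open>Moments of the fluctuation and size of the cost\<close>

text \<open>The Gronwall bound is raised to an even power. Jensen's inequality treats the average
  over the grid, so n terms bounded by V and weighted by 1/n contribute V, and the estimate does not
  depend on n.\<close>

lemma euler_moment_bound:
  fixes x0 :: "'a \<Rightarrow> 'b::euclidean_space" and \<xi> :: "'a \<Rightarrow> nat \<Rightarrow> 'b"
  assumes A: "\<And>j x. j < n \<Longrightarrow> norm (A (real j * \<Delta>) x) \<le> L * norm x" and L: "L \<ge> 0"
    and n: "n > 0" and \<Delta>: "\<Delta> \<ge> 0" "real n * \<Delta> = T"
    and [measurable]: "x0 \<in> borel_measurable M" and sm: "\<And>i. i \<le> n \<Longrightarrow> (\<lambda>\<omega>. \<Sum>m<i. \<xi> \<omega> m) \<in> borel_measurable M"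
    and V: "V \<ge> 0" "\<And>i. i \<le> n \<Longrightarrow> (\<integral>\<^sup>+\<omega>. ennreal (norm (\<Sum>m<i. \<xi> \<omega> m) ^ (2 * k)) \<partial>M) \<le> ennreal V"
    and V0: "V0 \<ge> 0" "(\<integral>\<^sup>+\<omega>. ennreal (norm (x0 \<omega>) ^ (2 * k)) \<partial>M) \<le> ennreal V0"
    and j: "j \<le> n"
  shows "(\<integral>\<^sup>+\<omega>. ennreal (norm (euler \<Delta> A (x0 \<omega>) (\<xi> \<omega>) j) ^ (2 * k)) \<partial>M)
     \<le> ennreal (3 ^ (2 * k) * (V + exp (L * T) ^ (2 * k) * V0 + (exp (L * T) * L * T) ^ (2 * k) * V))"
proof -
  define s where "s i \<omega> = (\<Sum>m<i. \<xi> \<omega> m)" for i \<omega>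
  have [measurable]: "i \<le> n \<Longrightarrow> s i \<in> borel_measurable M" for i using sm by (simp add: s_def[abs_def])
  define c where "c = exp (L * T)"
  have c: "c \<ge> 0" by (simp add: c_def)
  have T: "T \<ge> 0" using \<Delta> by auto
  define a1 a2 a3 :: real where "a1 = 3 ^ (2 * k)" and "a2 = 3 ^ (2 * k) * c ^ (2 * k)"
    and "a3 = 3 ^ (2 * k) * (c * L * T) ^ (2 * k) / real n"
  have a: "a1 \<ge> 0" "a2 \<ge> 0" "a3 \<ge> 0" using c L T by (auto simp: a1_def a2_def a3_def)
  have ptw: "norm (euler \<Delta> A (x0 \<omega>) (\<xi> \<omega>) j) ^ (2 * k)
     \<le> a1 * norm (s j \<omega>) ^ (2 * k) + a2 * norm (x0 \<omega>) ^ (2 * k) + a3 * (\<Sum>i<n. norm (s i \<omega>) ^ (2 * k))" for \<omega>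
  proof -
    define m where "m = (\<Sum>i<n. norm (s i \<omega>)) / real n"
    have m: "m \<ge> 0" by (simp add: m_def sum_nonneg)
    have "norm (euler \<Delta> A (x0 \<omega>) (\<xi> \<omega>) j) \<le> norm (s j \<omega>)
       + c * (norm (x0 \<omega>) + L * \<Delta> * (\<Sum>i<n. norm (s i \<omega>)))"
      using euler_linear_bound[where A=A and L=L and n=n and \<Delta>=\<Delta> and x="x0 \<omega>" and \<xi>="\<xi> \<omega>", OF A L \<Delta>(1) j] by (simp add: s_def c_def \<Delta>(2))
    also have "\<dots> = norm (s j \<omega>) + c * norm (x0 \<omega>) + c * L * T * m"
      using n by (simp add: m_def \<Delta>(2)[symmetric] algebra_simps)
    finally have "norm (euler \<Delta> A (x0 \<omega>) (\<xi> \<omega>) j) ^ (2 * k)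
       \<le> (norm (s j \<omega>) + c * norm (x0 \<omega>) + c * L * T * m) ^ (2 * k)"
      by (intro power_mono) auto
    also have "\<dots> \<le> 3 ^ (2 * k) * (norm (s j \<omega>) ^ (2 * k) + (c * norm (x0 \<omega>)) ^ (2 * k) + (c * L * T * m) ^ (2 * k))"
      using c L T m by (intro power_sum3) auto
    also have "\<dots> \<le> 3 ^ (2 * k) * (norm (s j \<omega>) ^ (2 * k) + (c * norm (x0 \<omega>)) ^ (2 * k)
        + (c * L * T) ^ (2 * k) * ((\<Sum>i<n. norm (s i \<omega>) ^ (2 * k)) / real n))"
      unfolding power_mult_distrib[of "c * L * T" m]
      by (intro mult_left_mono add_left_mono) (auto simp: m_def intro!: power_mean n)
    also have "\<dots> = a1 * norm (s j \<omega>) ^ (2 * k) + a2 * norm (x0 \<omega>) ^ (2 * k) + a3 * (\<Sum>i<n. norm (s i \<omega>) ^ (2 * k))"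
      by (simp add: a1_def a2_def a3_def power_mult_distrib distrib_left)
    finally show ?thesis .
  qed
  have "(\<integral>\<^sup>+\<omega>. ennreal (norm (euler \<Delta> A (x0 \<omega>) (\<xi> \<omega>) j) ^ (2 * k)) \<partial>M)
     \<le> (\<integral>\<^sup>+\<omega>. ennreal a1 * ennreal (norm (s j \<omega>) ^ (2 * k)) + ennreal a2 * ennreal (norm (x0 \<omega>) ^ (2 * k))
        + ennreal a3 * (\<Sum>i<n. ennreal (norm (s i \<omega>) ^ (2 * k))) \<partial>M)"
    using a by (intro nn_integral_mono)
      (auto simp: sum_nonneg simp flip: ennreal_mult' ennreal_plus intro!: ennreal_leI ptw)
  also have "\<dots> = ennreal a1 * (\<integral>\<^sup>+\<omega>. ennreal (norm (s j \<omega>) ^ (2 * k)) \<partial>M)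
      + ennreal a2 * (\<integral>\<^sup>+\<omega>. ennreal (norm (x0 \<omega>) ^ (2 * k)) \<partial>M)
      + ennreal a3 * (\<Sum>i<n. \<integral>\<^sup>+\<omega>. ennreal (norm (s i \<omega>) ^ (2 * k)) \<partial>M)"
  proof -
    have [measurable]: "s j \<in> borel_measurable M" using j by simp
    have sumM: "(\<lambda>\<omega>. \<Sum>i<n. ennreal (norm (s i \<omega>) ^ (2 * k))) \<in> borel_measurable M"
    proof (intro borel_measurable_sum)
      fix i assume "i \<in> {..<n}"
      then have [measurable]: "s i \<in> borel_measurable M" by simp
      show "(\<lambda>\<omega>. ennreal (norm (s i \<omega>) ^ (2 * k))) \<in> borel_measurable M" by measurable
    qed
    have "(\<integral>\<^sup>+\<omega>. (\<Sum>i<n. ennreal (norm (s i \<omega>) ^ (2 * k))) \<partial>M) = (\<Sum>i<n. \<integral>\<^sup>+\<omega>. ennreal (norm (s i \<omega>) ^ (2 * k)) \<partial>M)"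
    proof (rule nn_integral_sum)
      fix i assume "i \<in> {..<n}"
      then have [measurable]: "s i \<in> borel_measurable M" by simp
      show "(\<lambda>\<omega>. ennreal (norm (s i \<omega>) ^ (2 * k))) \<in> borel_measurable M" by measurable
    qed
    then show ?thesis using sumM by (simp add: nn_integral_add nn_integral_cmult)
  qed
  also have "\<dots> \<le> ennreal a1 * ennreal V + ennreal a2 * ennreal V0 + ennreal a3 * (\<Sum>i<n. ennreal V)"
    using V(2) V0(2) j by (intro add_mono mult_left_mono sum_mono) (auto simp: s_def)
  also have "\<dots> = ennreal (a1 * V + a2 * V0 + a3 * (real n * V))"
    using a V(1) V0(1) by (simp add: ennreal_of_nat_eq_real_of_nat flip: ennreal_mult' ennreal_plus)
  also have "a1 * V + a2 * V0 + a3 * (real n * V)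
      = 3 ^ (2 * k) * (V + exp (L * T) ^ (2 * k) * V0 + (exp (L * T) * L * T) ^ (2 * k) * V)"
    using n by (simp add: a1_def a2_def a3_def c_def algebra_simps)
  finally show ?thesis .
qed

text \<open>For an affine drift the deviation from a noise-free scheme obeys the linear scheme. This
  separates the random fluctuation, whose moments scale with the noise, from the deterministic
  discretisation error.\<close>

lemma euler_affine_diff:
  assumes "\<And>t u w. b t u - b t w = A t (u - w)"
  shows "euler \<Delta> b x \<xi> j - euler \<Delta> b y (\<lambda>_. 0) j = euler \<Delta> A (x - y) \<xi> j"
proof (induction j)
  case (Suc j)
  have "euler \<Delta> b x \<xi> (Suc j) - euler \<Delta> b y (\<lambda>_. 0) (Suc j) = (euler \<Delta> b x \<xi> j - euler \<Delta> b y (\<lambda>_. 0) j)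
     + \<Delta> *\<^sub>R (b (real j * \<Delta>) (euler \<Delta> b x \<xi> j) - b (real j * \<Delta>) (euler \<Delta> b y (\<lambda>_. 0) j)) + \<xi> j"
    by (simp add: algebra_simps)
  also have "\<dots> = euler \<Delta> A (x - y) \<xi> (Suc j)" unfolding assms Suc by simp
  finally show ?case .
qed simp

lemma power_sum2:
  fixes a b :: real
  assumes "a \<ge> 0" "b \<ge> 0"
  shows "(a + b) ^ p \<le> 2 ^ p * (a ^ p + b ^ p)"
proof -
  have "(a + b) ^ p \<le> (2 * max a b) ^ p" using assms by (intro power_mono) auto
  also have "\<dots> = 2 ^ p * max a b ^ p" by (simp add: power_mult_distrib)
  also have "max a b ^ p \<le> a ^ p + b ^ p" using assms by (auto simp: max_def)
  finally show ?thesis by simp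
qed

text \<open>One step costs |S' \<Delta> u|^2 / (2 \<Delta>), which is of order \<Delta>, and n steps
  add up to T. In the application \<open>mh\<close> is the noise-free scheme and \<open>m\<close>
  the ODE solution on the grid, so the distance to \<open>m\<close> is at most |\<zeta>| +
  \<delta>.\<close>

lemma drift_cost_bound:
  fixes S' :: "real ^ 'n::finite ^ 'n" and \<zeta> :: "nat \<Rightarrow> 'a \<Rightarrow> real ^ 'n"
  assumes n: "n > 0" and \<Delta>: "\<Delta> > 0" "real n * \<Delta> = T"
    and \<kappa>: "\<kappa> \<ge> 0" "\<And>y. (norm (S' *v y))\<^sup>2 \<le> \<kappa> * (norm y)\<^sup>2" and C: "C \<ge> 0"
    and rem: "\<And>j x. j < n \<Longrightarrow> norm (u j x) \<le> C * (norm (x - m j) ^ 2 + norm (x - m j) ^ (s + 2))"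
    and \<delta>: "\<delta> \<ge> 0" "\<And>j. j < n \<Longrightarrow> norm (mh j - m j) \<le> \<delta>"
    and \<zeta>: "\<And>j. j < n \<Longrightarrow> \<zeta> j \<in> borel_measurable M"
    and V: "V \<ge> 0" "\<And>j. j < n \<Longrightarrow> (\<integral>\<^sup>+\<omega>. ennreal (norm (\<zeta> j \<omega>) ^ 4) \<partial>M) \<le> ennreal V"
    and V': "V' \<ge> 0" "\<And>j. j < n \<Longrightarrow> (\<integral>\<^sup>+\<omega>. ennreal (norm (\<zeta> j \<omega>) ^ (2 * s + 4)) \<partial>M) \<le> ennreal V'"
    and M: "prob_space M"
  shows "(\<integral>\<^sup>+\<omega>. (\<Sum>j<n. ennreal ((norm (S' *v (\<Delta> *\<^sub>R u j (mh j + \<zeta> j \<omega>))))\<^sup>2 / (2 * \<Delta>))) \<partial>M)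
     \<le> ennreal (T * \<kappa> * C\<^sup>2 * 2 ^ (2 * s + 4) * (V + V' + (\<delta> ^ 4 + \<delta> ^ (2 * s + 4))))"
proof -
  interpret prob_space M by fact
  \<comment> \<open>The 2 from (x + y)^2 \<le> 2 (x^2 + y^2) cancels the one in 2 \<Delta>; the
    power 2^(2s + 4) comes from expanding (|\<zeta>| + \<delta>)^p for p \<le> 2s + 4.\<close>
  define q where "q = \<Delta> * \<kappa> * C\<^sup>2 * 2 ^ (2 * s + 4)"
  have q: "q \<ge> 0" using \<Delta> \<kappa> by (simp add: q_def)
  define d where "d = \<delta> ^ 4 + \<delta> ^ (2 * s + 4)"
  have d: "d \<ge> 0" using \<delta> by (simp add: d_def)
  have ptw: "(norm (S' *v (\<Delta> *\<^sub>R u j (mh j + \<zeta> j \<omega>))))\<^sup>2 / (2 * \<Delta>)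
      \<le> q * (norm (\<zeta> j \<omega>) ^ 4 + norm (\<zeta> j \<omega>) ^ (2 * s + 4) + d)" if j: "j < n" for j \<omega>
  proof -
    define r a where "r = norm (mh j + \<zeta> j \<omega> - m j)" and "a = norm (\<zeta> j \<omega>)"
    have r0: "r \<ge> 0" "a \<ge> 0" by (auto simp: r_def a_def)
    have ra: "r \<le> a + \<delta>"
      using norm_triangle_ineq[of "\<zeta> j \<omega>" "mh j - m j"] \<delta>(2)[OF j] by (simp add: r_def a_def algebra_simps)
    have "(norm (S' *v (\<Delta> *\<^sub>R u j (mh j + \<zeta> j \<omega>))))\<^sup>2 \<le> \<kappa> * (norm (\<Delta> *\<^sub>R u j (mh j + \<zeta> j \<omega>)))\<^sup>2" by (rule \<kappa>)
    also have "\<dots> = \<kappa> * \<Delta>\<^sup>2 * (norm (u j (mh j + \<zeta> j \<omega>)))\<^sup>2" by (simp add: power_mult_distrib)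
    also have "\<dots> \<le> \<kappa> * \<Delta>\<^sup>2 * (C * (r ^ 2 + r ^ (s + 2)))\<^sup>2"
      using rem[OF j, of "mh j + \<zeta> j \<omega>"] \<kappa> by (intro mult_left_mono power_mono) (auto simp: r_def)
    also have "\<dots> = \<kappa> * \<Delta>\<^sup>2 * C\<^sup>2 * (r ^ 2 + r ^ (s + 2))\<^sup>2" by (simp add: power_mult_distrib)
    also have "\<dots> \<le> \<kappa> * \<Delta>\<^sup>2 * C\<^sup>2 * (2 * (r ^ 4 + r ^ (2 * s + 4)))"
    proof (intro mult_left_mono)
      have "(s + 2) * 2 = 2 * s + 4" "(2::nat) * 2 = 4" by simp_all
      then have e: "(r ^ 2)\<^sup>2 = r ^ 4" "(r ^ (s + 2))\<^sup>2 = r ^ (2 * s + 4)"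
        by (metis power_mult)+
      have "(x + y)\<^sup>2 \<le> 2 * (x\<^sup>2 + y\<^sup>2)" for x y :: real
        using sum_squares_bound[of x y] by (simp add: power2_sum)
      from this[of "r ^ 2" "r ^ (s + 2)"] show "(r ^ 2 + r ^ (s + 2))\<^sup>2 \<le> 2 * (r ^ 4 + r ^ (2 * s + 4))"
        unfolding e .
    qed (use \<kappa> in auto)
    also have "\<dots> \<le> \<kappa> * \<Delta>\<^sup>2 * C\<^sup>2 * (2 * (2 ^ (2 * s + 4) * (a ^ 4 + a ^ (2 * s + 4) + d)))"
    proof (intro mult_left_mono)
      have p: "r ^ p \<le> 2 ^ (2 * s + 4) * (a ^ p + \<delta> ^ p)" if "p \<le> 2 * s + 4" for p
      proof -
        have "r ^ p \<le> (a + \<delta>) ^ p" using ra r0 by (intro power_mono)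
        also have "\<dots> \<le> 2 ^ p * (a ^ p + \<delta> ^ p)" using r0 \<delta> by (intro power_sum2)
        also have "\<dots> \<le> 2 ^ (2 * s + 4) * (a ^ p + \<delta> ^ p)"
          using r0 \<delta> that by (intro mult_right_mono power_increasing) auto
        finally show ?thesis .
      qed
      show "r ^ 4 + r ^ (2 * s + 4) \<le> 2 ^ (2 * s + 4) * (a ^ 4 + a ^ (2 * s + 4) + d)"
        using add_mono[OF p[of 4] p[of "2 * s + 4"]] by (simp add: d_def distrib_left)
    qed (use \<kappa> in auto)
    finally have "(norm (S' *v (\<Delta> *\<^sub>R u j (mh j + \<zeta> j \<omega>))))\<^sup>2 / (2 * \<Delta>)
        \<le> \<kappa> * \<Delta>\<^sup>2 * C\<^sup>2 * (2 * (2 ^ (2 * s + 4) * (a ^ 4 + a ^ (2 * s + 4) + d))) / (2 * \<Delta>)"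
      using \<Delta> by (intro divide_right_mono) auto
    also have "\<dots> = q * (a ^ 4 + a ^ (2 * s + 4) + d)"
      using \<Delta> by (simp add: q_def power2_eq_square)
    finally show ?thesis by (simp add: a_def)
  qed
  have one: "(\<integral>\<^sup>+\<omega>. ennreal (q * (norm (\<zeta> j \<omega>) ^ 4 + norm (\<zeta> j \<omega>) ^ (2 * s + 4) + d)) \<partial>M) \<le> ennreal (q * (V + V' + d))"
    if j: "j < n" for j
  proof -
    note \<zeta>[OF j, measurable]
    have "(\<integral>\<^sup>+\<omega>. ennreal (q * (norm (\<zeta> j \<omega>) ^ 4 + norm (\<zeta> j \<omega>) ^ (2 * s + 4) + d)) \<partial>M)
      = (\<integral>\<^sup>+\<omega>. ennreal q * (ennreal (norm (\<zeta> j \<omega>) ^ 4) + ennreal (norm (\<zeta> j \<omega>) ^ (2 * s + 4)) + ennreal d) \<partial>M)"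
      using q d by (intro nn_integral_cong) (simp flip: ennreal_mult' ennreal_plus)
    also have "\<dots> = ennreal q * ((\<integral>\<^sup>+\<omega>. ennreal (norm (\<zeta> j \<omega>) ^ 4) \<partial>M)
        + (\<integral>\<^sup>+\<omega>. ennreal (norm (\<zeta> j \<omega>) ^ (2 * s + 4)) \<partial>M) + ennreal d)"
      by (simp add: nn_integral_cmult nn_integral_add emeasure_space_1)
    also have "\<dots> \<le> ennreal q * (ennreal V + ennreal V' + ennreal d)"
      using V(2)[OF j] V'(2)[OF j] by (intro mult_left_mono add_mono) auto
    also have "\<dots> = ennreal (q * (V + V' + d))" using q d V V' by (simp flip: ennreal_mult' ennreal_plus)
    finally show ?thesis .
  qed
  have "(\<integral>\<^sup>+\<omega>. (\<Sum>j<n. ennreal ((norm (S' *v (\<Delta> *\<^sub>R u j (mh j + \<zeta> j \<omega>))))\<^sup>2 / (2 * \<Delta>))) \<partial>M)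
      \<le> (\<integral>\<^sup>+\<omega>. (\<Sum>j<n. ennreal (q * (norm (\<zeta> j \<omega>) ^ 4 + norm (\<zeta> j \<omega>) ^ (2 * s + 4) + d))) \<partial>M)"
    by (intro nn_integral_mono sum_mono ennreal_leI ptw) auto
  also have "\<dots> = (\<Sum>j<n. \<integral>\<^sup>+\<omega>. ennreal (q * (norm (\<zeta> j \<omega>) ^ 4 + norm (\<zeta> j \<omega>) ^ (2 * s + 4) + d)) \<partial>M)"
  proof (rule nn_integral_sum)
    fix j assume "j \<in> {..<n}"
    then have [measurable]: "\<zeta> j \<in> borel_measurable M" using \<zeta> by simp
    show "(\<lambda>\<omega>. ennreal (q * (norm (\<zeta> j \<omega>) ^ 4 + norm (\<zeta> j \<omega>) ^ (2 * s + 4) + d))) \<in> borel_measurable M" by measurable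
  qed
  also have "\<dots> \<le> (\<Sum>j<n. ennreal (q * (V + V' + d)))" by (intro sum_mono one) auto
  also have "\<dots> = ennreal (real n * (q * (V + V' + d)))"
    using q d V V' by (simp add: ennreal_of_nat_eq_real_of_nat flip: ennreal_mult')
  also have "real n * (q * (V + V' + d)) = T * \<kappa> * C\<^sup>2 * 2 ^ (2 * s + 4) * (V + V' + d)"
    by (simp add: q_def \<Delta>(2)[symmetric])
  finally show ?thesis by (simp add: d_def)
qed

text \<open>Data processing in dual form: a bounded test function composed with g is again one.
  Evaluation at t turns this into the bound for time marginals.\<close>

lemma entropy_bound_distr:
  assumes sets: "sets \<nu> = sets \<mu>" and K: "entropy_bound K \<nu> \<mu>" and g: "g \<in> measurable \<mu> R"
  shows "entropy_bound K (distr \<nu> R g) (distr \<mu> R g)"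
  unfolding entropy_bound_def
proof safe
  fix F :: "_ \<Rightarrow> real" and b assume "F \<in> borel_measurable (distr \<mu> R g)" and b: "\<forall>x. \<bar>F x\<bar> \<le> b"
  then have F[measurable]: "F \<in> borel_measurable R" by simp
  have g': "g \<in> measurable \<nu> R" using g by (simp add: measurable_cong_sets[OF sets refl])
  have Fg: "(\<lambda>x. F (g x)) \<in> borel_measurable \<mu>" using g by measurable
  have "(\<integral>x. F (g x) \<partial>\<nu>) \<le> K + ln (\<integral>x. exp (F (g x)) \<partial>\<mu>)"
    by (rule mp[OF bspec[OF K[unfolded entropy_bound_def] Fg]]) (use b in blast)
  then show "(\<integral>x. F x \<partial>distr \<nu> R g) \<le> K + ln (\<integral>x. exp (F x) \<partial>distr \<mu> R g)"
    using g g' by (simp add: integral_distr)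
qed

text \<open>The increments telescope, so the partial sum is \<open>S\<close> applied to one Gaussian
  vector, with variance i \<Delta> \<le> T in each coordinate; hence a bound uniform in i and
  n.\<close>

lemma noise_moment:
  fixes B :: "real \<Rightarrow> 'b \<Rightarrow> real ^ 'n::finite"
  assumes B: "wiener_process T N B" and n: "n > 0" "real n * \<Delta> = T" "\<Delta> > 0"
    and S: "\<And>x. (norm (S *v x))\<^sup>2 \<le> r * (norm x)\<^sup>2" and r: "r \<ge> 0" and k: "k > 0" and i: "i \<le> n"
  shows "(\<integral>\<^sup>+\<omega>. ennreal (norm (\<Sum>m<i. S *v increments B \<Delta> n \<omega> m) ^ (2 * k)) \<partial>N)
     \<le> ennreal (r ^ k * (real CARD('n) ^ Suc k * (fact (2 * k) / (2 ^ k * fact k)) * T ^ k))"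
proof -
  have sum: "(\<Sum>m<i. S *v increments B \<Delta> n \<omega> m) = S *v (B (real i * \<Delta>) \<omega> - B 0 \<omega>)" for \<omega>
    using i
  proof (induction i)
    case (Suc i)
    then show ?case
      by (simp add: increments_def matrix_vector_mult_diff_distrib)
  qed simp
  have pw: "norm (S *v x) ^ (2 * k) \<le> r ^ k * norm x ^ (2 * k)" for x
    using power_mono[OF S[of x], of k] by (simp add: power_mult power_mult_distrib)
  show ?thesis
  proof (cases "i = 0")
    \<comment> \<open>The empty sum is 0 and its power vanishes because k > 0. The case is separate
      since the Gaussian law is prescribed for increments over a positive time.\<close>
    case True
    then show ?thesis using k by (simp add: power_0_left)
  next
    case False
    have iT: "0 < real i * \<Delta>" "real i * \<Delta> \<le> T"
      using False n i by (auto simp: n(2)[symmetric] mult_right_mono)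
    then have T: "T \<ge> 0" by linarith
    have Bm: "B t \<in> borel_measurable N" if "t \<in> {0..T}" for t using B that by (simp add: wiener_process_def)
    have [measurable]: "(\<lambda>\<omega>. B (real i * \<Delta>) \<omega> - B 0 \<omega>) \<in> borel_measurable N"
      using iT T by (intro borel_measurable_diff Bm) auto
    have g: "is_gaussian 0 (mat (real i * \<Delta> - 0)) (distr N borel (\<lambda>\<omega>. B (real i * \<Delta>) \<omega> - B 0 \<omega>))"
      using B iT unfolding wiener_process_def by blast
    have "(\<integral>\<^sup>+\<omega>. ennreal (norm (\<Sum>m<i. S *v increments B \<Delta> n \<omega> m) ^ (2 * k)) \<partial>N)
       \<le> (\<integral>\<^sup>+\<omega>. ennreal (r ^ k) * ennreal (norm (B (real i * \<Delta>) \<omega> - B 0 \<omega> - 0) ^ (2 * k)) \<partial>N)"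
      unfolding sum using r by (intro nn_integral_mono) (simp add: pw flip: ennreal_mult')
    also have "\<dots> = ennreal (r ^ k) * (\<integral>\<^sup>+\<omega>. ennreal (norm (B (real i * \<Delta>) \<omega> - B 0 \<omega> - 0) ^ (2 * k)) \<partial>N)"
      by (rule nn_integral_cmult) measurable
    also have "(\<integral>\<^sup>+\<omega>. ennreal (norm (B (real i * \<Delta>) \<omega> - B 0 \<omega> - 0) ^ (2 * k)) \<partial>N)
       = (\<integral>\<^sup>+x. ennreal (norm (x - 0) ^ (2 * k)) \<partial>distr N borel (\<lambda>\<omega>. B (real i * \<Delta>) \<omega> - B 0 \<omega>))"
      by (subst nn_integral_distr) auto
    also have "\<dots> \<le> ennreal (real CARD('n) ^ Suc k * (fact (2 * k) / (2 ^ k * fact k)) * T ^ k)"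
      using iT by (intro gaussian_norm_moment[OF g]) (auto simp: mat_def)
    finally show ?thesis using r by (simp add: mult_left_mono flip: ennreal_mult')
  qed
qed

text \<open>The lower bound on the quadratic form makes the square root injective, hence invertible;
  read at \<open>S' *v y\<close> it bounds the inverse.\<close>

lemma matrix_sqrt_inverse:
  fixes A :: "real ^ 'n::finite ^ 'n"
  assumes A: "pos_def A" and c: "c > 0" "\<And>x. c * (norm x)\<^sup>2 \<le> x \<bullet> (A *v x)"
  obtains S' where "\<And>y. matrix_sqrt A *v (S' *v y) = y" "\<And>y. (norm (S' *v y))\<^sup>2 \<le> (1 / c) * (norm y)\<^sup>2"
proof -
  let ?S = "matrix_sqrt A"
  have lower: "c * (norm x)\<^sup>2 \<le> (norm (?S *v x))\<^sup>2" for x using c(2) by (simp add: norm_matrix_sqrt[OF A])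
  have "x = 0" if "?S *v x = 0" for x
  proof -
    have "c * (norm x)\<^sup>2 \<le> 0" using lower[of x] that by simp
    then show ?thesis using c(1) by (simp add: mult_le_0_iff)
  qed
  then obtain S' where "S' ** ?S = mat 1" using matrix_left_invertible_ker[of ?S] by blast
  then have "?S ** S' = mat 1" by (simp add: matrix_left_right_inverse)
  then have inv: "?S *v (S' *v y) = y" for y by (simp add: matrix_vector_mul_assoc)
  moreover have "(norm (S' *v y))\<^sup>2 \<le> (1 / c) * (norm y)\<^sup>2" for y
    using lower[of "S' *v y"] c(1) by (simp add: inv field_simps)
  ultimately show thesis by (rule that)
qed

section \<open>Constants uniform in \<epsilon> and the limit of fine grids\<close>

theorem theorem2p2:
  fixes T :: real
    and f :: "real ^ 'n::finite \<Rightarrow> real ^ 'n"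
    and Sig C0 :: "real ^ 'n ^ 'n"
    and m0 :: "real ^ 'n"
    and m :: "real \<Rightarrow> real ^ 'n"
    and \<mu>0 \<nu>0 :: "real \<Rightarrow> (real ^ 'n) measure"
    and M :: "real \<Rightarrow> 'a measure" and N :: "real \<Rightarrow> 'b measure"
    and W :: "real \<Rightarrow> real \<Rightarrow> 'a \<Rightarrow> real ^ 'n" and B :: "real \<Rightarrow> real \<Rightarrow> 'b \<Rightarrow> real ^ 'n"
    and v :: "real \<Rightarrow> 'a \<Rightarrow> real \<Rightarrow> real ^ 'n" and l :: "real \<Rightarrow> 'b \<Rightarrow> real \<Rightarrow> real ^ 'n"
    and \<mu> \<nu> :: "real \<Rightarrow> (real \<Rightarrow> real ^ 'n) measure"
  assumes "T > 0"
    and "pos_def Sig"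
    and "standing_assumption T f"
    and "pos_semidef C0"
    and "ode_solution T f m0 m"
    and "\<And>\<epsilon>. \<epsilon> > 0 \<Longrightarrow> prob_space (\<mu>0 \<epsilon>) \<and> sets (\<mu>0 \<epsilon>) = sets borel"
    and "\<And>\<epsilon>. \<epsilon> > 0 \<Longrightarrow> is_gaussian m0 (\<epsilon> *\<^sub>R C0) (\<nu>0 \<epsilon>)"
    and "\<And>\<epsilon>. \<epsilon> > 0 \<Longrightarrow>
           sde_solution T (\<lambda>t x. f x) (matrix_sqrt (\<epsilon> *\<^sub>R Sig)) (\<mu>0 \<epsilon>) (M \<epsilon>) (W \<epsilon>) (v \<epsilon>)"
    and "\<And>\<epsilon>. \<epsilon> > 0 \<Longrightarrow>
           sde_solution T (\<lambda>t x. f (m t) + jacobian f (at (m t)) *v (x - m t))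
             (matrix_sqrt (\<epsilon> *\<^sub>R Sig)) (\<nu>0 \<epsilon>) (N \<epsilon>) (B \<epsilon>) (l \<epsilon>)"
    and "\<And>\<epsilon>. \<epsilon> > 0 \<Longrightarrow> \<mu> \<epsilon> = distr (M \<epsilon>) (path_space T) (v \<epsilon>)"
    and "\<And>\<epsilon>. \<epsilon> > 0 \<Longrightarrow> \<nu> \<epsilon> = distr (N \<epsilon>) (path_space T) (l \<epsilon>)"
  shows "\<exists>c>0. \<forall>\<^sub>F \<epsilon> in at_right 0.
           KL (\<nu> \<epsilon>) (\<mu> \<epsilon>) \<le> KL (\<nu>0 \<epsilon>) (\<mu>0 \<epsilon>) + ereal (c * \<epsilon>) \<and>
           (\<forall>t\<in>{0..T}. KL (time_marginal t (\<nu> \<epsilon>)) (time_marginal t (\<mu> \<epsilon>))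
                        \<le> KL (\<nu>0 \<epsilon>) (\<mu>0 \<epsilon>) + ereal (c * \<epsilon>))"
proof -
  have T: "T > 0" and Sig: "pos_def Sig" and sa: "standing_assumption T f" and C0: "pos_semidef C0"
    and ode: "ode_solution T f m0 m"
    using assms(1-5) by auto
  obtain cf s where f: "\<And>d. C_class 2 (\<lambda>x. f x $ d)" and cf: "cf > 0"
    and bound: "\<And>d i j u. \<bar>partial i (partial j (\<lambda>x. f x $ d)) u\<bar> \<le> cf * (1 + norm u ^ s)"
    using sa unfolding standing_assumption_def by blast
  have m_0: "m 0 = m0" and m_deriv: "\<And>t. t \<in> {0..T} \<Longrightarrow> (m has_vector_derivative f (m t)) (at t within {0..T})"
    using ode by (auto simp: ode_solution_def)
  have m_cont: "continuous_on {0..T} m"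
    using m_deriv by (intro continuous_on_vector_derivative) auto
  have "bounded (m ` {0..T})" using m_cont by (intro compact_imp_bounded compact_continuous_image) auto
  then obtain R where "\<forall>x\<in>m ` {0..T}. norm x \<le> R" unfolding bounded_iff by blast
  then have R: "\<And>t. t \<in> {0..T} \<Longrightarrow> norm (m t) \<le> R" by blast
  obtain C where C: "C \<ge> 0" "\<And>x y. norm y \<le> R \<Longrightarrow>
    norm (f x - f y - jacobian f (at y) *v (x - y)) \<le> C * (norm (x - y) ^ 2 + norm (x - y) ^ (s + 2))"
    using Taylor_remainder[OF f cf bound] by blast
  obtain L where L: "L \<ge> 0" "\<And>y h. norm y \<le> R \<Longrightarrow> norm (jacobian f (at y) *v h) \<le> L * norm h"
    using jacobian_bounded[OF f] by blast
  define A where "A t x = jacobian f (at (m t)) *v x" for t x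
  define b where "b t x = f (m t) + A t (x - m t)" for t x
  have A_bound: "norm (A t x) \<le> L * norm x" if "t \<in> {0..T}" for t x
    unfolding A_def by (rule L(2)[OF R[OF that]])
  have b_diff: "b t u - b t w = A t (u - w)" for t u w
    by (simp add: b_def A_def matrix_vector_mult_diff_distrib)
  have b_m: "b t (m t) = f (m t)" for t by (simp add: b_def A_def)
  have b_f: "norm (b t x - f x) \<le> C * (norm (x - m t) ^ 2 + norm (x - m t) ^ (s + 2))" if "t \<in> {0..T}" for t x
  proof -
    have "b t x - f x = - (f x - f (m t) - jacobian f (at (m t)) *v (x - m t))" by (simp add: b_def A_def)
    then show ?thesis using C(2)[OF R[OF that], of x] by (metis norm_minus_cancel)
  qed
  have fm_cont: "continuous_on {0..T} (\<lambda>t. f (h t))" if "continuous_on {0..T} h" for h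
    by (rule continuous_on_compose2[OF continuous_on_jacobian(2)[OF f] that]) auto
  have b1: "continuous_on {0..T} (\<lambda>t. b t (h t))" if "continuous_on {0..T} h" for h
    unfolding b_def A_def
    by (intro continuous_on_add fm_cont continuous_on_jacobian_mult[OF f] continuous_on_diff m_cont that)
  have b2: "continuous_on UNIV (b t)" for t
    unfolding b_def A_def
    by (intro continuous_on_add continuous_on_const
       continuous_on_compose2[OF linear_continuous_on[OF matrix_vector_mul_bounded_linear]] continuous_on_diff continuous_on_id) auto
  have f2: "continuous_on UNIV f" by (rule continuous_on_jacobian(2)[OF f])
  have lip_b: "\<exists>L\<ge>0. \<forall>t\<in>{0..T}. \<forall>x y. norm y \<le> R \<longrightarrow> norm (x - y) \<le> 1 \<longrightarrow> norm (b t x - b t y) \<le> L * norm (x - y)" for R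
    unfolding b_diff using A_bound L(1) by blast
  have lip_f: "\<exists>L\<ge>0. \<forall>t\<in>{0..T}. \<forall>x y. norm y \<le> R \<longrightarrow> norm (x - y) \<le> 1 \<longrightarrow> norm (f x - f y) \<le> L * norm (x - y)" for R
    using locally_Lipschitz[OF f cf bound, of R] by metis
  have m_int: "m t = m 0 + integral {0..t} (\<lambda>r. b r (m r)) + 0" if "t \<in> {0..T}" for t
  proof -
    have "((\<lambda>r. f (m r)) has_integral m t - m 0) {0..t}"
      using that by (intro fundamental_theorem_of_calculus has_vector_derivative_within_subset[OF m_deriv]) auto
    then show ?thesis by (simp add: b_m integral_unique)
  qed
  \<comment> \<open>The linearised drift agrees with f along m, so m solves the linearised equation
    without noise and the corresponding scheme converges to it.\<close>
  have m_euler: "\<exists>N. \<forall>n\<ge>N. \<forall>j\<le>n. norm (euler (T / real n) b m0 (\<lambda>_. 0) j - m (real j * (T / real n))) \<le> e" if "e > 0" for e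
    using euler_converges[where g=b and y=m and w="\<lambda>_. 0", OF T L(1) m_int b1[OF m_cont] _ that] A_bound
    by (simp add: b_diff m_0)
  obtain cS where cS: "cS > 0" "\<And>x. cS * (norm x)\<^sup>2 \<le> x \<bullet> (Sig *v x)" using pos_def_lower_bound[OF Sig] by blast
  obtain Lam where Lam: "Lam > 0" "\<And>x. norm (Sig *v x) \<le> norm x * Lam"
    using bounded_linear.pos_bounded[OF matrix_vector_mul_bounded_linear[of Sig]] by blast
  have Sig_upper: "x \<bullet> (Sig *v x) \<le> Lam * (norm x)\<^sup>2" for x
  proof -
    have "x \<bullet> (Sig *v x) \<le> norm x * norm (Sig *v x)" by (rule norm_cauchy_schwarz)
    also have "\<dots> \<le> norm x * (norm x * Lam)" using Lam(2) by (intro mult_left_mono) auto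
    finally show ?thesis by (simp add: power2_eq_square mult_ac)
  qed
  have C0_diag: "0 \<le> C0 $ i $ i" for i
    unfolding matrix_entry_inner[of C0] using C0 by (simp add: pos_semidef_def)
  \<comment> \<open>The trace of C0 dominates its diagonal entries, which are the initial variances
    up to the factor \<epsilon>.\<close>
  define w0 where "w0 = (\<Sum>i\<in>UNIV. C0 $ i $ i)"
  have w0: "0 \<le> w0" "C0 $ i $ i \<le> w0" for i
    unfolding w0_def by (auto intro!: sum_nonneg member_le_sum C0_diag)
  define ck :: "nat \<Rightarrow> real" where "ck k = real CARD('n) ^ Suc k * (fact (2 * k) / (2 ^ k * fact k))" for k
  have ck: "ck k \<ge> 0" for k by (simp add: ck_def)
  \<comment> \<open>The bound of \<open>euler_moment_bound\<close> at \<epsilon> = 1. Initial and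
    noise moments both scale like \<epsilon>^k, so the moment of order 2k is at most
    \<open>Mk k\<close> times \<epsilon>^k.\<close>
  define Mk where "Mk k = 3 ^ (2 * k) * (Lam ^ k * (ck k * T ^ k) + exp (L * T) ^ (2 * k) * (ck k * w0 ^ k)
     + (exp (L * T) * L * T) ^ (2 * k) * (Lam ^ k * (ck k * T ^ k)))" for k
  have Mk: "Mk k \<ge> 0" for k
    using T L Lam w0 ck by (auto simp: Mk_def intro!: mult_nonneg_nonneg add_nonneg_nonneg)
  \<comment> \<open>The prefactor of \<open>drift_cost_bound\<close>, with the 1/\<epsilon> from the
    squared norm of the inverse square root taken out.\<close>
  define G where "G = T * (1 / cS) * C\<^sup>2 * 2 ^ (2 * s + 4)"
  have G: "G \<ge> 0" using T cS by (simp add: G_def)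
  \<comment> \<open>The moments of order 4 and 2s + 4 correspond to k = 2 and k = s + 2. The summand
    1 makes c positive even if G is 0.\<close>
  define c where "c = G * (Mk 2 + Mk (s + 2)) + 1"
  have c: "c > 0" using G Mk[of 2] Mk[of "s + 2"] by (simp add: c_def add_nonneg_pos)
  have main: "entropy_bound (c * \<epsilon> + K0) (\<nu> \<epsilon>) (\<mu> \<epsilon>)"
    if \<epsilon>: "0 < \<epsilon>" "\<epsilon> < 1" and K0: "entropy_bound K0 (\<nu>0 \<epsilon>) (\<mu>0 \<epsilon>)" for \<epsilon> K0
  proof -
    define S where "S = matrix_sqrt (\<epsilon> *\<^sub>R Sig)"
    have pd: "pos_def (\<epsilon> *\<^sub>R Sig)" by (rule pos_def_scaleR[OF Sig \<epsilon>(1)])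
    have quad: "x \<bullet> ((\<epsilon> *\<^sub>R Sig) *v x) = \<epsilon> * (x \<bullet> (Sig *v x))" for x
      by (simp add: scaleR_matrix_vector_assoc[symmetric])
    have S_upper: "(norm (S *v x))\<^sup>2 \<le> (\<epsilon> * Lam) * (norm x)\<^sup>2" for x
      using Sig_upper[of x] \<epsilon> unfolding S_def norm_matrix_sqrt[OF pd] quad by (simp add: mult.assoc mult_left_mono)
    obtain S' where S': "\<And>y. S *v (S' *v y) = y" "\<And>y. (norm (S' *v y))\<^sup>2 \<le> (1 / (\<epsilon> * cS)) * (norm y)\<^sup>2"
    proof (rule matrix_sqrt_inverse[OF pd, of "\<epsilon> * cS"])
      show "0 < \<epsilon> * cS" using \<epsilon> cS by simp
      show "\<epsilon> * cS * (norm x)\<^sup>2 \<le> x \<bullet> ((\<epsilon> *\<^sub>R Sig) *v x)" for x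
        unfolding quad using cS(2)[of x] \<epsilon> by (simp add: mult.assoc mult_left_mono)
    qed (use that in \<open>auto simp: S_def\<close>)
    have v: "sde_solution T (\<lambda>t. f) S (\<mu>0 \<epsilon>) (M \<epsilon>) (W \<epsilon>) (v \<epsilon>)"
      using assms(8)[OF \<epsilon>(1)] by (simp add: S_def)
    have l: "sde_solution T b S (\<nu>0 \<epsilon>) (N \<epsilon>) (B \<epsilon>) (l \<epsilon>)"
      using assms(9)[OF \<epsilon>(1)] by (simp add: S_def b_def[abs_def] A_def)
    interpret N: prob_space "N \<epsilon>" using l by (simp add: sde_solution_def)
    have wp: "wiener_process T (N \<epsilon>) (B \<epsilon>)" and lm: "l \<epsilon> \<in> measurable (N \<epsilon>) (path_space T)"
      and l0_law: "distr (N \<epsilon>) borel (\<lambda>\<omega>. l \<epsilon> \<omega> 0) = \<nu>0 \<epsilon>"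
      using l by (auto simp: sde_solution_def)
    have l0: "(\<lambda>\<omega>. l \<epsilon> \<omega> 0) \<in> borel_measurable (N \<epsilon>)"
      using T by (intro measurable_compose[OF lm measurable_path_eval]) auto
    have x0m: "(\<lambda>\<omega>. l \<epsilon> \<omega> 0 - m0) \<in> borel_measurable (N \<epsilon>)" using l0 by measurable
    have Bm: "B \<epsilon> t \<in> borel_measurable (N \<epsilon>)" if "t \<in> {0..T}" for t
      using wp that by (simp add: wiener_process_def)
    have x0_moment: "(\<integral>\<^sup>+\<omega>. ennreal (norm (l \<epsilon> \<omega> 0 - m0) ^ (2 * k)) \<partial>N \<epsilon>) \<le> ennreal (ck k * (\<epsilon> * w0) ^ k)" for k
    proof -
      have "(\<integral>\<^sup>+\<omega>. ennreal (norm (l \<epsilon> \<omega> 0 - m0) ^ (2 * k)) \<partial>N \<epsilon>) = (\<integral>\<^sup>+x. ennreal (norm (x - m0) ^ (2 * k)) \<partial>\<nu>0 \<epsilon>)"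
        unfolding l0_law[symmetric] using l0 by (subst nn_integral_distr) auto
      also have "\<dots> \<le> ennreal (ck k * (\<epsilon> * w0) ^ k)"
        unfolding ck_def using C0_diag w0 \<epsilon>
        by (intro gaussian_norm_moment[OF assms(7)[OF \<epsilon>(1)]]) (auto intro: mult_left_mono)
      finally show ?thesis .
    qed
    have moment: "(\<integral>\<^sup>+\<omega>. ennreal (norm (euler \<Delta> A (l \<epsilon> \<omega> 0 - m0) (\<lambda>i. S *v increments (B \<epsilon>) \<Delta> n \<omega> i) j) ^ (2 * k)) \<partial>N \<epsilon>)
        \<le> ennreal (Mk k * \<epsilon> ^ k)"
      and measurable_deviation: "(\<lambda>\<omega>. euler \<Delta> A (l \<epsilon> \<omega> 0 - m0) (\<lambda>i. S *v increments (B \<epsilon>) \<Delta> n \<omega> i) j) \<in> borel_measurable (N \<epsilon>)"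
      if n: "n > 0" "real n * \<Delta> = T" "\<Delta> > 0" and j: "j \<le> n" and k: "k > 0" for n \<Delta> j k
    proof -
      have incm: "(\<lambda>\<omega>. increments (B \<epsilon>) \<Delta> n \<omega> i) \<in> borel_measurable (N \<epsilon>)" if "i < n" for i
        using grid_points[OF n that] that unfolding increments_def
        by (simp del: of_nat_Suc) (intro borel_measurable_diff Bm, auto)
      have contA: "continuous_on UNIV (A t)" for t
        unfolding A_def by (intro linear_continuous_on matrix_vector_mul_bounded_linear)
      show "(\<lambda>\<omega>. euler \<Delta> A (l \<epsilon> \<omega> 0 - m0) (\<lambda>i. S *v increments (B \<epsilon>) \<Delta> n \<omega> i) j) \<in> borel_measurable (N \<epsilon>)"
        by (rule measurable_euler[OF contA x0m]) (use j incm in auto)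
      have "(\<integral>\<^sup>+\<omega>. ennreal (norm (euler \<Delta> A (l \<epsilon> \<omega> 0 - m0) (\<lambda>i. S *v increments (B \<epsilon>) \<Delta> n \<omega> i) j) ^ (2 * k)) \<partial>N \<epsilon>)
        \<le> ennreal (3 ^ (2 * k) * ((\<epsilon> * Lam) ^ k * (ck k * T ^ k) + exp (L * T) ^ (2 * k) * (ck k * (\<epsilon> * w0) ^ k)
          + (exp (L * T) * L * T) ^ (2 * k) * ((\<epsilon> * Lam) ^ k * (ck k * T ^ k))))"
      proof (rule euler_moment_bound[OF _ L(1) n(1) less_imp_le[OF n(3)] n(2) x0m _ _ _ _ x0_moment j])
        show "norm (A (real j * \<Delta>) x) \<le> L * norm x" if "j < n" for j x
          by (rule A_bound[OF grid_points(1)[OF n that]])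
        show "(\<lambda>\<omega>. \<Sum>m<i. S *v increments (B \<epsilon>) \<Delta> n \<omega> m) \<in> borel_measurable (N \<epsilon>)" if "i \<le> n" for i
          using that by (intro borel_measurable_sum measurable_matrix_mult incm) auto
        show "(\<integral>\<^sup>+\<omega>. ennreal (norm (\<Sum>m<i. S *v increments (B \<epsilon>) \<Delta> n \<omega> m) ^ (2 * k)) \<partial>N \<epsilon>)
           \<le> ennreal ((\<epsilon> * Lam) ^ k * (ck k * T ^ k))" if "i \<le> n" for i
          unfolding ck_def using \<epsilon> Lam by (intro noise_moment[OF wp n S_upper _ k that]) auto
        show "0 \<le> (\<epsilon> * Lam) ^ k * (ck k * T ^ k)" "0 \<le> ck k * (\<epsilon> * w0) ^ k"
          using \<epsilon> Lam ck T w0 by auto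
      qed
      also have "3 ^ (2 * k) * ((\<epsilon> * Lam) ^ k * (ck k * T ^ k) + exp (L * T) ^ (2 * k) * (ck k * (\<epsilon> * w0) ^ k)
          + (exp (L * T) * L * T) ^ (2 * k) * ((\<epsilon> * Lam) ^ k * (ck k * T ^ k))) = Mk k * \<epsilon> ^ k"
        by (simp only: Mk_def power_mult_distrib[of \<epsilon>]) (simp add: algebra_simps)
      finally show "(\<integral>\<^sup>+\<omega>. ennreal (norm (euler \<Delta> A (l \<epsilon> \<omega> 0 - m0) (\<lambda>i. S *v increments (B \<epsilon>) \<Delta> n \<omega> i) j) ^ (2 * k)) \<partial>N \<epsilon>)
        \<le> ennreal (Mk k * \<epsilon> ^ k)" .
    qed
    have cost: "\<forall>\<^sub>F n in sequentially.
      (\<integral>\<^sup>+\<omega>. (\<Sum>j<Suc n. ennreal ((norm (S' *v ((T / real (Suc n)) *\<^sub>R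
        (b (real j * (T / real (Suc n))) (euler (T / real (Suc n)) b (l \<epsilon> \<omega> 0) (\<lambda>i. S *v increments (B \<epsilon>) (T / real (Suc n)) (Suc n) \<omega> i) j)
       - f (euler (T / real (Suc n)) b (l \<epsilon> \<omega> 0) (\<lambda>i. S *v increments (B \<epsilon>) (T / real (Suc n)) (Suc n) \<omega> i) j)))))\<^sup>2
        / (2 * (T / real (Suc n))))) \<partial>N \<epsilon>) \<le> ennreal (c * \<epsilon> + \<eta>)" if \<eta>: "\<eta> > 0" for \<eta>
    proof -
      \<comment> \<open>Makes the deterministic error harmless, 2 G \<delta> / \<epsilon> \<le>
        \<eta>, with 2 G + 1 in the denominator in case G is 0. The minimum with 1 allows its powers
        to be bounded by \<delta> itself.\<close>
      define \<delta> where "\<delta> = min 1 (\<eta> * \<epsilon> / (2 * G + 1))"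
      have \<delta>: "0 < \<delta>" "\<delta> \<le> 1" "\<delta> \<le> \<eta> * \<epsilon> / (2 * G + 1)" using \<eta> \<epsilon> G by (auto simp: \<delta>_def)
      obtain N0 where N0: "\<And>n j. n \<ge> N0 \<Longrightarrow> j \<le> n \<Longrightarrow> norm (euler (T / real n) b m0 (\<lambda>_. 0) j - m (real j * (T / real n))) \<le> \<delta>"
        using m_euler[OF \<delta>(1)] by blast
      show ?thesis
        using eventually_ge_at_top[of N0]
      proof eventually_elim
        case (elim n)
        define \<Delta> where "\<Delta> = T / real (Suc n)"
        have grid: "0 < Suc n" "real (Suc n) * \<Delta> = T" "\<Delta> > 0" using T by (auto simp: \<Delta>_def)
        define \<zeta> where "\<zeta> j \<omega> = euler \<Delta> A (l \<epsilon> \<omega> 0 - m0) (\<lambda>i. S *v increments (B \<epsilon>) \<Delta> (Suc n) \<omega> i) j" for j \<omega>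
        \<comment> \<open>The noise-free scheme from m0 plus the linear fluctuation \<zeta>, which
          carries both the noise and the random initial deviation.\<close>
        have decomp: "euler \<Delta> b (l \<epsilon> \<omega> 0) (\<lambda>i. S *v increments (B \<epsilon>) \<Delta> (Suc n) \<omega> i) j = euler \<Delta> b m0 (\<lambda>_. 0) j + \<zeta> j \<omega>" for j \<omega>
          unfolding \<zeta>_def euler_affine_diff[of b A, OF b_diff, symmetric] by simp
        have "(\<integral>\<^sup>+\<omega>. (\<Sum>j<Suc n. ennreal ((norm (S' *v (\<Delta> *\<^sub>R (\<lambda>j x. b (real j * \<Delta>) x - f x) j (euler \<Delta> b m0 (\<lambda>_. 0) j + \<zeta> j \<omega>))))\<^sup>2 / (2 * \<Delta>))) \<partial>N \<epsilon>)
          \<le> ennreal (T * (1 / (\<epsilon> * cS)) * C\<^sup>2 * 2 ^ (2 * s + 4) * (Mk 2 * \<epsilon> ^ 2 + Mk (s + 2) * \<epsilon> ^ (s + 2) + (\<delta> ^ 4 + \<delta> ^ (2 * s + 4))))"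
        proof (rule drift_cost_bound[where m="\<lambda>j. m (real j * \<Delta>)" and \<zeta>=\<zeta>, OF grid(1) grid(3) grid(2) _ S'(2) C(1)])
          show "0 \<le> 1 / (\<epsilon> * cS)" using \<epsilon> cS by simp
          fix j assume j: "j < Suc n"
          show "norm (b (real j * \<Delta>) x - f x) \<le> C * (norm (x - m (real j * \<Delta>)) ^ 2 + norm (x - m (real j * \<Delta>)) ^ (s + 2))" for x
            by (rule b_f[OF grid_points(1)[OF grid j]])
          show "norm (euler \<Delta> b m0 (\<lambda>_. 0) j - m (real j * \<Delta>)) \<le> \<delta>"
            unfolding \<Delta>_def by (rule N0) (use elim j in auto)
          show "\<zeta> j \<in> borel_measurable (N \<epsilon>)"
            unfolding \<zeta>_def[abs_def] by (rule measurable_deviation[OF grid, of _ 1]) (use j in auto)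
          show "(\<integral>\<^sup>+\<omega>. ennreal (norm (\<zeta> j \<omega>) ^ 4) \<partial>N \<epsilon>) \<le> ennreal (Mk 2 * \<epsilon> ^ 2)"
            using moment[OF grid, of j 2] j by (simp add: \<zeta>_def)
          have "2 * (s + 2) = 2 * s + 4" by simp
          then show "(\<integral>\<^sup>+\<omega>. ennreal (norm (\<zeta> j \<omega>) ^ (2 * s + 4)) \<partial>N \<epsilon>) \<le> ennreal (Mk (s + 2) * \<epsilon> ^ (s + 2))"
            using moment[OF grid, of j "s + 2"] j unfolding \<zeta>_def by (metis add_gr_0 less_imp_le zero_less_numeral)
        qed (use \<delta> Mk \<epsilon> N.prob_space_axioms in \<open>auto intro!: mult_nonneg_nonneg\<close>)
        also have "T * (1 / (\<epsilon> * cS)) * C\<^sup>2 * 2 ^ (2 * s + 4) * (Mk 2 * \<epsilon> ^ 2 + Mk (s + 2) * \<epsilon> ^ (s + 2) + (\<delta> ^ 4 + \<delta> ^ (2 * s + 4)))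
          = (G / \<epsilon>) * (Mk 2 * \<epsilon> ^ 2 + Mk (s + 2) * \<epsilon> ^ (s + 2) + (\<delta> ^ 4 + \<delta> ^ (2 * s + 4)))"
          by (simp add: G_def)
        \<comment> \<open>Higher powers are reduced by \<epsilon> < 1 and \<delta> \<le> 1; the
          prefactor G/\<epsilon> against \<epsilon>^2 leaves the rate \<epsilon>.\<close>
        also have "\<dots> \<le> (G / \<epsilon>) * (Mk 2 * \<epsilon> ^ 2 + Mk (s + 2) * \<epsilon> ^ 2 + (\<delta> + \<delta>))"
        proof -
          have "\<epsilon> ^ (s + 2) \<le> \<epsilon> ^ 2" using \<epsilon> by (intro power_decreasing) auto
          moreover have "\<delta> ^ 4 \<le> \<delta> ^ 1" "\<delta> ^ (2 * s + 4) \<le> \<delta> ^ 1" using \<delta> by (intro power_decreasing; simp)+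
          ultimately show ?thesis using G \<epsilon> Mk by (intro mult_left_mono add_mono) auto
        qed
        also have "\<dots> = G * (Mk 2 + Mk (s + 2)) * \<epsilon> + G * 2 * (\<delta> / \<epsilon>)"
          using \<epsilon> by (simp add: field_simps power2_eq_square)
        also have "\<dots> \<le> c * \<epsilon> + \<eta>"
        proof (rule add_mono)
          show "G * (Mk 2 + Mk (s + 2)) * \<epsilon> \<le> c * \<epsilon>" using \<epsilon> by (intro mult_right_mono) (auto simp: c_def)
          have "G * 2 * (\<delta> / \<epsilon>) \<le> G * 2 * (\<eta> / (2 * G + 1))"
            using \<delta>(3) \<epsilon> G by (intro mult_left_mono) (auto simp: field_simps)
          also have "\<dots> \<le> \<eta>" using \<eta> G by (simp add: field_simps)
          finally show "G * 2 * (\<delta> / \<epsilon>) \<le> \<eta>" .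
        qed
        finally show ?case unfolding \<Delta>_def[symmetric] decomp by (simp add: ennreal_leI order_trans)
      qed
    qed
    have "entropy_bound (c * \<epsilon> + K0) (distr (N \<epsilon>) (path_space T) (l \<epsilon>)) (distr (M \<epsilon>) (path_space T) (v \<epsilon>))"
      by (rule sde_entropy_bound[where f="\<lambda>t. f" and b=b, OF T v l K0 S'(1) b1 b2 fm_cont f2 lip_b lip_f _ cost])
        (use c \<epsilon> in auto)
    then show ?thesis using assms(10,11)[OF \<epsilon>(1)] by simp
  qed
  have "\<forall>\<^sub>F \<epsilon> in at_right 0. KL (\<nu> \<epsilon>) (\<mu> \<epsilon>) \<le> KL (\<nu>0 \<epsilon>) (\<mu>0 \<epsilon>) + ereal (c * \<epsilon>) \<and>
           (\<forall>t\<in>{0..T}. KL (time_marginal t (\<nu> \<epsilon>)) (time_marginal t (\<mu> \<epsilon>))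
                        \<le> KL (\<nu>0 \<epsilon>) (\<mu>0 \<epsilon>) + ereal (c * \<epsilon>))"
    using eventually_at_right_real[of 0 1, OF zero_less_one]
  proof eventually_elim
    case (elim \<epsilon>)
    then have \<epsilon>: "0 < \<epsilon>" "\<epsilon> < 1" by auto
    \<comment> \<open>An infinite initial divergence makes the right-hand sides infinite; otherwise
      it is a real number and can serve as K0.\<close>
    show ?case
    proof (cases "KL (\<nu>0 \<epsilon>) (\<mu>0 \<epsilon>) = \<infinity>")
      case False
      define K0 where "K0 = KL_divergence (exp 1) (\<mu>0 \<epsilon>) (\<nu>0 \<epsilon>)"
      have KL0: "KL (\<nu>0 \<epsilon>) (\<mu>0 \<epsilon>) = ereal K0" using False by (auto simp: KL_def K0_def split: if_splits)
      have "entropy_bound K0 (\<nu>0 \<epsilon>) (\<mu>0 \<epsilon>)"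
        unfolding K0_def using assms(6,7)[OF \<epsilon>(1)] False
        by (intro KL_imp_entropy_bound) (auto simp: is_gaussian_def)
      then have eb: "entropy_bound (c * \<epsilon> + K0) (\<nu> \<epsilon>) (\<mu> \<epsilon>)" by (rule main[OF \<epsilon>])
      have ps: "prob_space (\<nu> \<epsilon>)" "prob_space (\<mu> \<epsilon>)" and sets: "sets (\<nu> \<epsilon>) = sets (path_space T)" "sets (\<mu> \<epsilon>) = sets (path_space T)"
        using assms(8,9)[OF \<epsilon>(1)] unfolding assms(10,11)[OF \<epsilon>(1)] sde_solution_def
        by (auto intro!: prob_space.prob_space_distr)
      have "KL (\<nu> \<epsilon>) (\<mu> \<epsilon>) \<le> ereal (c * \<epsilon> + K0)"
        using ps sets eb by (intro entropy_bound_imp_KL_le) auto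
      moreover have "KL (time_marginal t (\<nu> \<epsilon>)) (time_marginal t (\<mu> \<epsilon>)) \<le> ereal (c * \<epsilon> + K0)" if t: "t \<in> {0..T}" for t
      proof -
        have g: "(\<lambda>h. h t) \<in> borel_measurable (\<mu> \<epsilon>)" "(\<lambda>h. h t) \<in> borel_measurable (\<nu> \<epsilon>)"
          using measurable_path_eval[OF t] by (auto simp: measurable_cong_sets[OF sets(1) refl] measurable_cong_sets[OF sets(2) refl])
        show ?thesis unfolding time_marginal_def
          by (intro entropy_bound_imp_KL_le entropy_bound_distr[OF _ eb g(1)] prob_space.prob_space_distr[OF ps(1) g(2)]
            prob_space.prob_space_distr[OF ps(2) g(1)]) (auto simp: sets)
      qed
      ultimately show ?thesis by (simp add: KL0 add.commute)
    qed simp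
  qed
  then show ?thesis using c by blast
qed

end
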